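(* Let $\alpha$ be the asymptotic density of the set $S$ of positive integers $n$ with the following property: there exist conjugacy classes $C$ and $D$ of $A_n$, each consisting of elements of prime order, such that $\langle c,d\rangle=A_n$ for every $(c,d)\in C\times D$. Let $\rho$ be the Dickman–de Bruijn function. Then (A) $\alpha\ge 1-\rho(20)>1-10^{-28}$; and (B) if the Riemann Hypothesis holds, then $\alpha=1$; and if the Cramér Conjecture holds, then $\alpha=1$.
   Context: $A_n$ is the alternating group on $\{1,\dots,n\}$. The asymptotic density of a set $S$ of positive integers is $\liminf_{M\to\infty}|S\cap\{1,\dots,M\}|/M$. The Dickman–de Bruijn function $\rho:[0,\infty)\to\mathbb{R}$ is the continuous function with $\rho(u)=1$ for $0\le u\le 1$ and $u\rho'(u)+\rho(u-1)=0$ for $u>1$. Writing $p_k$ for the $k$-th smallest prime, the Cramér Conjecture is the statement that there is a constant $C$ such that $p_{k+1}-p_k\le C\log^2 p_k$ for all $k$. *)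

theory Defs
  imports
    "HOL-Complex_Analysis.Complex_Analysis"
    "HOL-Algebra.Sym_Groups"
    "HOL-Algebra.Group_Action"
    "HOL-Algebra.Multiplicative_Group"
    "HOL-Library.Infinite_Set"
    "HOL-Library.Liminf_Limsup"
    "HOL-Computational_Algebra.Primes"
begin

text \<open>The action is the one of \<open>group.action_by_conjugation\<close>.\<close>

definition conjugacy_classes :: "('a, 'b) monoid_scheme \<Rightarrow> 'a set set" where
  "conjugacy_classes G =
     orbits G (carrier G) (\<lambda>g. \<lambda>h \<in> carrier G. g \<otimes>\<^bsub>G\<^esub> h \<otimes>\<^bsub>G\<^esub> (inv\<^bsub>G\<^esub> g))"

definition prime_order_class :: "('a, 'b) monoid_scheme \<Rightarrow> 'a set \<Rightarrow> bool" where
  "prime_order_class G C \<longleftrightarrow>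
     C \<in> conjugacy_classes G \<and> (\<forall>x\<in>C. prime (group.ord G x))"

definition invariably_prime_generated :: "nat set" where
  "invariably_prime_generated =
     {n. n \<ge> 1 \<and>
         (\<exists>C D. prime_order_class (alt_group n) C \<and> prime_order_class (alt_group n) D \<and>
           (\<forall>c\<in>C. \<forall>d\<in>D. generate (alt_group n) {c, d} = carrier (alt_group n)))}"

text \<open>The term at \<open>M = 0\<close> does not influence the limit inferior.\<close>

definition asymptotic_density :: "nat set \<Rightarrow> ereal" where
  "asymptotic_density S = liminf (\<lambda>M. ereal (real (card (S \<inter> {1..M})) / real M))"

text \<open>The Dickman--de Bruijn function lives on \<open>[0, \<infinity>)\<close>; the value 0 on negative
  arguments is a convention that makes the description unique.\<close>

definition dickman_rho :: "real \<Rightarrow> real" where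
  "dickman_rho = (THE \<rho>.
     continuous_on {0..} \<rho> \<and>
     (\<forall>u<0. \<rho> u = 0) \<and>
     (\<forall>u\<in>{0..1}. \<rho> u = 1) \<and>
     (\<forall>u>1. \<exists>\<rho>'. (\<rho> has_real_derivative \<rho>') (at u) \<and> u * \<rho>' + \<rho> (u - 1) = 0))"

text \<open>The Riemann zeta function is the analytic continuation of its Dirichlet series to
  \<open>\<complex> - {1}\<close>; the value 0 at the pole is a convention that makes the description unique.\<close>

definition riemann_zeta :: "complex \<Rightarrow> complex" where
  "riemann_zeta = (THE f.
     f holomorphic_on - {1} \<and>
     f 1 = 0 \<and>
     (\<forall>s. Re s > 1 \<longrightarrow> (\<lambda>n. 1 / of_nat (Suc n) powr s) sums f s))"

definition riemann_hypothesis :: bool where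
  "riemann_hypothesis \<longleftrightarrow>
     (\<forall>s. s \<noteq> 1 \<and> riemann_zeta s = 0 \<and> (\<forall>n::nat. n \<ge> 1 \<longrightarrow> s \<noteq> - 2 * of_nat n) \<longrightarrow> Re s = 1 / 2)"

text \<open>The primes are enumerated from index 0.\<close>

definition nth_prime :: "nat \<Rightarrow> nat" where
  "nth_prime k = enumerate {p. prime p} k"

definition cramer_conjecture :: bool where
  "cramer_conjecture \<longleftrightarrow>
     (\<exists>C::real. \<forall>k. real (nth_prime (Suc k)) - real (nth_prime k) \<le> C * (ln (real (nth_prime k)))\<^sup>2)"

end

theory Submission
  imports Defs "HOL-Real_Asymp.Real_Asymp"
begin

text \<open>
  The density is in fact 1, unconditionally. Let \<open>n = a p + b\<close> with \<open>p\<close> prime, \<open>a\<close> and \<open>b\<close> coprime,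
  \<open>b\<^sup>2 < p\<close>, \<open>b\<close> somewhat larger than \<open>a\<^sup>2 log n\<close>, and let \<open>r\<close> be an odd prime divisor of \<open>n\<close> with \<open>a b < r\<close>.
  An element \<open>c\<close> with \<open>a\<close> cycles of length \<open>p\<close> and an element \<open>d\<close> with \<open>n / r\<close> cycles of length \<open>r\<close>
  generate the alternating group: comparing orbit lengths and block sizes modulo \<open>p\<close> and \<open>r\<close> shows that
  \<open>G = \<langle>c, d\<rangle>\<close> is primitive. Counting chains of fixed points of conjugates of \<open>c\<close> shows that the
  centralizer of \<open>c\<close> in \<open>G\<close> is too large to act faithfully on the support of \<open>c\<close>, so some nontrivial
  \<open>z \<in> G\<close> is supported on the \<open>b\<close> fixed points of \<open>c\<close>. As all point stabilizers have orbits of length at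
  least \<open>p > (b - 1)\<^sup>2\<close>, some conjugate of the support of \<open>z\<close> meets it in a single point, and the
  commutator of \<open>z\<close> with that conjugate is a 3-cycle. A primitive group with a 3-cycle contains the
  alternating group.

  It remains to represent almost all \<open>n \<in> (X, 2 X]\<close> in this way. Few \<open>n\<close> are smooth, so \<open>r\<close> exists. Take
  \<open>a = 1 + W j\<close> with \<open>W = z!\<close> and \<open>J \<le> j < 64 J\<close>, and primes \<open>p \<in> (P, 2 P]\<close>, where \<open>J\<close> is a small power of
  \<open>X\<close>. Weighting the condition \<open>a p \<approx> n - 2 J\<^sup>3\<close> by a Fejer kernel in the logarithms turns the count into
  a bilinear form in which only nonzero frequencies \<open>t\<close> of the sum of \<open>a\<^sup>-\<^sup>1\<^sup>-\<^sup>i\<^sup>t\<close> give an error.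
  These sums have a power saving by Weyl-van der Corput differencing; the sums over \<open>n\<close> and \<open>p\<close> are
  handled by Cauchy-Schwarz and spacing alone. The choice of \<open>W\<close> makes the pairs with \<open>a\<close> and \<open>n\<close> not
  coprime negligible.
\<close>

section \<open>Permutations of prime order and the alternating group\<close>

text \<open>With a single p-cycle one would need a prime just below almost every n. The factor a
  adds a smooth variable whose exponential sums are bounded elementarily, so about the primes only a
  logarithmic lower bound for their number in one dyadic window is used. Three demands on b compete:
  it must exceed about a^2 log n for the centralizer count, stay below the square root of p for the
  commutator, and satisfy a b < r. With J about X^d and b about J^3 the first holds because a is
  about J; the others hold for small d, since r > X^(10 d)/2 is available outside a set of density
  O(d). The number 64 ties the analysis together: a runs through a range of ratio about 64 and the
  kernel has period ln 64 in the logarithm, so at each of its nonzero frequencies the integral of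
  a^(-1-it) over the range vanishes and even low frequencies cancel. The numbers compared have ratio
  at most 32, which keeps them clear of the next peak of the kernel. In the error of the bilinear
  form only logarithms and constants depending on W are lost, against a saved power of X.\<close>

lemma funpow_funpow: "(f ^^ i) ((f ^^ j) x) = (f ^^ (i + j)) x"
  by (simp add: funpow_add)

text \<open>Coinciding iterates give a period k with 0 < k < p; as k is coprime to p, Bezout reduces
  the periods k and p to the period 1. Since f is an arbitrary map, the lemma also serves for a
  permutation acting on blocks.\<close>

lemma prime_cycle_inj:
  assumes "prime p" "(f ^^ p) x = x" "f x \<noteq> x"
  shows "inj_on (\<lambda>i. (f ^^ i) x) {..<p}"
proof -
  have aux: "False" if ij: "i < j" "j < p" "(f ^^ i) x = (f ^^ j) x" for i j
  proof -
    define k where "k = j - i"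
    have k: "0 < k" "k < p" using ij by (auto simp: k_def)
    have "p - i + i = p" "p - i + j = k + p" using ij by (auto simp: k_def)
    then have "x = (f ^^ (p - i)) ((f ^^ i) x)" using assms(2) by (simp only: funpow_funpow)
    also have "\<dots> = (f ^^ (p - i)) ((f ^^ j) x)" using ij by simp
    also have "\<dots> = (f ^^ (k + p)) x"
      using \<open>p - i + j = k + p\<close> by (simp only: funpow_funpow)
    also have "\<dots> = (f ^^ k) x" by (simp add: funpow_add assms(2))
    finally have kx: "(f ^^ k) x = x" by simp
    have "coprime k p" using k assms(1)
      by (metis coprime_commute nat_dvd_not_less prime_imp_coprime)
    then obtain u v where uv: "k * u = p * v + 1"
      using bezout_nat[of k p] k by auto
    have "(f ^^ (k * u)) x = x" using kx by (metis funpow_mod_eq funpow_0 mod_mult_self1_is_0)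
    moreover have "(f ^^ (p * v + 1)) x = f x"
    proof -
      have "(f ^^ (p * v)) x = x" using assms(2) by (metis funpow_mod_eq funpow_0 mod_mult_self1_is_0)
      then show ?thesis by simp
    qed
    ultimately show False using uv assms(3) by simp
  qed
  show ?thesis
  proof (rule inj_onI)
    fix i j assume "i \<in> {..<p}" "j \<in> {..<p}" "(f ^^ i) x = (f ^^ j) x"
    then show "i = j" using aux[of i j] aux[of j i] by (metis lessThan_iff linorder_neqE_nat)
  qed
qed

lemma prime_cycle_card:
  assumes "prime p" "(f ^^ p) x = x" "f x \<noteq> x"
  shows "card (range (\<lambda>i. (f ^^ i) x)) = p"
proof -
  have "range (\<lambda>i. (f ^^ i) x) = (\<lambda>i. (f ^^ i) x) ` {..<p}"
  proof (intro subset_antisym subsetI)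
    fix y assume "y \<in> range (\<lambda>i. (f ^^ i) x)"
    then obtain i where "y = (f ^^ i) x" by auto
    then have "y = (f ^^ (i mod p)) x" using funpow_mod_eq[OF assms(2)] by simp
    then show "y \<in> (\<lambda>i. (f ^^ i) x) ` {..<p}"
      using assms(1) prime_gt_0_nat by auto
  qed auto
  then show ?thesis using card_image[OF prime_cycle_inj[OF assms]] by simp
qed

text \<open>One representative per cycle. Besides the count modulo p, the representatives matter
  because a map commuting with f is determined on M by its values on R.\<close>

lemma prime_cycle_reps:
  assumes "prime p" "finite M" "f ` M \<subseteq> M" "\<And>x. x \<in> M \<Longrightarrow> (f ^^ p) x = x" "\<And>x. x \<in> M \<Longrightarrow> f x \<noteq> x"
  obtains R where "R \<subseteq> M" "card R * p = card M" "M = (\<Union>x\<in>R. range (\<lambda>i. (f ^^ i) x))"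
proof -
  define cyc where "cyc x = range (\<lambda>i. (f ^^ i) x)" for x
  have inM: "(f ^^ i) x \<in> M" if "x \<in> M" for i x
    using that assms(3) by (induction i) auto
  have cycM: "cyc x \<subseteq> M" if "x \<in> M" for x using inM[OF that] by (auto simp: cyc_def)
  have self: "x \<in> cyc x" for x unfolding cyc_def by (rule range_eqI[of _ _ 0]) simp
  have sub: "cyc z \<subseteq> cyc x" if "z \<in> cyc x" for x z
  proof
    fix y assume "y \<in> cyc z"
    then obtain j where "y = (f ^^ j) z" by (auto simp: cyc_def)
    moreover obtain i where "z = (f ^^ i) x" using \<open>z \<in> cyc x\<close> by (auto simp: cyc_def)
    ultimately have "y = (f ^^ (j + i)) x" by (simp add: funpow_add)
    then show "y \<in> cyc x" by (auto simp: cyc_def)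
  qed
  have sym: "x \<in> cyc z" if "z \<in> cyc x" "x \<in> M" for x z
  proof -
    obtain i where "z = (f ^^ i) x" using \<open>z \<in> cyc x\<close> by (auto simp: cyc_def)
    then have z: "z = (f ^^ (i mod p)) x" using funpow_mod_eq[OF assms(4)[OF that(2)]] by simp
    have "i mod p < p" using assms(1) prime_gt_0_nat by auto
    then have "p - i mod p + i mod p = p" by simp
    then have "(f ^^ (p - i mod p)) z = x"
      unfolding z funpow_funpow using assms(4)[OF that(2)] by metis
    then show ?thesis unfolding cyc_def by (metis rangeI)
  qed
  have eq: "cyc z = cyc x" if "z \<in> cyc x" "x \<in> M" for x z
    using sub[OF that(1)] sub[OF sym[OF that]] by blast
  have disj: "cyc x \<inter> cyc y = {}" if "x \<in> M" "y \<in> M" "cyc x \<noteq> cyc y" for x y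
    using eq that by blast
  have un: "\<Union>(cyc ` M) = M" using cycM self by blast
  have "p * card (cyc ` M) = card (\<Union>(cyc ` M))"
  proof (rule card_partition)
    show "finite (cyc ` M)" using assms by auto
    show "finite (\<Union>(cyc ` M))" using un assms by auto
    show "card c = p" if "c \<in> cyc ` M" for c
    proof -
      from that obtain x where "x \<in> M" "c = cyc x" by auto
      then show ?thesis using prime_cycle_card[OF assms(1) assms(4) assms(5)] by (simp add: cyc_def)
    qed
    show "c1 \<inter> c2 = {}" if "c1 \<in> cyc ` M" "c2 \<in> cyc ` M" "c1 \<noteq> c2" for c1 c2
      using that disj by auto
  qed
  then have cM: "card (cyc ` M) * p = card M" using un by (simp add: mult.commute)
  obtain R where R: "R \<subseteq> M" "inj_on cyc R" "cyc ` R = cyc ` M"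
    by (metis subset_image_inj order_refl)
  show ?thesis
  proof (rule that)
    show "R \<subseteq> M" by fact
    show "card R * p = card M" using cM R by (metis card_image)
    show "M = (\<Union>x\<in>R. range (\<lambda>i. (f ^^ i) x))"
      using R un unfolding cyc_def[symmetric] by simp
  qed
qed

definition fixpts :: "'a set \<Rightarrow> ('a \<Rightarrow> 'a) \<Rightarrow> 'a set" where
  "fixpts A f = {x \<in> A. f x = x}"

lemma card_fixpts_prime_order:
  assumes "prime p" "finite A" "f ` A \<subseteq> A" "inj_on f A" "\<And>x. x \<in> A \<Longrightarrow> (f ^^ p) x = x"
  obtains i where "card A = i * p + card (fixpts A f)"
proof -
  define M where "M = A - fixpts A f"
  have M: "f ` M \<subseteq> M"
  proof
    fix y assume "y \<in> f ` M"
    then obtain x where x: "x \<in> A" "f x \<noteq> x" "y = f x" by (auto simp: M_def fixpts_def)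
    moreover have "f y \<noteq> y" using x assms(3,4) by (metis image_subset_iff inj_onD)
    ultimately show "y \<in> M" using assms(3) by (auto simp: M_def fixpts_def)
  qed
  have M': "finite M" "\<And>x. x \<in> M \<Longrightarrow> (f ^^ p) x = x" "\<And>x. x \<in> M \<Longrightarrow> f x \<noteq> x"
    using assms(2,5) by (auto simp: M_def fixpts_def)
  obtain R where "R \<subseteq> M" "card R * p = card M" "M = (\<Union>x\<in>R. range (\<lambda>i. (f ^^ i) x))"
    by (rule prime_cycle_reps[OF assms(1) M'(1) M M'(2,3)])
  moreover have "card A = card M + card (fixpts A f)"
    using assms(2) unfolding M_def fixpts_def
    by (subst card_Un_disjoint[symmetric]) (auto intro: arg_cong[where f=card])
  ultimately show ?thesis using that by metis
qed

section \<open>Finite permutation groups as sets of functions\<close>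

locale perm_group =
  fixes \<Omega> :: "'a set" and G :: "('a \<Rightarrow> 'a) set"
  assumes finite_points: "finite \<Omega>"
    and permutes_points: "g \<in> G \<Longrightarrow> g permutes \<Omega>"
    and id_mem: "id \<in> G"
    and comp_mem: "g \<in> G \<Longrightarrow> h \<in> G \<Longrightarrow> g \<circ> h \<in> G"
    and inv_mem: "g \<in> G \<Longrightarrow> inv' g \<in> G"
begin

lemma finite_group: "finite G"
  using finite_subset[OF _ finite_permutations[OF finite_points]] permutes_points by auto

lemma mem_points: "g \<in> G \<Longrightarrow> g x \<in> \<Omega> \<longleftrightarrow> x \<in> \<Omega>"
  using permutes_points permutes_in_image by metis

lemma inv_cancel [simp]: "g \<in> G \<Longrightarrow> inv' g (g x) = x" "g \<in> G \<Longrightarrow> g (inv' g x) = x"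
  using permutes_inverses[OF permutes_points] by auto

lemma inv_comp [simp]: "g \<in> G \<Longrightarrow> inv' g \<circ> g = id" "g \<in> G \<Longrightarrow> g \<circ> inv' g = id"
  by (auto simp: fun_eq_iff)

lemma group_inj: "g \<in> G \<Longrightarrow> inj g"
  using permutes_inj[OF permutes_points] .

lemma eq_iff: "g \<in> G \<Longrightarrow> g x = g y \<longleftrightarrow> x = y"
  using group_inj by (auto simp: inj_def)

lemma funpow_mem: "g \<in> G \<Longrightarrow> g ^^ i \<in> G"
  by (induction i) (auto simp: id_mem comp_mem id_def[symmetric])

definition orb :: "'a \<Rightarrow> 'a set" where "orb x = (\<lambda>g. g x) ` G"

lemma orb_self: "x \<in> orb x"
  unfolding orb_def by (rule image_eqI[OF _ id_mem]) simp

lemma orb_subset: "x \<in> \<Omega> \<Longrightarrow> orb x \<subseteq> \<Omega>"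
  unfolding orb_def using mem_points by auto

lemma finite_orb: "finite (orb x)"
  unfolding orb_def using finite_group by auto

lemma orb_image: "g \<in> G \<Longrightarrow> y \<in> orb x \<Longrightarrow> g y \<in> orb x"
proof -
  assume "g \<in> G" "y \<in> orb x"
  then obtain h where "h \<in> G" "y = h x" by (auto simp: orb_def)
  then show ?thesis unfolding orb_def
    by (intro image_eqI[OF _ comp_mem[OF \<open>g \<in> G\<close> \<open>h \<in> G\<close>]]) simp
qed

lemma orb_sym: "y \<in> orb x \<Longrightarrow> x \<in> orb y"
proof -
  assume "y \<in> orb x"
  then obtain h where "h \<in> G" "y = h x" by (auto simp: orb_def)
  then have "x = inv' h y" by simp
  then show ?thesis unfolding orb_def using inv_mem[OF \<open>h \<in> G\<close>] by blast
qed

lemma orb_eq: "y \<in> orb x \<Longrightarrow> orb y = orb x"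
proof -
  have "orb v \<subseteq> orb u" if "v \<in> orb u" for u v
  proof
    fix w assume "w \<in> orb v"
    then obtain h where "h \<in> G" "w = h v" by (auto simp: orb_def)
    then show "w \<in> orb u" using orb_image[OF _ that] by simp
  qed
  then show "y \<in> orb x \<Longrightarrow> orb y = orb x" using orb_sym by (meson subset_antisym)
qed

lemma orbit_stabilizer: "card G = card (orb x) * card {g \<in> G. g x = x}"
proof -
  have "card G = (\<Sum>y\<in>orb x. card {g \<in> G. g x = y})"
    using sum.image_gen[OF finite_group, of "\<lambda>_. 1::nat" "\<lambda>g. g x"] by (simp add: orb_def)
  also have "\<dots> = (\<Sum>y\<in>orb x. card {g \<in> G. g x = x})"
  proof (rule sum.cong[OF refl])
    fix y assume "y \<in> orb x"
    then obtain h where h: "h \<in> G" "y = h x" by (auto simp: orb_def)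
    have "bij_betw (\<lambda>g. h \<circ> g) {g \<in> G. g x = x} {g \<in> G. g x = y}"
    proof (rule bij_betw_byWitness[where f' = "\<lambda>g. inv' h \<circ> g"])
      show "\<forall>g\<in>{g \<in> G. g x = x}. inv' h \<circ> (h \<circ> g) = g" using h by (auto simp: fun_eq_iff)
      show "\<forall>g\<in>{g \<in> G. g x = y}. h \<circ> (inv' h \<circ> g) = g" using h by (auto simp: fun_eq_iff)
      show "(\<circ>) h ` {g \<in> G. g x = x} \<subseteq> {g \<in> G. g x = y}" using h by (auto intro: comp_mem)
      show "(\<circ>) (inv' h) ` {g \<in> G. g x = y} \<subseteq> {g \<in> G. g x = x}"
        using h by (auto intro: comp_mem inv_mem)
    qed
    from bij_betw_same_card[OF this] show "card {g \<in> G. g x = y} = card {g \<in> G. g x = x}"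
      by simp
  qed
  finally show ?thesis by simp
qed

lemma stabilizer_perm_group: "perm_group \<Omega> {g \<in> G. \<forall>s\<in>S. g s = s}"
proof
  show "finite \<Omega>" by (rule finite_points)
  show "g permutes \<Omega>" if "g \<in> {g \<in> G. \<forall>s\<in>S. g s = s}" for g using that permutes_points by auto
  show "id \<in> {g \<in> G. \<forall>s\<in>S. g s = s}" using id_mem by auto
  show "g \<circ> h \<in> {g \<in> G. \<forall>s\<in>S. g s = s}"
    if "g \<in> {g \<in> G. \<forall>s\<in>S. g s = s}" "h \<in> {g \<in> G. \<forall>s\<in>S. g s = s}" for g h
    using that by (auto intro: comp_mem)
  show "inv' g \<in> {g \<in> G. \<forall>s\<in>S. g s = s}" if g: "g \<in> {g \<in> G. \<forall>s\<in>S. g s = s}" for g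
  proof -
    have "inv' g s = s" if "s \<in> S" for s
    proof -
      have "g s = s" "g \<in> G" using g that by auto
      then show ?thesis using inv_cancel(1)[of g s] by simp
    qed
    then show ?thesis using g by (auto intro: inv_mem)
  qed
qed

lemma conj_mem: "g \<in> G \<Longrightarrow> h \<in> G \<Longrightarrow> g \<circ> h \<circ> inv' g \<in> G"
  by (intro comp_mem inv_mem)

lemma conj_funpow: "g \<in> G \<Longrightarrow> (g \<circ> h \<circ> inv' g) ^^ i = g \<circ> (h ^^ i) \<circ> inv' g"
proof (induction i)
  case 0 then show ?case by (simp add: fun_eq_iff)
next
  case (Suc i)
  then show ?case by (simp add: fun_eq_iff)
qed

end

section \<open>Stabilizers and closures for the conjugates of an element of prime order\<close>

locale prime_perm_group = perm_group +
  fixes c :: "'a \<Rightarrow> 'a" and p :: nat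
  assumes c_mem: "c \<in> G" and prime_p: "prime p" and c_pow: "c ^^ p = id"
    and few_fixpts: "card (fixpts \<Omega> c) < p"
    and c_nontriv: "c \<noteq> id"
begin

definition Cl :: "('a \<Rightarrow> 'a) set" where "Cl = (\<lambda>g. g \<circ> c \<circ> inv' g) ` G"

lemma Cl_mem: "y \<in> Cl \<Longrightarrow> y \<in> G"
  unfolding Cl_def by (auto intro: conj_mem c_mem)

lemma c_Cl: "c \<in> Cl"
proof -
  have "c = id \<circ> c \<circ> inv' id" by simp
  then show ?thesis unfolding Cl_def using id_mem by blast
qed

lemma Cl_pow: "y \<in> Cl \<Longrightarrow> y ^^ p = id"
  unfolding Cl_def using conj_funpow c_pow by (auto simp: fun_eq_iff)

lemma finite_Cl: "finite Cl" unfolding Cl_def using finite_group by auto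

lemma Cl_conj: "y \<in> Cl \<Longrightarrow> g \<in> G \<Longrightarrow> g \<circ> y \<circ> inv' g \<in> Cl"
proof -
  assume y: "y \<in> Cl" and g: "g \<in> G"
  then obtain h where h: "h \<in> G" "y = h \<circ> c \<circ> inv' h" unfolding Cl_def by auto
  have "inv' (g \<circ> h) = inv' h \<circ> inv' g"
    using g h permutes_points by (meson o_inv_distrib permutes_bij)
  then have "g \<circ> y \<circ> inv' g = (g \<circ> h) \<circ> c \<circ> inv' (g \<circ> h)" using h by (simp add: o_assoc)
  then show ?thesis unfolding Cl_def using comp_mem[OF g h(1)] by blast
qed

lemma Cl_fixpts: "y \<in> Cl \<Longrightarrow> card (fixpts \<Omega> y) = card (fixpts \<Omega> c)"
proof -
  assume "y \<in> Cl"
  then obtain g where g: "g \<in> G" "y = g \<circ> c \<circ> inv' g" unfolding Cl_def by auto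
  have "bij_betw g (fixpts \<Omega> c) (fixpts \<Omega> y)"
  proof (rule bij_betw_byWitness[where f' = "inv' g"])
    show "\<forall>x\<in>fixpts \<Omega> c. inv' g (g x) = x" "\<forall>x\<in>fixpts \<Omega> y. g (inv' g x) = x" using g by auto
    show "g ` fixpts \<Omega> c \<subseteq> fixpts \<Omega> y" using g mem_points by (auto simp: fixpts_def)
    show "inv' g ` fixpts \<Omega> y \<subseteq> fixpts \<Omega> c"
      using g mem_points[OF inv_mem] by (auto simp: fixpts_def) (metis inv_cancel(1))
  qed
  from bij_betw_same_card[OF this] show ?thesis by simp
qed

lemma cycle_mem:
  assumes "y \<in> Cl" "y x \<noteq> x"
  shows "card (range (\<lambda>i. (y ^^ i) x)) = p"
  using prime_cycle_card[OF prime_p, of y x] Cl_pow[OF assms(1)] assms(2) by simp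

text \<open>The closure operator behind the counting: \<open>ClS S\<close> holds the conjugates of c
  that fix S pointwise, and \<open>closure S\<close> their common fixed points. A point of \<Omega>
  outside \<open>closure S\<close> is moved by such a conjugate, so a whole p-cycle lies in its
  orbit under \<open>St S\<close>.\<close>

definition St :: "'a set \<Rightarrow> ('a \<Rightarrow> 'a) set" where "St S = {g \<in> G. \<forall>s\<in>S. g s = s}"
definition ClS :: "'a set \<Rightarrow> ('a \<Rightarrow> 'a) set" where "ClS S = Cl \<inter> St S"
definition closure :: "'a set \<Rightarrow> 'a set" where "closure S = {x \<in> \<Omega>. \<forall>y\<in>ClS S. y x = x}"
abbreviation orbS :: "'a set \<Rightarrow> 'a \<Rightarrow> 'a set" where "orbS S x \<equiv> (\<lambda>g. g x) ` St S"

lemma St_group: "perm_group \<Omega> (St S)" unfolding St_def by (rule stabilizer_perm_group)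

lemma orbS_orb: "perm_group.orb (St S) x = orbS S x"
  using perm_group.orb_def[OF St_group] .

lemma finite_orbS: "finite (orbS S x)" using perm_group.finite_orb[OF St_group] orbS_orb by metis

lemma ClS_conj: "y \<in> ClS S \<Longrightarrow> g \<in> St S \<Longrightarrow> g \<circ> y \<circ> inv' g \<in> ClS S"
  unfolding ClS_def using Cl_conj[of y g] perm_group.conj_mem[OF St_group, of g S y]
  by (auto simp: St_def)

lemma closure_invariant: "g \<in> St S \<Longrightarrow> x \<in> closure S \<Longrightarrow> g x \<in> closure S"
proof -
  assume g: "g \<in> St S" and x: "x \<in> closure S"
  interpret K: perm_group \<Omega> "St S" by (rule St_group)
  have "y (g x) = g x" if "y \<in> ClS S" for y
  proof -
    have "inv' g \<circ> y \<circ> inv' (inv' g) \<in> ClS S" using ClS_conj[OF that K.inv_mem[OF g]] .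
    moreover have "inv' (inv' g) = g" using K.permutes_points[OF g] by (simp add: permutes_inv_inv)
    ultimately have "(inv' g \<circ> y \<circ> g) x = x" using x by (auto simp: closure_def)
    then have "g ((inv' g) (y (g x))) = g x" by simp
    then show ?thesis using g by simp
  qed
  then show ?thesis using x K.mem_points[OF g] by (auto simp: closure_def)
qed

lemma card_orbS_ge:
  assumes "x \<in> \<Omega>" "x \<notin> closure S"
  shows "p \<le> card (orbS S x)"
proof -
  interpret K: perm_group \<Omega> "St S" by (rule St_group)
  obtain y where y: "y \<in> ClS S" "y x \<noteq> x" using assms by (auto simp: closure_def)
  have "range (\<lambda>i. (y ^^ i) x) \<subseteq> orbS S x"
    using K.funpow_mem y by (auto simp: ClS_def)
  moreover have "card (range (\<lambda>i. (y ^^ i) x)) = p" using cycle_mem y by (auto simp: ClS_def)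
  ultimately show ?thesis using card_mono[OF finite_orbS] by metis
qed

lemma St_insert: "St (insert b S) = {g \<in> St S. g b = b}" by (auto simp: St_def)

lemma card_St_insert:
  assumes "x \<in> \<Omega>" "x \<notin> closure S"
  shows "p * card (St (insert x S)) \<le> card (St S)"
proof -
  have "card (St S) = card (orbS S x) * card (St (insert x S))"
    using perm_group.orbit_stabilizer[OF St_group] orbS_orb St_insert by metis
  then show ?thesis using card_orbS_ge[OF assms] by simp
qed

lemma ClS_insert: "ClS (insert b S) = {y \<in> ClS S. y b = b}" by (auto simp: ClS_def St_def)

lemma ClS_orbit_bij:
  assumes "g \<in> St S"
  shows "bij_betw (\<lambda>y. g \<circ> y \<circ> inv' g) (ClS (insert x S)) (ClS (insert (g x) S))"
proof (rule bij_betw_byWitness[where f' = "\<lambda>y. inv' g \<circ> y \<circ> g"])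
  interpret K: perm_group \<Omega> "St S" by (rule St_group)
  have ii: "inv' (inv' g) = g" using K.permutes_points[OF assms] by (simp add: permutes_inv_inv)
  show "\<forall>y\<in>ClS (insert x S). inv' g \<circ> (g \<circ> y \<circ> inv' g) \<circ> g = y"
    "\<forall>y\<in>ClS (insert (g x) S). g \<circ> (inv' g \<circ> y \<circ> g) \<circ> inv' g = y"
    using assms by (auto simp: fun_eq_iff)
  show "(\<lambda>y. g \<circ> y \<circ> inv' g) ` ClS (insert x S) \<subseteq> ClS (insert (g x) S)"
    unfolding ClS_insert using ClS_conj[OF _ assms] assms by auto
  show "(\<lambda>y. inv' g \<circ> y \<circ> g) ` ClS (insert (g x) S) \<subseteq> ClS (insert x S)"
    unfolding ClS_insert using ClS_conj[OF _ K.inv_mem[OF assms]] assms ii by auto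
qed

lemma card_ClS_orbit:
  assumes "g \<in> St S"
  shows "card (ClS (insert (g x) S)) = card (ClS (insert x S))"
  using bij_betw_same_card[OF ClS_orbit_bij[OF assms]] by simp

text \<open>An inclusion between two finite sets that conjugation puts in bijection is an equality.
  Hence lying in the closure of one another is an equivalence relation on an orbit of
  \<open>St S\<close>, and the closures cut the orbit into blocks.\<close>

lemma closure_insert_orbit:
  assumes "x' \<in> orbS S x" "x' \<in> closure (insert x S)"
  shows "ClS (insert x' S) = ClS (insert x S)"
proof -
  obtain g where g: "g \<in> St S" "x' = g x" using assms(1) by auto
  have "ClS (insert x S) \<subseteq> ClS (insert x' S)"
    using assms(2) by (auto simp: closure_def ClS_def St_def)
  moreover have "card (ClS (insert x' S)) = card (ClS (insert x S))"
    using card_ClS_orbit[OF g(1)] g(2) by simp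
  moreover have "finite (ClS (insert x' S))" using finite_Cl by (auto simp: ClS_def)
  ultimately show ?thesis by (metis card_subset_eq)
qed

end

section \<open>Chains of fixed points and the order of the centralizer\<close>

context prime_perm_group
begin

lemma orbS_points: "x \<in> \<Omega> \<Longrightarrow> orbS S x \<subseteq> \<Omega>"
  using perm_group.orb_subset[OF St_group] orbS_orb by metis

lemma orbS_self: "x \<in> orbS S x"
  using perm_group.orb_self[OF St_group] orbS_orb by metis

lemma orbS_eq: "y \<in> orbS S x \<Longrightarrow> orbS S y = orbS S x"
  using perm_group.orb_eq[OF St_group] orbS_orb by metis

lemma orbS_image: "g \<in> St S \<Longrightarrow> y \<in> orbS S x \<Longrightarrow> g y \<in> orbS S x"
  using perm_group.orb_image[OF St_group] orbS_orb by metis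

lemma orbS_closure:
  assumes "y \<in> orbS S x" "y \<in> closure S" shows "x \<in> closure S"
proof -
  have "x \<in> orbS S y" using orbS_eq[OF assms(1)] orbS_self by metis
  then show ?thesis using closure_invariant[OF _ assms(2)] by auto
qed

text \<open>The closures split the orbit U into blocks of equal size permuted by
  \<open>St S\<close>. The block of b lies in the fixed points of y and so has fewer than p
  elements; therefore the block of a point moved by y has p pairwise disjoint images under powers of
  y, all inside U.\<close>

lemma closure_block_small:
  assumes y: "y \<in> ClS S" and x: "x \<in> \<Omega>" "x \<notin> closure S"
    and b: "b \<in> \<Omega>" "y b = b" "b \<in> orbS S x"
  shows "card (closure (insert b S) \<inter> orbS S x) * p \<le> card (orbS S x)"
proof -
  interpret K: perm_group \<Omega> "St S" by (rule St_group)
  define U where "U = orbS S x"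
  have U: "U \<subseteq> \<Omega>" "finite U" using orbS_points[OF x(1)] finite_orbS by (auto simp: U_def)
  have Uo: "orbS S z = U" if "z \<in> U" for z using orbS_eq that by (auto simp: U_def)
  \<comment> \<open>\<open>B z\<close> is the class of z for equality of
    \<open>ClS (insert z S)\<close>; the next fact identifies it with the trace of the closure on
    U.\<close>
  define B where "B z = {z' \<in> U. ClS (insert z' S) = ClS (insert z S)}" for z
  have B: "closure (insert z S) \<inter> U = B z" if "z \<in> U" for z
  proof (intro subset_antisym subsetI)
    fix z' assume "z' \<in> closure (insert z S) \<inter> U"
    then show "z' \<in> B z" using closure_insert_orbit[of z' z S] Uo[OF that] by (auto simp: B_def)
  next
    fix z' assume "z' \<in> B z"
    then have z': "z' \<in> U" "ClS (insert z' S) = ClS (insert z S)" by (auto simp: B_def)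
    have "w z' = z'" if "w \<in> ClS (insert z S)" for w using that z'(2)[symmetric] ClS_insert by auto
    then show "z' \<in> closure (insert z S) \<inter> U" using z' U by (auto simp: closure_def)
  qed
  have Bmap: "g z' \<in> B (g z)" if g: "g \<in> St S" and "z' \<in> B z" for g z z'
  proof -
    from \<open>z' \<in> B z\<close> have z': "z' \<in> U" "ClS (insert z' S) = ClS (insert z S)" by (auto simp: B_def)
    have "ClS (insert (g z') S) = ClS (insert (g z) S)"
      using bij_betw_imp_surj_on[OF ClS_orbit_bij[OF g, of z']]
        bij_betw_imp_surj_on[OF ClS_orbit_bij[OF g, of z]] z'(2) by simp
    then show ?thesis using z' orbS_image[OF g] by (auto simp: B_def U_def)
  qed
  have Beq: "B z' = B z" if "z' \<in> B z" for z z' using that by (auto simp: B_def)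
  have finB: "finite (B z)" for z using U by (auto simp: B_def)
  have le: "card (B z) \<le> card (B (g z))" if g: "g \<in> St S" for g z
    using Bmap[OF g] card_inj_on_le[of g "B z" "B (g z)"] finB K.group_inj[OF g]
    by (meson image_subsetI inj_on_subset subset_UNIV)
  have Bb: "B b \<subseteq> fixpts \<Omega> y"
  proof
    fix z assume "z \<in> B b"
    then have "z \<in> \<Omega>" "ClS (insert z S) = ClS (insert b S)" using U by (auto simp: B_def)
    moreover have "y \<in> ClS (insert b S)" using y b by (auto simp: ClS_insert)
    ultimately show "z \<in> fixpts \<Omega> y" using ClS_insert by (auto simp: fixpts_def)
  qed
  have fy: "card (fixpts \<Omega> y) < p" using Cl_fixpts few_fixpts y by (auto simp: ClS_def)
  have finf: "finite (fixpts \<Omega> y)" using finite_points by (auto simp: fixpts_def)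
  have "p \<le> card U" using card_orbS_ge[OF x] by (simp add: U_def)
  then have "\<not> U \<subseteq> fixpts \<Omega> y" using fy card_mono[OF finf] by (meson leD order.trans)
  then obtain z where z: "z \<in> U" "y z \<noteq> z" using U by (auto simp: fixpts_def)
  have ySt: "y \<in> St S" using y by (auto simp: ClS_def)
  have zb: "card (B z) = card (B b)"
  proof -
    have "z \<in> orbS S b" "b \<in> orbS S z" using Uo z b by (auto simp: U_def)
    then obtain g h where "g \<in> St S" "z = g b" "h \<in> St S" "b = h z" by auto
    then show ?thesis using le[of g b] le[of h z] by simp
  qed
  have Bp: "card (B z) < p" using zb card_mono[OF finf Bb] fy by simp
  have zB: "z \<in> B z" using z by (auto simp: B_def)
  have ypow: "(y ^^ p) w = w" for w using Cl_pow y by (auto simp: ClS_def)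
  \<comment> \<open>If a nontrivial power of y mapped one element of the block into the block, it
    would preserve the block and keep a p-cycle of z inside a set with fewer than p points.\<close>
  have nomeet: False if k: "0 < k" "k < p" and w: "w \<in> B z" "(y ^^ k) w \<in> B z" for k w
  proof -
    define f where "f = y ^^ k"
    have f: "f \<in> St S" unfolding f_def by (rule K.funpow_mem[OF ySt])
    have "B (f w) = B z" using Beq[OF w(2)] by (simp add: f_def)
    moreover have "B w = B z" using Beq[OF w(1)] .
    ultimately have fB: "f v \<in> B z" if "v \<in> B z" for v using Bmap[OF f, of v w] that by simp
    have fi: "(f ^^ i) z \<in> B z" for i by (induction i) (auto simp: zB fB)
    have "inj_on (\<lambda>i. (y ^^ i) z) {..<p}" using prime_cycle_inj[OF prime_p ypow z(2)] .
    then have "f z \<noteq> z" using k unfolding f_def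
      by (metis funpow_0 inj_onD lessThan_iff less_numeral_extra(3) order.strict_trans)
    moreover have "(f ^^ p) z = z"
      unfolding f_def funpow_mult using ypow[of z]
      by (metis funpow_mod_eq funpow_0 mod_mult_self2_is_0)
    ultimately have "card (range (\<lambda>i. (f ^^ i) z)) = p" by (intro prime_cycle_card[OF prime_p])
    moreover have "range (\<lambda>i. (f ^^ i) z) \<subseteq> B z" using fi by auto
    ultimately show False using card_mono[OF finB] Bp by (metis leD)
  qed
  have step: "u = v \<and> i = j" if "u \<in> B z" "v \<in> B z" "i \<le> j" "j < p" "(y ^^ i) u = (y ^^ j) v" for u v i j
  proof -
    have "(y ^^ i) u = (y ^^ i) ((y ^^ (j - i)) v)" using that by (simp add: funpow_funpow)
    then have "u = (y ^^ (j - i)) v" using K.eq_iff[OF K.funpow_mem[OF ySt]] by metis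
    moreover have "j - i < p" using that by simp
    then have "j - i = 0" using nomeet[of "j - i" v] that calculation by (cases "j - i = 0") auto
    ultimately show ?thesis using that by simp
  qed
  have "inj_on (\<lambda>(w, i). (y ^^ i) w) (B z \<times> {..<p})"
  proof (rule inj_onI, clarsimp)
    fix u i v j assume "u \<in> B z" "i < p" "v \<in> B z" "j < p" "(y ^^ i) u = (y ^^ j) v"
    then show "u = v \<and> i = j" using step[of u v i j] step[of v u j i] by (cases "i \<le> j") auto
  qed
  moreover have "(\<lambda>(w, i). (y ^^ i) w) ` (B z \<times> {..<p}) \<subseteq> U"
    using orbS_image[OF K.funpow_mem[OF ySt]] by (auto simp: B_def U_def)
  ultimately have "card (B z \<times> {..<p}) \<le> card U" using card_inj_on_le U by blast
  then have "card (B b) * p \<le> card U" using zb by (simp add: card_cartesian_product)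
  then show ?thesis using B[of b] b by (simp add: U_def)
qed

text \<open>The number of sequences of j fixed points of y in which each point avoids the closure of
  S together with the earlier points.\<close>

primrec ext_count :: "nat \<Rightarrow> 'a set \<Rightarrow> ('a \<Rightarrow> 'a) \<Rightarrow> nat" where
  "ext_count 0 S y = 1"
| "ext_count (Suc j) S y = (\<Sum>b\<in>fixpts \<Omega> y - closure S. ext_count j (insert b S) y)"

text \<open>Double counting with the chain chosen before y. Each further point has at most
  \<open>card \<Omega>\<close> choices, while the pointwise stabilizer shrinks by a factor of at
  least p because the point is outside the closure; the elements y that remain are bounded by the
  last stabilizer.\<close>

lemma ext_count_upper:
  "(\<Sum>y\<in>ClS S. ext_count j S y) * p ^ j \<le> card \<Omega> ^ j * card (St S)"
proof (induction j arbitrary: S)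
  case 0
  have "card (ClS S) \<le> card (St S)"
    using card_mono[OF perm_group.finite_group[OF St_group]] by (auto simp: ClS_def)
  then show ?case by simp
next
  case (Suc j)
  have fin: "finite (ClS S)" using finite_Cl by (auto simp: ClS_def)
  have "(\<Sum>y\<in>ClS S. ext_count (Suc j) S y)
     = (\<Sum>y\<in>ClS S. \<Sum>b\<in>{b. b \<in> \<Omega> - closure S \<and> y b = b}. ext_count j (insert b S) y)"
    by (intro sum.cong refl) (auto simp: fixpts_def intro!: sum.cong)
  also have "\<dots> = (\<Sum>b\<in>\<Omega> - closure S. \<Sum>y\<in>{y. y \<in> ClS S \<and> y b = b}. ext_count j (insert b S) y)"
    using fin finite_points by (intro sum.swap_restrict) auto
  also have "\<dots> = (\<Sum>b\<in>\<Omega> - closure S. \<Sum>y\<in>ClS (insert b S). ext_count j (insert b S) y)"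
    by (simp add: ClS_insert)
  finally have "(\<Sum>y\<in>ClS S. ext_count (Suc j) S y) * p ^ Suc j
    = (\<Sum>b\<in>\<Omega> - closure S. p * ((\<Sum>y\<in>ClS (insert b S). ext_count j (insert b S) y) * p ^ j))"
    by (simp add: sum_distrib_left sum_distrib_right mult_ac)
  also have "\<dots> \<le> (\<Sum>b\<in>\<Omega> - closure S. p * (card \<Omega> ^ j * card (St (insert b S))))"
    using Suc.IH by (intro sum_mono mult_left_mono) auto
  also have "\<dots> \<le> (\<Sum>b\<in>\<Omega> - closure S. card \<Omega> ^ j * card (St S))"
  proof (rule sum_mono)
    fix b assume "b \<in> \<Omega> - closure S"
    then have "p * card (St (insert b S)) \<le> card (St S)" using card_St_insert by auto
    then have "card \<Omega> ^ j * (p * card (St (insert b S))) \<le> card \<Omega> ^ j * card (St S)"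
      by (rule mult_left_mono) simp
    then show "p * (card \<Omega> ^ j * card (St (insert b S))) \<le> card \<Omega> ^ j * card (St S)"
      by (simp add: mult_ac)
  qed
  also have "\<dots> = card (\<Omega> - closure S) * (card \<Omega> ^ j * card (St S))" by simp
  also have "\<dots> \<le> card \<Omega> * (card \<Omega> ^ j * card (St S))"
    using finite_points by (intro mult_right_mono card_mono) auto
  finally show ?case by (simp add: mult_ac)
qed

text \<open>Fixing one more point costs one unit of density, measured as p times the share of fixed
  points of y in an orbit. The closure of \<open>insert b S\<close> takes up at most a p-th part of
  the old orbit and thus at most one unit; the rest splits into orbits of
  \<open>St (insert b S)\<close>, and by averaging one of them keeps density w.\<close>

lemma sub_orbit_dense:
  assumes y: "y \<in> ClS S" and x: "x \<in> \<Omega>" "x \<notin> closure S"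
    and b: "b \<in> \<Omega>" "y b = b" "b \<in> orbS S x"
    and dense: "Suc w * card (orbS S x) \<le> card (fixpts \<Omega> y \<inter> orbS S x) * p"
  obtains x' where "x' \<in> \<Omega>" "x' \<notin> closure (insert b S)"
    "w * card (orbS (insert b S) x') \<le> card (fixpts \<Omega> y \<inter> orbS (insert b S) x') * p"
proof -
  define U where "U = orbS S x"
  define V where "V = U - closure (insert b S)"
  define F where "F = fixpts \<Omega> y"
  let ?o = "orbS (insert b S)"
  have U: "U \<subseteq> \<Omega>" "finite U" using orbS_points[OF x(1)] finite_orbS by (auto simp: U_def)
  have finV: "finite V" using U by (auto simp: V_def)
  have small: "card (closure (insert b S) \<inter> U) * p \<le> card U"
    using closure_block_small[OF y x b] by (simp add: U_def)
  have Upos: "0 < card U" using card_orbS_ge[OF x] prime_gt_0_nat[OF prime_p] by (simp add: U_def)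
  have cV: "card V = card U - card (closure (insert b S) \<inter> U)"
    unfolding V_def using U by (metis Int_commute card_Diff_subset_Int finite_Int)
  have "2 \<le> p" using prime_p prime_ge_2_nat by auto
  have "V \<noteq> {}"
  proof
    assume "V = {}"
    then have "card U \<le> card (closure (insert b S) \<inter> U)" using cV by simp
    then have "card U * p \<le> card U" using small mult_right_mono[of _ _ p] order_trans by blast
    then show False using Upos \<open>2 \<le> p\<close> by simp
  qed
  have oV: "?o v \<subseteq> V" if "v \<in> V" for v
  proof
    fix v' assume v': "v' \<in> ?o v"
    then obtain g where g: "g \<in> St (insert b S)" "v' = g v" by auto
    have "v' \<in> U" using g orbS_image[of g S v x] that by (auto simp: V_def U_def St_insert)
    moreover have "v' \<notin> closure (insert b S)"
      using orbS_closure[OF v'] that by (auto simp: V_def)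
    ultimately show "v' \<in> V" by (auto simp: V_def)
  qed
  define Q where "Q = ?o ` V"
  have finQ: "finite Q" using finV by (auto simp: Q_def)
  have UQ: "\<Union>Q = V" using oV orbS_self by (auto simp: Q_def)
  have disj: "c1 \<inter> c2 = {}" if "c1 \<in> Q" "c2 \<in> Q" "c1 \<noteq> c2" for c1 c2
    using that orbS_eq[of _ _ "insert b S"] unfolding Q_def by (metis (no_types, lifting) disjoint_iff imageE)
  have cardV: "card V = (\<Sum>C\<in>Q. card C)"
  proof -
    have "pairwise disjnt Q" using disj by (auto simp: pairwise_def disjnt_def)
    moreover have "finite A" if "A \<in> Q" for A using that finite_orbS by (auto simp: Q_def)
    ultimately show ?thesis using card_Union_disjoint[of Q] UQ by simp
  qed
  have FV: "F \<inter> V = (\<Union>C\<in>Q. F \<inter> C)" using UQ by auto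
  have cardFV: "card (F \<inter> V) = (\<Sum>C\<in>Q. card (F \<inter> C))"
    unfolding FV
  proof (rule card_UN_disjoint[OF finQ])
    show "\<forall>C\<in>Q. finite (F \<inter> C)" using finite_orbS by (auto simp: Q_def)
    show "\<forall>C\<in>Q. \<forall>C'\<in>Q. C \<noteq> C' \<longrightarrow> F \<inter> C \<inter> (F \<inter> C') = {}" using disj by blast
  qed
  have "\<exists>C\<in>Q. w * card C \<le> card (F \<inter> C) * p"
  proof (rule ccontr)
    assume "\<not> ?thesis"
    then have "(\<Sum>C\<in>Q. card (F \<inter> C) * p) < (\<Sum>C\<in>Q. w * card C)"
      using finQ \<open>V \<noteq> {}\<close> by (intro sum_strict_mono) (auto simp: Q_def)
    then have lt: "card (F \<inter> V) * p < w * card V"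
      unfolding cardFV cardV by (simp add: sum_distrib_left sum_distrib_right)
    have "F \<inter> U \<subseteq> (F \<inter> V) \<union> (closure (insert b S) \<inter> U)" by (auto simp: V_def)
    then have "card (F \<inter> U) \<le> card (F \<inter> V) + card (closure (insert b S) \<inter> U)"
      using card_mono[of "(F \<inter> V) \<union> (closure (insert b S) \<inter> U)" "F \<inter> U"] U finV
        card_Un_le[of "F \<inter> V" "closure (insert b S) \<inter> U"] by (meson finite_Int finite_UnI le_trans)
    then have "card (F \<inter> U) * p \<le> card (F \<inter> V) * p + card (closure (insert b S) \<inter> U) * p"
      by (metis add_mult_distrib mult_le_mono1)
    also have "\<dots> < w * card V + card U" using lt small by linarith
    also have "\<dots> \<le> w * card U + card U" using cV by (simp add: mult_left_mono)
    finally show False using dense by (simp add: U_def F_def)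
  qed
  then obtain v where v: "v \<in> V" "w * card (?o v) \<le> card (F \<inter> ?o v) * p" by (auto simp: Q_def)
  then show ?thesis using that[of v] U by (auto simp: V_def F_def)
qed

text \<open>An orbit outside the closure has at least p points, so density at least W yields at
  least W fixed points of y in it. Each may be the next point of the chain, since
  \<open>sub_orbit_dense\<close> leaves enough density for the remaining steps.\<close>

lemma ext_count_lower:
  assumes "y \<in> ClS S" "x \<in> \<Omega>" "x \<notin> closure S"
    "(W + j) * card (orbS S x) \<le> card (fixpts \<Omega> y \<inter> orbS S x) * p"
  shows "W ^ j \<le> ext_count j S y"
  using assms
proof (induction j arbitrary: S x)
  case 0 then show ?case by simp
next
  case (Suc j)
  define D where "D = fixpts \<Omega> y \<inter> orbS S x"
  have D: "b \<in> \<Omega>" "y b = b" "b \<in> orbS S x" if "b \<in> D" for b using that by (auto simp: D_def fixpts_def)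
  have finD: "finite D" using finite_orbS by (auto simp: D_def)
  have ge: "W ^ j \<le> ext_count j (insert b S) y" if "b \<in> D" for b
  proof -
    have "Suc (W + j) * card (orbS S x) \<le> card (fixpts \<Omega> y \<inter> orbS S x) * p" using Suc.prems by simp
    then obtain x' where x': "x' \<in> \<Omega>" "x' \<notin> closure (insert b S)"
      "(W + j) * card (orbS (insert b S) x') \<le> card (fixpts \<Omega> y \<inter> orbS (insert b S) x') * p"
      using sub_orbit_dense[OF Suc.prems(1-3) D[OF \<open>b \<in> D\<close>]] by blast
    have "y \<in> ClS (insert b S)" using Suc.prems(1) D[OF that] by (auto simp: ClS_insert)
    then show ?thesis using Suc.IH x' by blast
  qed
  have "W * p \<le> card D * p"
  proof -
    have "W * p \<le> (W + Suc j) * card (orbS S x)"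
      using card_orbS_ge[OF Suc.prems(2,3)] by (intro mult_mono) auto
    then show ?thesis using Suc.prems(4) unfolding D_def by (rule order_trans)
  qed
  then have WD: "W \<le> card D" using prime_gt_0_nat[OF prime_p] by simp
  have "W ^ Suc j \<le> card D * W ^ j" using WD by simp
  also have "\<dots> = (\<Sum>b\<in>D. W ^ j)" by simp
  also have "\<dots> \<le> (\<Sum>b\<in>D. ext_count j (insert b S) y)" using ge by (intro sum_mono)
  also have "\<dots> \<le> (\<Sum>b\<in>fixpts \<Omega> y - closure S. ext_count j (insert b S) y)"
  proof (rule sum_mono2)
    show "finite (fixpts \<Omega> y - closure S)" using finite_points by (auto simp: fixpts_def)
    show "D \<subseteq> fixpts \<Omega> y - closure S" using orbS_closure Suc.prems(3) by (auto simp: D_def)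
  qed auto
  finally show ?case by simp
qed

lemma card_Cl: "card G = card Cl * card {g \<in> G. g \<circ> c = c \<circ> g}"
proof -
  let ?C = "{g \<in> G. g \<circ> c = c \<circ> g}"
  have "card G = (\<Sum>y\<in>Cl. card {g \<in> G. g \<circ> c \<circ> inv' g = y})"
    using sum.image_gen[OF finite_group, of "\<lambda>_. 1::nat" "\<lambda>g. g \<circ> c \<circ> inv' g"] by (simp add: Cl_def)
  also have "\<dots> = (\<Sum>y\<in>Cl. card ?C)"
  proof (rule sum.cong[OF refl])
    fix y assume "y \<in> Cl"
    then obtain h where h: "h \<in> G" "y = h \<circ> c \<circ> inv' h" by (auto simp: Cl_def)
    have conj_iff: "g \<circ> c \<circ> inv' g = y \<longleftrightarrow> g \<circ> c = y \<circ> g" if "g \<in> G" for g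
    proof
      assume "g \<circ> c \<circ> inv' g = y"
      then have "y \<circ> g = g \<circ> c \<circ> (inv' g \<circ> g)" by (simp add: o_assoc)
      then show "g \<circ> c = y \<circ> g" using that by simp
    next
      assume "g \<circ> c = y \<circ> g"
      then show "g \<circ> c \<circ> inv' g = y" using that by (simp add: fun_eq_iff)
    qed
    have "bij_betw (\<lambda>g. h \<circ> g) ?C {g \<in> G. g \<circ> c \<circ> inv' g = y}"
    proof (rule bij_betw_byWitness[where f' = "\<lambda>g. inv' h \<circ> g"])
      show "\<forall>g\<in>?C. inv' h \<circ> (h \<circ> g) = g" "\<forall>g\<in>{g \<in> G. g \<circ> c \<circ> inv' g = y}. h \<circ> (inv' h \<circ> g) = g"
        using h by (auto simp: fun_eq_iff)
      show "(\<lambda>g. h \<circ> g) ` ?C \<subseteq> {g \<in> G. g \<circ> c \<circ> inv' g = y}"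
      proof (clarify)
        fix g assume g: "g \<in> G" "g \<circ> c = c \<circ> g"
        have "h \<circ> g \<in> G" using comp_mem[OF h(1) g(1)] .
        moreover have "(h \<circ> g) \<circ> c = y \<circ> (h \<circ> g)"
          using g(2) h by (simp add: fun_eq_iff)
        ultimately show "h \<circ> g \<in> G \<and> h \<circ> g \<circ> c \<circ> inv' (h \<circ> g) = y" using conj_iff by blast
      qed
      show "(\<lambda>g. inv' h \<circ> g) ` {g \<in> G. g \<circ> c \<circ> inv' g = y} \<subseteq> ?C"
      proof (clarify)
        fix g assume g: "g \<in> G" "y = g \<circ> c \<circ> inv' g"
        then have "g \<circ> c = y \<circ> g" using conj_iff by blast
        then have "inv' h \<circ> g \<circ> c = c \<circ> (inv' h \<circ> g)" using h by (simp add: fun_eq_iff)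
        moreover have "inv' h \<circ> g \<in> G" using comp_mem[OF inv_mem[OF h(1)] g(1)] .
        ultimately show "inv' h \<circ> g \<in> G \<and> inv' h \<circ> g \<circ> c = c \<circ> (inv' h \<circ> g)" by blast
      qed
    qed
    from bij_betw_same_card[OF this] show "card {g \<in> G. g \<circ> c \<circ> inv' g = y} = card ?C" by simp
  qed
  finally show ?thesis by simp
qed

text \<open>Both counts of chains are compared for empty S, and the size of the class of c is
  cancelled from the order of G. By transitivity \<Omega> is the only orbit, so the density concerns
  all fixed points of c.\<close>

lemma centralizer_large:
  assumes trans: "\<And>x y. x \<in> \<Omega> \<Longrightarrow> y \<in> \<Omega> \<Longrightarrow> y \<in> orb x"
    and dense: "(W + j) * card \<Omega> \<le> card (fixpts \<Omega> c) * p"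
  shows "(W * p) ^ j \<le> card \<Omega> ^ j * card {g \<in> G. g \<circ> c = c \<circ> g}"
proof -
  have St0: "St {} = G" and Cl0: "ClS {} = Cl" using Cl_mem by (auto simp: St_def ClS_def)
  have orb: "orbS {} x = \<Omega>" if "x \<in> \<Omega>" for x
    using trans orb_subset that unfolding St0 orb_def by blast
  obtain x where x: "c x \<noteq> x" using c_nontriv by (auto simp: fun_eq_iff)
  then have x\<Omega>: "x \<in> \<Omega>" using permutes_points[OF c_mem] by (meson permutes_not_in)
  have xcl: "x \<notin> closure {}" using x c_Cl Cl0 by (auto simp: closure_def)
  have lower: "W ^ j \<le> ext_count j {} y" if "y \<in> Cl" for y
  proof (rule ext_count_lower[OF _ x\<Omega> xcl])
    show "y \<in> ClS {}" using that Cl0 by simp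
    have "fixpts \<Omega> y \<inter> \<Omega> = fixpts \<Omega> y" by (auto simp: fixpts_def)
    then show "(W + j) * card (orbS {} x) \<le> card (fixpts \<Omega> y \<inter> orbS {} x) * p"
      using dense Cl_fixpts[OF that] orb[OF x\<Omega>] by simp
  qed
  let ?C = "{g \<in> G. g \<circ> c = c \<circ> g}"
  have "card Cl * W ^ j \<le> (\<Sum>y\<in>Cl. ext_count j {} y)"
    using sum_mono[of Cl "\<lambda>_. W ^ j"] lower by simp
  then have "card Cl * W ^ j * p ^ j \<le> card \<Omega> ^ j * card G"
    using ext_count_upper[where j = j and S = "{}"] St0 Cl0 by (simp) (meson le_trans mult_le_mono1)
  also have "\<dots> = card Cl * (card \<Omega> ^ j * card ?C)" using card_Cl by simp
  finally have "card Cl * (W * p) ^ j \<le> card Cl * (card \<Omega> ^ j * card ?C)"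
    by (simp add: power_mult_distrib mult_ac)
  moreover have "0 < card Cl" using c_Cl finite_Cl card_gt_0_iff by blast
  ultimately show ?thesis by simp
qed

text \<open>A centralizing element is determined on the support of c by the image of one point from
  each of the a cycles, which leaves at most \<open>card \<Omega> ^ a\<close> restrictions. Two
  centralizing elements with equal restriction differ by an element supported on the fixed points of
  c.\<close>

lemma small_support:
  assumes "card \<Omega> ^ a < card {g \<in> G. g \<circ> c = c \<circ> g}"
    and ca: "card \<Omega> = a * p + card (fixpts \<Omega> c)"
  obtains z where "z \<in> G" "z \<noteq> id" "\<And>x. z x \<noteq> x \<Longrightarrow> x \<in> fixpts \<Omega> c"
proof -
  let ?C = "{g \<in> G. g \<circ> c = c \<circ> g}"
  define M where "M = \<Omega> - fixpts \<Omega> c"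
  have M1: "finite M" using finite_points by (simp add: M_def)
  have M2: "c ` M \<subseteq> M"
    using mem_points[OF c_mem] eq_iff[OF c_mem] by (auto simp: M_def fixpts_def)
  have M3: "\<And>x. x \<in> M \<Longrightarrow> (c ^^ p) x = x" "\<And>x. x \<in> M \<Longrightarrow> c x \<noteq> x"
    using c_pow by (auto simp: M_def fixpts_def)
  obtain R where R: "R \<subseteq> M" "card R * p = card M" "M = (\<Union>x\<in>R. range (\<lambda>i. (c ^^ i) x))"
    by (rule prime_cycle_reps[OF prime_p M1 M2 M3])
  have "card M = card \<Omega> - card (fixpts \<Omega> c)"
    unfolding M_def by (rule card_Diff_subset) (auto simp: fixpts_def finite_points)
  then have "card R * p = a * p" using ca R(2) by simp
  then have cR: "card R = a" using prime_gt_0_nat[OF prime_p] by simp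
  have finR: "finite R" using R(1) M1 finite_subset by auto
  have sub: "(\<lambda>g. restrict g R) ` ?C \<subseteq> R \<rightarrow>\<^sub>E \<Omega>"
    using R(1) mem_points by (auto simp: M_def)
  have cPi: "card (R \<rightarrow>\<^sub>E \<Omega>) = card \<Omega> ^ a" using finR cR by (simp add: card_PiE)
  have "finite (R \<rightarrow>\<^sub>E \<Omega>)" using finR finite_points by (simp add: finite_PiE)
  then have "card ((\<lambda>g. restrict g R) ` ?C) < card ?C"
    using assms(1) card_mono[OF _ sub] cPi by simp
  then have "\<not> inj_on (\<lambda>g. restrict g R) ?C" using pigeonhole by blast
  then obtain g h where gh: "g \<in> ?C" "h \<in> ?C" "g \<noteq> h" "restrict g R = restrict h R"
    by (auto simp: inj_on_def)
  have eqR: "g x = h x" if "x \<in> R" for x using fun_cong[OF gh(4), of x] that by simp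
  have com: "k ((c ^^ i) x) = (c ^^ i) (k x)" if "k \<circ> c = c \<circ> k" for k i x
  proof (induction i)
    case (Suc i)
    then show ?case using fun_cong[OF that, of "(c ^^ i) x"] by simp
  qed simp
  have eqM: "g x = h x" if "x \<in> M" for x
  proof -
    obtain r i where "r \<in> R" "x = (c ^^ i) r" using R(3) \<open>x \<in> M\<close> by blast
    then show ?thesis using com[of g i r] com[of h i r] eqR gh by simp
  qed
  define z where "z = inv' h \<circ> g"
  show ?thesis
  proof (rule that[of z])
    show "z \<in> G" using gh comp_mem inv_mem by (simp add: z_def)
    show "z \<noteq> id"
    proof
      assume "z = id"
      then have "h \<circ> (inv' h \<circ> g) = h" by (simp add: z_def)
      then have "g = h" using gh by (simp add: fun_eq_iff)
      then show False using gh by simp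
    qed
    show "x \<in> fixpts \<Omega> c" if "z x \<noteq> x" for x
    proof (rule ccontr)
      assume n: "x \<notin> fixpts \<Omega> c"
      show False
      proof (cases "x \<in> \<Omega>")
        case True
        then have "g x = h x" using n eqM by (simp add: M_def)
        then show False using \<open>z x \<noteq> x\<close> gh by (simp add: z_def)
      next
        case False
        then have "z x = x" using \<open>z \<in> G\<close> permutes_points permutes_not_in by metis
        then show False using \<open>z x \<noteq> x\<close> by simp
      qed
    qed
  qed
qed

end

section \<open>3-cycles, blocks and primitive groups\<close>

definition tri :: "'a \<Rightarrow> 'a \<Rightarrow> 'a \<Rightarrow> 'a \<Rightarrow> 'a" where
  "tri a b c x = (if x = a then b else if x = b then c else if x = c then a else x)"

lemma tri_rotate: "distinct [a, b, c] \<Longrightarrow> tri b c a = tri a b c"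
  by (auto simp: tri_def fun_eq_iff)

lemma tri_square: "distinct [a, b, c] \<Longrightarrow> tri a b c \<circ> tri a b c = tri a c b"
  by (auto simp: tri_def fun_eq_iff)

lemma cycle_of_list_tri: "distinct [a, b, c] \<Longrightarrow> cycle_of_list [a, b, c] = tri a b c"
  by (auto simp: tri_def fun_eq_iff transpose_def)

context perm_group
begin

definition is_block :: "'a set \<Rightarrow> bool" where
  "is_block B \<longleftrightarrow> B \<subseteq> \<Omega> \<and> B \<noteq> {} \<and> (\<forall>g\<in>G. g ` B = B \<or> g ` B \<inter> B = {})"

definition transitive :: bool where
  "transitive \<longleftrightarrow> (\<forall>x\<in>\<Omega>. \<forall>y\<in>\<Omega>. y \<in> orb x)"

definition primitive :: bool where
  "primitive \<longleftrightarrow> transitive \<and> (\<forall>B. is_block B \<longrightarrow> card B = 1 \<or> B = \<Omega>)"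

text \<open>The class of x in \<Omega> is a block with more than one point: a translate that meets
  the class is contained in it, and equal to it by cardinality.\<close>

lemma primitive_equiv:
  assumes prim: "primitive"
    and R: "\<And>x. R x x" "\<And>x y. R x y \<Longrightarrow> R y x" "\<And>x y z. R x y \<Longrightarrow> R y z \<Longrightarrow> R x z"
    and inv: "\<And>g x y. g \<in> G \<Longrightarrow> R x y \<Longrightarrow> R (g x) (g y)"
    and xy: "x \<in> \<Omega>" "y \<in> \<Omega>" "x \<noteq> y" "R x y" and uv: "u \<in> \<Omega>" "v \<in> \<Omega>"
  shows "R u v"
proof -
  define B where "B = {w \<in> \<Omega>. R x w}"
  have finB: "finite B" using finite_points by (simp add: B_def)
  have "is_block B" unfolding is_block_def
  proof (intro conjI ballI)
    show "B \<subseteq> \<Omega>" by (auto simp: B_def)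
    show "B \<noteq> {}" using xy(1) R(1)[of x] by (auto simp: B_def)
    fix g assume g: "g \<in> G"
    show "g ` B = B \<or> g ` B \<inter> B = {}"
    proof (cases "g ` B \<inter> B = {}")
      case False
      then obtain w where w: "w \<in> B" "g w \<in> B" by auto
      have "g ` B \<subseteq> B"
      proof
        fix v' assume "v' \<in> g ` B"
        then obtain v where v: "v \<in> B" "v' = g v" by auto
        have "R x w" "R x v" "R x (g w)" using w v by (auto simp: B_def)
        then have "R w v" using R(3)[OF R(2)[OF \<open>R x w\<close>]] by blast
        then have "R (g w) (g v)" using inv[OF g] by simp
        with \<open>R x (g w)\<close> have "R x (g v)" by (rule R(3))
        moreover have "g v \<in> \<Omega>" using v mem_points[OF g] by (auto simp: B_def)
        ultimately show "v' \<in> B" using v by (simp add: B_def)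
      qed
      moreover have "card (g ` B) = card B"
        using card_image[OF inj_on_subset[OF group_inj[OF g] subset_UNIV]] .
      ultimately show ?thesis using card_subset_eq[OF finB] by simp
    qed simp
  qed
  then consider "card B = 1" | "B = \<Omega>" using prim by (auto simp: primitive_def)
  then show ?thesis
  proof cases
    case 1
    moreover have "{x, y} \<subseteq> B" using xy R(1)[of x] by (auto simp: B_def)
    then have "card {x, y} \<le> card B" using card_mono[OF finB] by blast
    ultimately show ?thesis using xy by simp
  next
    case 2
    then have "R x u" "R x v" using uv by (auto simp: B_def)
    then show ?thesis using R(3)[OF R(2)] by blast
  qed
qed

lemma tri_conj:
  assumes "g \<in> G" "distinct [a, b, c]" "tri a b c \<in> G"
  shows "tri (g a) (g b) (g c) \<in> G"
proof -
  have "g \<circ> tri a b c \<circ> inv' g = tri (g a) (g b) (g c)"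
  proof
    fix x
    define y where "y = inv' g x"
    then have x: "x = g y" using assms(1) by simp
    show "(g \<circ> tri a b c \<circ> inv' g) x = tri (g a) (g b) (g c) x"
      unfolding x using assms(1,2) by (simp add: tri_def eq_iff)
  qed
  then show ?thesis using conj_mem[OF assms(1,3)] by simp
qed

lemma distinct_image: "g \<in> G \<Longrightarrow> distinct [a, b, c] \<Longrightarrow> distinct [g a, g b, g c]"
  by (simp add: eq_iff)

lemma tri_reverse: "distinct [a, b, c] \<Longrightarrow> tri a b c \<in> G \<Longrightarrow> tri a c b \<in> G"
  using comp_mem[of "tri a b c" "tri a b c"] tri_square by metis

lemma tri_moved_mem:
  assumes "distinct [a, b, c]" "tri a b c \<in> G" shows "a \<in> \<Omega>" "b \<in> \<Omega>" "c \<in> \<Omega>"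
proof -
  have "tri a b c a \<noteq> a" "tri a b c b \<noteq> b" "tri a b c c \<noteq> c" using assms(1) by (auto simp: tri_def)
  then show "a \<in> \<Omega>" "b \<in> \<Omega>" "c \<in> \<Omega>"
    using permutes_not_in[OF permutes_points[OF assms(2)]] by metis+
qed

text \<open>Jordan's argument for 3-cycles. Lying on a common 3-cycle of G is an invariant
  equivalence relation, hence universal; conjugation then exchanges the third point of a 3-cycle for
  any other.\<close>

lemma primitive_three_cycles:
  assumes prim: "primitive" and t: "distinct [u, v, w]" "tri u v w \<in> G"
    and abd: "a \<in> \<Omega>" "b \<in> \<Omega>" "d \<in> \<Omega>" "distinct [a, b, d]"
  shows "tri a b d \<in> G"
proof -
  define R where "R x y \<longleftrightarrow> x = y \<or> (\<exists>z. distinct [x, y, z] \<and> tri x y z \<in> G)" for x y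
  have R1: "R x x" for x by (simp add: R_def)
  have R2: "R y x" if "R x y" for x y
  proof (cases "x = y")
    case False
    then obtain z where z: "distinct [x, y, z]" "tri x y z \<in> G" using \<open>R x y\<close> by (auto simp: R_def)
    then have "tri x z y \<in> G" using tri_reverse by blast
    then have "tri y x z \<in> G" using tri_rotate[of y x z] z(1) by auto
    then show ?thesis using z(1) by (auto simp: R_def)
  qed (simp add: R_def)
  have R3: "R x z" if xy: "R x y" and yz: "R y z" for x y z
  proof (cases "x = y \<or> y = z \<or> x = z")
    case True then show ?thesis using xy yz R1 by auto
  next
    case False
    obtain s where s: "distinct [x, y, s]" "tri x y s \<in> G" using xy False unfolding R_def by auto
    obtain t where t: "distinct [y, z, t]" "tri y z t \<in> G" using yz False unfolding R_def by auto
    show ?thesis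
    proof (cases "t = x")
      case True
      then have "tri x y z \<in> G" using tri_rotate[of x y z] t False by auto
      then have "tri x z y \<in> G" using tri_reverse[of x y z] False by auto
      then show ?thesis using False unfolding R_def by (intro disjI2 exI[of _ y]) auto
    next
      case tx: False
      \<comment> \<open>Conjugating the cycle through x, y, s by g sends y to z and keeps x, which
        puts x and z on one 3-cycle.\<close>
      define g where "g = tri y z t"
      have g: "g \<in> G" "g x = x" "g y = z" using t tx False by (auto simp: g_def tri_def)
      have "tri x z (g s) \<in> G" using tri_conj[OF g(1) s] g by simp
      moreover have "distinct [x, z, g s]" using distinct_image[OF g(1) s(1)] g by simp
      ultimately show ?thesis by (auto simp: R_def)
    qed
  qed
  have R4: "R (g x) (g y)" if g: "g \<in> G" and xy: "R x y" for g x y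
  proof (cases "x = y")
    case False
    then obtain z where z: "distinct [x, y, z]" "tri x y z \<in> G" using xy by (auto simp: R_def)
    show ?thesis using tri_conj[OF g z] distinct_image[OF g z(1)] unfolding R_def by blast
  qed (simp add: R_def)
  have uvR: "R u v" "u \<noteq> v" using t unfolding R_def by auto
  have all: "R x y" if "x \<in> \<Omega>" "y \<in> \<Omega>" for x y
  proof (rule primitive_equiv[of R u v x y, OF prim])
    show "R (g x) (g y)" if "g \<in> G" "R x y" for g x y using R4 that by blast
    show "R x z" if "R x y" "R y z" for x y z using R3 that by blast
  qed (use R1 R2 tri_moved_mem(1,2)[OF t] uvR that in auto)
  obtain c where c: "distinct [a, b, c]" "tri a b c \<in> G" using all[of a b] abd unfolding R_def by auto
  show ?thesis
  proof (cases "c = d")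
    case True then show ?thesis using c by simp
  next
    case False
    have "c \<in> \<Omega>" using tri_moved_mem[OF c] by simp
    then obtain e where e: "distinct [c, d, e]" "tri c d e \<in> G"
      using all[of c d] abd False unfolding R_def by auto
    \<comment> \<open>Conjugation by g replaces c with d unless e is a or b. In these cases the
      inverse g' sends c to e and e to d, which gives the wanted cycle up to rotation and
      reversal.\<close>
    define g where "g = tri c d e"
    define g' where "g' = tri c e d"
    have g: "g \<in> G" "g' \<in> G" using e tri_reverse by (auto simp: g_def g'_def)
    consider "e \<noteq> a" "e \<noteq> b" | "e = a" | "e = b" by blast
    then show ?thesis
    proof cases
      case 1
      then have "g a = a" "g b = b" "g c = d" using c(1) abd by (auto simp: g_def tri_def)
      then show ?thesis using tri_conj[OF g(1) c] by simp
    next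
      case 2
      then have "g' a = d" "g' b = b" "g' c = a" using c(1) abd by (auto simp: g'_def tri_def)
      then have "tri d b a \<in> G" using tri_conj[OF g(2) c] by simp
      then have "tri d a b \<in> G" using tri_reverse[of d b a] abd by auto
      then show ?thesis using tri_rotate[of d a b] abd by auto
    next
      case 3
      then have "g' a = a" "g' b = d" "g' c = b" using c(1) abd by (auto simp: g'_def tri_def)
      then have "tri a d b \<in> G" using tri_conj[OF g(2) c] by simp
      then show ?thesis using tri_reverse[of a d b] abd by auto
    qed
  qed
qed

text \<open>The point z o1 is moved by z and differs from o1, so w fixes it; symmetrically z fixes w
  o1. Away from these three points the commutator is trivial because z and w have no other common
  moved point.\<close>

lemma commutator_three_cycle:
  assumes "z \<in> G" "w \<in> G" and sup: "{x. z x \<noteq> x} \<inter> {x. w x \<noteq> x} = {o1}"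
  shows "distinct [o1, z o1, w o1]" "tri o1 (z o1) (w o1) \<in> G"
proof -
  have o1: "z o1 \<noteq> o1" "w o1 \<noteq> o1" using sup by auto
  have one: "z x = x \<or> w x = x" if "x \<noteq> o1" for x using sup that by auto
  have zi: "inv' z y = x \<longleftrightarrow> y = z x" for x y using assms(1) by (metis inv_cancel)
  have wi: "inv' w y = x \<longleftrightarrow> y = w x" for x y using assms(2) by (metis inv_cancel)
  have ez: "z x = z y \<longleftrightarrow> x = y" for x y using eq_iff[OF assms(1)] .
  have ew: "w x = w y \<longleftrightarrow> x = y" for x y using eq_iff[OF assms(2)] .
  have wz: "w (z o1) = z o1" using one[of "z o1"] o1 ez by metis
  have zw: "z (w o1) = w o1" using one[of "w o1"] o1 ew by metis
  have ne: "z o1 \<noteq> w o1" using o1 wz zw ew ez by metis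
  show d: "distinct [o1, z o1, w o1]" using o1 ne by auto
  define k where "k = z \<circ> w \<circ> inv' z \<circ> inv' w"
  have kG: "k \<in> G" unfolding k_def using assms by (intro comp_mem inv_mem)
  have "k x = tri o1 (z o1) (w o1) x" for x
  proof -
    define y where "y = inv' w x"
    define v where "v = inv' z y"
    have xy: "x = w y" and yv: "y = z v" using assms by (auto simp: y_def v_def)
    have kx: "k x = z (w v)" by (simp add: k_def y_def v_def)
    show ?thesis
    proof (cases "v = o1")
      case True
      then have "x = z o1" using xy yv wz by simp
      then show ?thesis using kx True zw d by (auto simp: tri_def)
    next
      case vo: False
      show ?thesis
      proof (cases "y = o1")
        case True
        have "w v = v" using one[OF vo] yv True vo by metis
        then have "k x = o1" using kx yv True by simp
        moreover have "x = w o1" using xy True by simp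
        ultimately show ?thesis using d by (auto simp: tri_def)
      next
        case yo: False
        show ?thesis
        proof (cases "z v = v")
          case True
          then have "k x = z x" using kx xy yv by simp
          moreover have "z x = (if x = o1 then z o1 else x)"
          proof (cases "x = o1")
            case False
            then show ?thesis using one[of x] xy yv True ew by metis
          qed simp
          moreover have "x \<noteq> z o1"
          proof
            assume "x = z o1"
            then have "w (z o1) = w y" using xy wz by simp
            then have "z o1 = z v" using ew yv by simp
            then show False using ez vo by simp
          qed
          moreover have "x \<noteq> w o1" using xy ew yo by simp
          ultimately show ?thesis by (auto simp: tri_def)
        next
          case zv: False
          then have wv: "w v = v" using one[OF vo] by simp
          have "z y \<noteq> y" using yv zv ez by simp
          then have "w y = y" using one[OF yo] by simp
          then have "x = y" "k x = x" using xy kx wv yv by auto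
          moreover have "x \<noteq> w o1" using xy ew yo by simp
          moreover have "x \<noteq> z o1" using \<open>x = y\<close> yv ez vo by simp
          ultimately show ?thesis using yo by (auto simp: tri_def)
        qed
      qed
    qed
  qed
  then have "k = tri o1 (z o1) (w o1)" by (rule ext)
  then show "tri o1 (z o1) (w o1) \<in> G" using kG by simp
qed

text \<open>A nonempty fibre is a coset of the pointwise stabilizer.\<close>

lemma fiber_card_le: "card {g \<in> G. \<forall>i\<in>I. g (f i) = h i} \<le> card {g \<in> G. \<forall>i\<in>I. g (f i) = f i}"
proof (cases "{g \<in> G. \<forall>i\<in>I. g (f i) = h i} = {}")
  case False
  then obtain g0 where g0: "g0 \<in> G" "\<forall>i\<in>I. g0 (f i) = h i" by auto
  show ?thesis
  proof (rule card_inj_on_le[of "\<lambda>g. inv' g0 \<circ> g"])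
    show "inj_on (\<lambda>g. inv' g0 \<circ> g) {g \<in> G. \<forall>i\<in>I. g (f i) = h i}"
    proof (rule inj_onI)
      fix g g' assume "inv' g0 \<circ> g = inv' g0 \<circ> g'"
      then have "g0 \<circ> (inv' g0 \<circ> g) = g0 \<circ> (inv' g0 \<circ> g')" by simp
      then show "g = g'" using g0 by (simp add: o_assoc)
    qed
    have "inv' g0 (h i) = f i" if "i \<in> I" for i using g0 that inv_cancel(1)[OF g0(1), of "f i"] by simp
    then show "(\<lambda>g. inv' g0 \<circ> g) ` {g \<in> G. \<forall>i\<in>I. g (f i) = h i} \<subseteq> {g \<in> G. \<forall>i\<in>I. g (f i) = f i}"
      using g0 by (auto intro: comp_mem inv_mem)
    show "finite {g \<in> G. \<forall>i\<in>I. g (f i) = f i}" using finite_group by simp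
  qed
next
  case True
  then show ?thesis by (simp only: card.empty)
qed

end

lemma card_off_diagonal:
  assumes "finite A"
  shows "card {(u, v). u \<in> A \<and> v \<in> A \<and> u \<noteq> v} = card A * (card A - 1)"
proof -
  have "{(u, v). u \<in> A \<and> v \<in> A \<and> u \<noteq> v} = A \<times> A - (\<lambda>x. (x, x)) ` A" by auto
  moreover have "card (A \<times> A - (\<lambda>x. (x, x)) ` A) = card (A \<times> A) - card ((\<lambda>x. (x, x)) ` A)"
    using assms by (intro card_Diff_subset) auto
  moreover have "card ((\<lambda>x. (x, x)) ` A) = card A" by (intro card_image) (auto simp: inj_on_def)
  ultimately show ?thesis using assms by (simp add: card_cartesian_product algebra_simps)
qed

section \<open>Large subdegrees and a translate meeting a set in one point\<close>

context prime_perm_group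
begin

text \<open>If y lay in the closure of x, having the same conjugates of c in the point stabilizer
  would be an invariant relation between distinct points, hence universal by primitivity. As c fixes
  some point it would then fix all of them.\<close>

lemma primitive_subdegree:
  assumes "primitive" "fixpts \<Omega> c \<noteq> {}" "x \<in> \<Omega>" "y \<in> \<Omega>" "x \<noteq> y"
  shows "p \<le> card (orbS {x} y)"
proof (rule card_orbS_ge[OF assms(4)], rule notI)
  assume ycl: "y \<in> closure {x}"
  have St0: "St {} = G" by (auto simp: St_def)
  have "y \<in> orb x" using assms by (auto simp: primitive_def transitive_def)
  then have "y \<in> orbS {} x" by (simp add: St0 orb_def)
  then have eq: "ClS {y} = ClS {x}" using closure_insert_orbit[of y x "{}"] ycl by simp
  have inv: "ClS {g u} = ClS {g v}" if "g \<in> G" "ClS {u} = ClS {v}" for g u v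
    using bij_betw_imp_surj_on[OF ClS_orbit_bij[of g "{}" u]]
      bij_betw_imp_surj_on[OF ClS_orbit_bij[of g "{}" v]] that by (simp add: St0)
  have all: "ClS {u} = ClS {v}" if "u \<in> \<Omega>" "v \<in> \<Omega>" for u v
  proof (rule primitive_equiv[where R = "\<lambda>u v. ClS {u} = ClS {v}" and x = x and y = y, OF assms(1)])
    show "ClS {g u} = ClS {g v}" if "g \<in> G" "ClS {u} = ClS {v}" for g u v by (rule inv[OF that])
  qed (use assms eq that in simp_all)
  obtain f where f: "f \<in> \<Omega>" "c f = f" using assms(2) by (auto simp: fixpts_def)
  then have "c \<in> ClS {f}" using c_Cl c_mem by (auto simp: ClS_def St_def)
  then have "c v = v" if "v \<in> \<Omega>" for v using all[OF f(1) that] by (auto simp: ClS_def St_def)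
  then have "c = id" using permutes_points[OF c_mem] by (auto simp: fun_eq_iff permutes_def)
  then show False using c_nontriv by simp
qed

text \<open>A moment argument for the number X of points of Z that a random g sends into Z. The mean
  of X is m^2/n; that of X (X - 1) is at most (m (m - 1))^2/(n p), because two-point stabilizers
  have index at least n p. If X never took the value 1, then X \<le> X (X - 1) throughout, which
  forces p \<le> (m - 1)^2.\<close>

lemma primitive_meet_one:
  assumes prim: "primitive" "fixpts \<Omega> c \<noteq> {}" and Z: "Z \<subseteq> \<Omega>" "Z \<noteq> {}" "(card Z - 1)\<^sup>2 < p"
  shows "\<exists>g\<in>G. card {u \<in> Z. g u \<in> Z} = 1"
proof (rule ccontr)
  assume "\<not> ?thesis"
  then have no: "card {u \<in> Z. g u \<in> Z} \<noteq> 1" if "g \<in> G" for g using that by blast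
  define X where "X g = card {u \<in> Z. g u \<in> Z}" for g :: "'a \<Rightarrow> 'a"
  define m where "m = card Z"
  define n where "n = card \<Omega>"
  define D where "D = {(u, v). u \<in> Z \<and> v \<in> Z \<and> u \<noteq> v}"
  have finZ: "finite Z" using Z(1) finite_points finite_subset by auto
  have mpos: "0 < m" using finZ Z(2) by (simp add: m_def card_gt_0_iff)
  have cD: "card D = m * (m - 1)" unfolding D_def m_def by (rule card_off_diagonal[OF finZ])
  have finD: "finite D" by (rule finite_subset[of _ "Z \<times> Z"]) (auto simp: D_def finZ)
  have orb\<Omega>: "orb u = \<Omega>" if "u \<in> \<Omega>" for u
    using prim that orb_subset[OF that] by (auto simp: primitive_def transitive_def)
  have stab: "n * card {g \<in> G. g u = u} = card G" if "u \<in> \<Omega>" for u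
    using orbit_stabilizer[of u] orb\<Omega>[OF that] by (simp add: n_def)
  \<comment> \<open>No fibre is larger than the stabilizer of u, and the n fibres together fill G,
    so all of them have the same size.\<close>
  have stab_v: "n * card {g \<in> G. g u = v} = card G" if "u \<in> \<Omega>" "v \<in> \<Omega>" for u v
  proof -
    have "card {g \<in> G. g u = v} \<le> card {g \<in> G. g u = u}" for u v
      using fiber_card_le[of "{()}" "\<lambda>_. u" "\<lambda>_. v"] by simp
    note le = this
    have "card G = (\<Sum>w\<in>\<Omega>. card {g \<in> G. g u = w})"
      using sum.image_gen[OF finite_group, of "\<lambda>_. 1::nat" "\<lambda>g. g u"] orb\<Omega>[OF that(1)]
      by (simp add: orb_def)
    also have "\<dots> = card {g \<in> G. g u = v} + (\<Sum>w\<in>\<Omega> - {v}. card {g \<in> G. g u = w})"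
      using sum.remove[OF finite_points that(2), of "\<lambda>w. card {g \<in> G. g u = w}"] by simp
    also have "\<dots> \<le> card {g \<in> G. g u = v} + (\<Sum>w\<in>\<Omega> - {v}. card {g \<in> G. g u = u})"
      using le by (intro add_left_mono sum_mono)
    also have "\<dots> = card {g \<in> G. g u = v} + (n - 1) * card {g \<in> G. g u = u}"
      using that finite_points by (simp add: n_def)
    finally have "n * card {g \<in> G. g u = u} \<le> card {g \<in> G. g u = v} + (n - 1) * card {g \<in> G. g u = u}"
      using stab[OF that(1)] by simp
    moreover have "0 < n" using that finite_points by (auto simp: n_def card_gt_0_iff)
    then have "n * card {g \<in> G. g u = u} = card {g \<in> G. g u = u} + (n - 1) * card {g \<in> G. g u = u}"
      by (cases n) auto
    ultimately have "card {g \<in> G. g u = v} = card {g \<in> G. g u = u}" using le[of u v] by linarith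
    then show ?thesis using stab[OF that(1)] by simp
  qed
  have sumX: "n * (\<Sum>g\<in>G. X g) = m * m * card G"
  proof -
    have "(\<Sum>g\<in>G. X g) = (\<Sum>g\<in>G. \<Sum>u\<in>{u. u \<in> Z \<and> g u \<in> Z}. 1)" by (simp add: X_def)
    also have "\<dots> = (\<Sum>u\<in>Z. \<Sum>g\<in>{g. g \<in> G \<and> g u \<in> Z}. 1)"
      by (rule sum.swap_restrict[OF finite_group finZ])
    also have "\<dots> = (\<Sum>u\<in>Z. \<Sum>v\<in>Z. card {g \<in> G. g u = v})"
    proof (rule sum.cong[OF refl])
      fix u assume "u \<in> Z"
      have "{g. g \<in> G \<and> g u \<in> Z} = (\<Union>v\<in>Z. {g \<in> G. g u = v})" by auto
      moreover have "card (\<Union>v\<in>Z. {g \<in> G. g u = v}) = (\<Sum>v\<in>Z. card {g \<in> G. g u = v})"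
        using finZ finite_group by (intro card_UN_disjoint) auto
      ultimately show "(\<Sum>g\<in>{g. g \<in> G \<and> g u \<in> Z}. 1) = (\<Sum>v\<in>Z. card {g \<in> G. g u = v})" by simp
    qed
    finally have "n * (\<Sum>g\<in>G. X g) = (\<Sum>u\<in>Z. \<Sum>v\<in>Z. n * card {g \<in> G. g u = v})"
      by (simp add: sum_distrib_left)
    also have "\<dots> = (\<Sum>u\<in>Z. \<Sum>v\<in>Z. card G)" using stab_v Z(1) by (intro sum.cong refl) auto
    finally show ?thesis by (simp add: m_def mult_ac)
  qed
  have two: "n * p * card {g \<in> G. g u = v \<and> g u' = v'} \<le> card G"
    if "u \<in> \<Omega>" "u' \<in> \<Omega>" "u \<noteq> u'" for u u' v v'
  proof -
    have "card {g \<in> G. g u = v \<and> g u' = v'} \<le> card {g \<in> G. g u = u \<and> g u' = u'}"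
      using fiber_card_le[of "{0, 1 :: nat}" "\<lambda>b. if b = 0 then u else u'" "\<lambda>b. if b = 0 then v else v'"]
      by simp
    also have "{g \<in> G. g u = u \<and> g u' = u'} = St (insert u' {u})" by (auto simp: St_def)
    finally have "p * card {g \<in> G. g u = v \<and> g u' = v'} \<le> p * card (St (insert u' {u}))" by simp
    also have "\<dots> \<le> card (orbS {u} u') * card (St (insert u' {u}))"
      using primitive_subdegree[OF prim that] by (intro mult_right_mono) auto
    also have "\<dots> = card (St {u})"
      using perm_group.orbit_stabilizer[OF St_group] orbS_orb St_insert by metis
    also have "St {u} = {g \<in> G. g u = u}" by (auto simp: St_def)
    finally have "n * (p * card {g \<in> G. g u = v \<and> g u' = v'}) \<le> n * card {g \<in> G. g u = u}"
      by (rule mult_le_mono2)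
    also have "\<dots> = card G" by (rule stab[OF that(1)])
    finally have "n * (p * card {g \<in> G. g u = v \<and> g u' = v'}) \<le> card G" .
    then show ?thesis by (simp add: mult_ac)
  qed
  have sumY: "n * p * (\<Sum>g\<in>G. X g * (X g - 1)) \<le> (m * (m - 1)) * (m * (m - 1)) * card G"
  proof -
    have Y: "X g * (X g - 1) = (\<Sum>d\<in>{d. d \<in> D \<and> g (fst d) \<in> Z \<and> g (snd d) \<in> Z}. 1)" for g
    proof -
      have "{d. d \<in> D \<and> g (fst d) \<in> Z \<and> g (snd d) \<in> Z}
        = {(u, v). u \<in> {u \<in> Z. g u \<in> Z} \<and> v \<in> {u \<in> Z. g u \<in> Z} \<and> u \<noteq> v}" by (auto simp: D_def)
      then show ?thesis using card_off_diagonal[of "{u \<in> Z. g u \<in> Z}"] finZ by (simp add: X_def)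
    qed
    have "(\<Sum>g\<in>G. X g * (X g - 1)) = (\<Sum>d\<in>D. \<Sum>g\<in>{g. g \<in> G \<and> g (fst d) \<in> Z \<and> g (snd d) \<in> Z}. 1)"
      unfolding Y by (rule sum.swap_restrict[OF finite_group finD])
    also have "\<dots> = (\<Sum>d\<in>D. card {g. g \<in> G \<and> g (fst d) \<in> Z \<and> g (snd d) \<in> Z})" by simp
    also have "\<dots> \<le> (\<Sum>d\<in>D. \<Sum>e\<in>D. card {g \<in> G. g (fst d) = fst e \<and> g (snd d) = snd e})"
    proof (rule sum_mono)
      fix d assume d: "d \<in> D"
      have "{g. g \<in> G \<and> g (fst d) \<in> Z \<and> g (snd d) \<in> Z}
        \<subseteq> (\<Union>e\<in>D. {g \<in> G. g (fst d) = fst e \<and> g (snd d) = snd e})"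
      proof
        fix g assume g: "g \<in> {g. g \<in> G \<and> g (fst d) \<in> Z \<and> g (snd d) \<in> Z}"
        then have "(g (fst d), g (snd d)) \<in> D" using d eq_iff[of g] by (auto simp: D_def)
        then show "g \<in> (\<Union>e\<in>D. {g \<in> G. g (fst d) = fst e \<and> g (snd d) = snd e})" using g by force
      qed
      then have "card {g. g \<in> G \<and> g (fst d) \<in> Z \<and> g (snd d) \<in> Z}
        \<le> card (\<Union>e\<in>D. {g \<in> G. g (fst d) = fst e \<and> g (snd d) = snd e})"
        using finite_group finD by (intro card_mono) auto
      also have "\<dots> \<le> (\<Sum>e\<in>D. card {g \<in> G. g (fst d) = fst e \<and> g (snd d) = snd e})"
        by (rule card_UN_le[OF finD])
      finally show "card {g. g \<in> G \<and> g (fst d) \<in> Z \<and> g (snd d) \<in> Z} \<le> \<dots>" .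
    qed
    finally have "n * p * (\<Sum>g\<in>G. X g * (X g - 1))
      \<le> n * p * (\<Sum>d\<in>D. \<Sum>e\<in>D. card {g \<in> G. g (fst d) = fst e \<and> g (snd d) = snd e})"
      by (rule mult_left_mono) simp
    also have "\<dots> = (\<Sum>d\<in>D. \<Sum>e\<in>D. n * p * card {g \<in> G. g (fst d) = fst e \<and> g (snd d) = snd e})"
      by (simp add: sum_distrib_left)
    also have "\<dots> \<le> (\<Sum>d\<in>D. \<Sum>e\<in>D. card G)"
      using Z(1) by (intro sum_mono two) (auto simp: D_def)
    finally show ?thesis by (simp add: cD mult_ac)
  qed
  have "X g \<le> X g * (X g - 1)" if "g \<in> G" for g
  proof -
    have "X g = 0 \<or> X g \<ge> 2" using no[OF that] by (auto simp: X_def)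
    then show ?thesis by (cases "X g = 0") auto
  qed
  then have "n * p * (\<Sum>g\<in>G. X g) \<le> n * p * (\<Sum>g\<in>G. X g * (X g - 1))"
    by (intro mult_left_mono sum_mono) auto
  also have "n * p * (\<Sum>g\<in>G. X g) = p * (n * (\<Sum>g\<in>G. X g))" by (simp only: mult_ac)
  also have "\<dots> = p * (m * m * card G)" by (simp only: sumX)
  finally have "p * (m * m * card G) \<le> (m * (m - 1)) * (m * (m - 1)) * card G"
    using sumY by (rule order_trans)
  then have "(m * m * card G) * p \<le> (m * m * card G) * (m - 1)\<^sup>2"
    by (simp add: power2_eq_square mult_ac)
  moreover have "0 < m * m * card G" using mpos finite_group id_mem card_gt_0_iff by fastforce
  ultimately have "p \<le> (m - 1)\<^sup>2" by (simp only: mult_le_cancel1)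
  then show False using Z(3) by (simp add: m_def)
qed

theorem primitive_contains_three_cycles:
  assumes prim: "primitive"
    and n: "card \<Omega> = a * p + card (fixpts \<Omega> c)" and b1: "fixpts \<Omega> c \<noteq> {}"
    and b2: "(card (fixpts \<Omega> c) - 1)\<^sup>2 < p"
    and j: "card \<Omega> ^ a < 2 ^ j" and b3: "(2 * (a + 1) + j) * card \<Omega> \<le> card (fixpts \<Omega> c) * p"
    and uvw: "u \<in> \<Omega>" "v \<in> \<Omega>" "w \<in> \<Omega>" "distinct [u, v, w]"
  shows "tri u v w \<in> G"
proof -
  have trans: "\<And>x y. x \<in> \<Omega> \<Longrightarrow> y \<in> \<Omega> \<Longrightarrow> y \<in> orb x"
    using prim by (auto simp: primitive_def transitive_def)
  have npos: "0 < card \<Omega>" using uvw finite_points by (auto simp: card_gt_0_iff)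
  \<comment> \<open>\<open>centralizer_large\<close> is used with W = 2 (a + 1). There are fewer
    than p fixed points, so the degree is below (a + 1) p and W p is at least twice the degree; the
    surplus factor 2 yields a centralizer of order at least 2^j.\<close>
  have "(2 * card \<Omega>) ^ j \<le> (2 * (a + 1) * p) ^ j"
    using n few_fixpts by (intro power_mono) (auto simp: algebra_simps)
  also have "\<dots> \<le> card \<Omega> ^ j * card {g \<in> G. g \<circ> c = c \<circ> g}"
    using centralizer_large[OF trans b3] .
  finally have "card \<Omega> ^ j * 2 ^ j \<le> card \<Omega> ^ j * card {g \<in> G. g \<circ> c = c \<circ> g}"
    by (simp add: power_mult_distrib mult.commute)
  then have "2 ^ j \<le> card {g \<in> G. g \<circ> c = c \<circ> g}" using npos by simp
  then have "card \<Omega> ^ a < card {g \<in> G. g \<circ> c = c \<circ> g}" using j by simp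
  then obtain z where z: "z \<in> G" "z \<noteq> id" "\<And>x. z x \<noteq> x \<Longrightarrow> x \<in> fixpts \<Omega> c"
    using small_support[OF _ n] by blast
  define Z where "Z = {x. z x \<noteq> x}"
  have ZF: "Z \<subseteq> fixpts \<Omega> c" using z(3) by (auto simp: Z_def)
  then have Z\<Omega>: "Z \<subseteq> \<Omega>" by (auto simp: fixpts_def)
  have Z0: "Z \<noteq> {}" using z(2) by (auto simp: Z_def fun_eq_iff)
  have "finite (fixpts \<Omega> c)" using finite_points by (simp add: fixpts_def)
  then have "card Z \<le> card (fixpts \<Omega> c)" using ZF by (rule card_mono)
  then have "(card Z - 1)\<^sup>2 \<le> (card (fixpts \<Omega> c) - 1)\<^sup>2" by (intro power_mono) auto
  then have Zp: "(card Z - 1)\<^sup>2 < p" using b2 by (rule order.strict_trans1)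
  obtain g where g: "g \<in> G" "card {u \<in> Z. g u \<in> Z} = 1"
    using primitive_meet_one[OF prim b1 Z\<Omega> Z0 Zp] by blast
  obtain u0 where u0: "{u \<in> Z. g u \<in> Z} = {u0}" using g(2) by (meson card_1_singletonE)
  \<comment> \<open>The support of w' is the translate of Z by g, and by the choice of g it shares
    exactly one point with Z.\<close>
  define w' where "w' = g \<circ> z \<circ> inv' g"
  have w': "w' \<in> G" unfolding w'_def by (rule conj_mem[OF g(1) z(1)])
  have moved: "w' (g x) \<noteq> g x \<longleftrightarrow> z x \<noteq> x" for x using g(1) by (simp add: w'_def eq_iff)
  have "{x. z x \<noteq> x} \<inter> {x. w' x \<noteq> x} = {g u0}"
  proof (intro subset_antisym subsetI)
    fix x assume x: "x \<in> {x. z x \<noteq> x} \<inter> {x. w' x \<noteq> x}"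
    define y where "y = inv' g x"
    have xy: "x = g y" using g(1) by (simp add: y_def)
    then have "y \<in> {u \<in> Z. g u \<in> Z}" using x moved[of y] by (auto simp: Z_def)
    then show "x \<in> {g u0}" using u0 xy by simp
  next
    fix x assume "x \<in> {g u0}"
    moreover have "u0 \<in> Z" "g u0 \<in> Z" using u0 by auto
    ultimately show "x \<in> {x. z x \<noteq> x} \<inter> {x. w' x \<noteq> x}" using moved[of u0] by (auto simp: Z_def)
  qed
  from commutator_three_cycle[OF z(1) w' this]
  show ?thesis using primitive_three_cycles[OF prim _ _ uvw] by blast
qed

end

section \<open>Transitivity and primitivity from cycle lengths\<close>

lemma orbit_size_arith:
  fixes a b p r i j :: nat
  assumes "r dvd a * p + b" "r dvd i * p + j" "i \<le> a" "j \<le> b" "a * b < r" "coprime a b" "0 < a"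
    "0 < i * p + j"
  shows "i = a \<and> j = b"
proof -
  \<comment> \<open>This combination eliminates p and leaves i b - a j, whose absolute value is at
    most a b < r; so it vanishes.\<close>
  have "int r dvd int i * int (a * p + b) - int a * int (i * p + j)"
    using assms(1,2) by (intro dvd_diff dvd_mult) (simp_all only: int_dvd_int_iff)
  then have d: "int r dvd int (i * b) - int (a * j)" by (simp add: algebra_simps)
  have le: "i * b \<le> a * b" "a * j \<le> a * b" using assms by auto
  then have "\<bar>int (i * b) - int (a * j)\<bar> < int r" using assms(5) by linarith
  then have "int (i * b) - int (a * j) = 0" using dvd_imp_le_int[OF _ d] by linarith
  then have eq: "i * b = a * j" by linarith
  then have "a dvd i * b" by simp
  then have "a dvd i" using assms(6) by (simp add: coprime_dvd_mult_left_iff)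
  then have "i = 0 \<or> i = a" using assms(3) by (metis dvd_imp_le le_antisym neq0_conv)
  then show ?thesis
  proof
    assume "i = 0"
    then have "j = 0" using eq assms(7) by simp
    then show ?thesis using \<open>i = 0\<close> assms(8) by simp
  next
    assume "i = a"
    then show ?thesis using eq assms(7) by simp
  qed
qed

context prime_perm_group
begin

lemma c_image: "c ` A \<subseteq> A \<Longrightarrow> finite A \<Longrightarrow> \<exists>i. card A = i * p + card (fixpts A c)"
  using card_fixpts_prime_order[OF prime_p, of A c] c_pow group_inj[OF c_mem]
  by (metis id_apply inj_on_subset subset_UNIV)

text \<open>An orbit is made of i cycles and j fixed points of c, and its size is a multiple of r
  because d has no fixed points; \<open>orbit_size_arith\<close> leaves only the whole of
  \<Omega>.\<close>

lemma transitive_of_orders: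
  assumes n: "card \<Omega> = a * p + card (fixpts \<Omega> c)" and d: "d \<in> G" "prime r" "d ^^ r = id" "fixpts \<Omega> d = {}"
    and r: "r dvd card \<Omega>" "a * card (fixpts \<Omega> c) < r" "coprime a (card (fixpts \<Omega> c))" "0 < a"
  shows "transitive"
  unfolding transitive_def
proof (intro ballI)
  fix x y assume x: "x \<in> \<Omega>" and y: "y \<in> \<Omega>"
  define U where "U = orb x"
  have U: "U \<subseteq> \<Omega>" "finite U" "x \<in> U" using x orb_subset finite_orb orb_self by (auto simp: U_def)
  have inv: "g ` U \<subseteq> U" if "g \<in> G" for g using orb_image[OF that] by (auto simp: U_def)
  obtain i where i: "card U = i * p + card (fixpts U c)" using c_image[OF inv[OF c_mem] U(2)] by blast
  have "d ` U \<subseteq> U" by (rule inv[OF d(1)])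
  moreover have "inj_on d U" using group_inj[OF d(1)] inj_on_subset by blast
  moreover have "\<And>x. x \<in> U \<Longrightarrow> (d ^^ r) x = x" using d by simp
  ultimately obtain i' where "card U = i' * r + card (fixpts U d)"
    using card_fixpts_prime_order[OF d(2) U(2)] by blast
  moreover have "fixpts U d = {}" using d(4) U by (auto simp: fixpts_def)
  ultimately have rU: "r dvd card U" by simp
  have sub: "fixpts U c \<subseteq> fixpts \<Omega> c" using U by (auto simp: fixpts_def)
  have finF: "finite (fixpts \<Omega> c)" using finite_points by (simp add: fixpts_def)
  have j: "card (fixpts U c) \<le> card (fixpts \<Omega> c)" by (rule card_mono[OF finF sub])
  have "card (U - fixpts U c) \<le> card (\<Omega> - fixpts \<Omega> c)"
    using finite_points U by (intro card_mono) (auto simp: fixpts_def)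
  moreover have "card (U - fixpts U c) = i * p"
    using i U by (subst card_Diff_subset) (auto simp: fixpts_def)
  moreover have "card (\<Omega> - fixpts \<Omega> c) = a * p"
    using n finite_points by (subst card_Diff_subset) (auto simp: fixpts_def)
  ultimately have "i \<le> a" using prime_gt_0_nat[OF prime_p] by simp
  moreover have "0 < card U" using U card_gt_0_iff by blast
  ultimately have "i = a \<and> card (fixpts U c) = card (fixpts \<Omega> c)"
    using orbit_size_arith[of r a p "card (fixpts \<Omega> c)" i "card (fixpts U c)"] r rU i n j by simp
  then have "card U = card \<Omega>" using i n by simp
  then have "U = \<Omega>" using U finite_points card_subset_eq by blast
  then show "y \<in> orb x" using y by (simp add: U_def)
qed

text \<open>If c preserves every translate of the block, all translates contain equally many fixed
  points and equally many cycles, so their number divides both a and b and is 1. Otherwise there are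
  at least p translates, so k \<le> a < p; translates containing a fixed point are then fixed
  pointwise, and k divides b and a p, hence k = 1.\<close>

lemma primitive_of_coprime:
  assumes trans: "transitive" and n: "card \<Omega> = a * p + card (fixpts \<Omega> c)"
    and cop: "coprime a (card (fixpts \<Omega> c))" and a: "a < p" and bpos: "fixpts \<Omega> c \<noteq> {}"
  shows "primitive"
  unfolding primitive_def
proof (intro conjI allI impI)
  show "transitive" by fact
  fix B assume blk: "is_block B"
  define k where "k = card B"
  define b where "b = card (fixpts \<Omega> c)"
  define F where "F = (\<lambda>g. g ` B) ` G"
  have B: "B \<subseteq> \<Omega>" "B \<noteq> {}" "finite B"
    using blk finite_points finite_subset by (auto simp: is_block_def)
  have BF: "B \<in> F" unfolding F_def by (rule image_eqI[OF _ id_mem]) simp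
  have kpos: "0 < k" using B by (simp add: k_def card_gt_0_iff)
  have finF: "finite F" unfolding F_def using finite_group by simp
  have cF: "card A = k" "finite A" "A \<subseteq> \<Omega>" if "A \<in> F" for A
  proof -
    obtain g where g: "g \<in> G" "A = g ` B" using \<open>A \<in> F\<close> by (auto simp: F_def)
    show "card A = k" using card_image[OF inj_on_subset[OF group_inj[OF g(1)] subset_UNIV]] g by (simp add: k_def)
    show "finite A" using g B by simp
    show "A \<subseteq> \<Omega>" using g B mem_points by auto
  qed
  have gF: "h ` A \<in> F" if h: "h \<in> G" and A: "A \<in> F" for h A
  proof -
    obtain g where g: "g \<in> G" "A = g ` B" using A by (auto simp: F_def)
    have "h ` A = (h \<circ> g) ` B" using g by (simp add: image_comp)
    then show ?thesis unfolding F_def using comp_mem[OF h g(1)] by blast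
  qed
  have disjF: "A \<inter> A' = {}" if AA: "A \<in> F" "A' \<in> F" "A \<noteq> A'" for A A'
  proof -
    obtain g where g: "g \<in> G" "A = g ` B" using AA by (auto simp: F_def)
    obtain g' where g': "g' \<in> G" "A' = g' ` B" using AA by (auto simp: F_def)
    define h where "h = inv' g \<circ> g'"
    have h: "h \<in> G" unfolding h_def using g g' by (intro comp_mem inv_mem)
    have gh: "A' = g ` (h ` B)" using g g' by (simp add: h_def image_comp o_assoc)
    have "h ` B \<noteq> B" using AA(3) g gh by auto
    then have "h ` B \<inter> B = {}" using blk h by (auto simp: is_block_def)
    then have "g ` (h ` B) \<inter> g ` B = {}" using g(1) by (auto simp: eq_iff)
    then show ?thesis using g(2) gh by blast
  qed
  have UF: "\<Union>F = \<Omega>"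
  proof (intro subset_antisym subsetI)
    fix y assume y: "y \<in> \<Omega>"
    obtain x where x: "x \<in> B" using B by auto
    then have "y \<in> orb x" using trans y B by (auto simp: transitive_def)
    then obtain g where "g \<in> G" "y = g x" by (auto simp: orb_def)
    then show "y \<in> \<Union>F" using x by (auto simp: F_def)
  qed (use cF(3) in auto)
  have kl: "k * card F = card \<Omega>"
    using card_partition[OF finF, of k] UF finite_points cF disjF by auto
  have bp: "b < p" using few_fixpts by (simp add: b_def)
  have ppos: "0 < p" using prime_gt_0_nat[OF prime_p] .
  \<comment> \<open>With fewer than p fixed points in all, a translate preserved by c has exactly k
    mod p of them.\<close>
  have fix_dec: "card A = (k div p) * p + card (fixpts A c) \<and> card (fixpts A c) = k mod p"
    if A: "A \<in> F" "c ` A \<subseteq> A" for A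
  proof -
    obtain i where i: "card A = i * p + card (fixpts A c)" using c_image[OF A(2) cF(2)[OF A(1)]] by blast
    have "card (fixpts A c) \<le> b" unfolding b_def
      using cF(3)[OF A(1)] finite_points by (intro card_mono) (auto simp: fixpts_def)
    then have "card (fixpts A c) < p" using bp by simp
    then have "k div p = i \<and> k mod p = card (fixpts A c)" using i cF(1)[OF A(1)] by simp
    then show ?thesis using i by simp
  qed
  show "card B = 1 \<or> B = \<Omega>"
  proof (cases "\<forall>A\<in>F. c ` A \<subseteq> A")
    case True
    have fixU: "fixpts \<Omega> c = (\<Union>A\<in>F. fixpts A c)" using UF by (auto simp: fixpts_def)
    have "b = (\<Sum>A\<in>F. card (fixpts A c))"
      unfolding b_def fixU
    proof (rule card_UN_disjoint[OF finF])
      show "\<forall>A\<in>F. finite (fixpts A c)" using cF(2) by (simp add: fixpts_def)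
      show "\<forall>A\<in>F. \<forall>A'\<in>F. A \<noteq> A' \<longrightarrow> fixpts A c \<inter> fixpts A' c = {}"
        using disjF by (fastforce simp: fixpts_def)
    qed
    also have "\<dots> = (\<Sum>A\<in>F. k mod p)" using fix_dec True by (intro sum.cong) auto
    finally have b: "b = card F * (k mod p)" by simp
    have "a * p + b = card F * ((k div p) * p + k mod p)"
      using kl n by (simp add: b_def mult.commute)
    then have "a * p = (card F * (k div p)) * p" using b
      by (simp only: distrib_left mult.assoc add_right_cancel)
    then have "a = card F * (k div p)" using ppos by simp
    then have "card F dvd a" "card F dvd b" using b by auto
    then have "card F = 1" using cop by (metis b_def coprime_common_divisor_nat)
    then have "card B = card \<Omega>" using kl by (simp add: k_def)
    then show ?thesis using B finite_points card_subset_eq by blast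
  next
    case False
    then obtain A where A: "A \<in> F" "\<not> c ` A \<subseteq> A" by auto
    \<comment> \<open>A translate moved by c has p distinct images: \<open>prime_cycle_inj\<close>
      is applied to the image map on sets.\<close>
    have pw: "((\<lambda>X. c ` X) ^^ i) X = (c ^^ i) ` X" for i X
      by (induction i) (auto simp: image_comp)
    have "inj_on (\<lambda>i. ((\<lambda>X. c ` X) ^^ i) A) {..<p}"
      by (rule prime_cycle_inj[OF prime_p]) (use A pw c_pow in auto)
    moreover have "(\<lambda>i. ((\<lambda>X. c ` X) ^^ i) A) ` {..<p} \<subseteq> F"
      using pw gF[OF funpow_mem[OF c_mem] A(1)] by auto
    ultimately have "p \<le> card F" using card_inj_on_le finF by fastforce
    then have "k * p \<le> card \<Omega>" using kl by (metis mult_le_mono2)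
    also have "\<dots> < (a + 1) * p" using n bp by (simp add: b_def)
    finally have "k < a + 1" using ppos by (simp only: mult_less_cancel2)
    then have ka: "k \<le> a" "k < p" using a by auto
    define F' where "F' = {A \<in> F. fixpts A c \<noteq> {}}"
    have F': "fixpts A c = A" if "A \<in> F'" for A
    proof -
      have AF: "A \<in> F" "fixpts A c \<noteq> {}" using that by (auto simp: F'_def)
      then obtain x where "x \<in> A" "c x = x" by (auto simp: fixpts_def)
      then have "c ` A \<inter> A \<noteq> {}" by force
      then have "c ` A \<subseteq> A" using disjF[OF gF[OF c_mem AF(1)] AF(1)] by auto
      then have "card (fixpts A c) = k mod p" using fix_dec[OF AF(1)] by blast
      then have "card (fixpts A c) = card A" using ka cF(1)[OF AF(1)] by simp
      moreover have "fixpts A c \<subseteq> A" by (auto simp: fixpts_def)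
      ultimately show ?thesis using card_subset_eq cF(2)[OF AF(1)] by blast
    qed
    have U': "\<Union>F' = fixpts \<Omega> c"
    proof (intro subset_antisym subsetI)
      fix x assume "x \<in> \<Union>F'"
      then obtain A where A: "A \<in> F'" "x \<in> A" by auto
      then have "x \<in> fixpts A c" using F' by simp
      moreover have "x \<in> \<Omega>" using A cF(3) by (auto simp: F'_def)
      ultimately show "x \<in> fixpts \<Omega> c" by (simp add: fixpts_def)
    next
      fix x assume x: "x \<in> fixpts \<Omega> c"
      then obtain A where A: "A \<in> F" "x \<in> A" using UF by (auto simp: fixpts_def)
      then show "x \<in> \<Union>F'" using x by (auto simp: F'_def fixpts_def)
    qed
    have "k * card F' = card (\<Union>F')"
    proof (rule card_partition)
      show "finite F'" using finF by (simp add: F'_def)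
      show "finite (\<Union>F')" unfolding U' using finite_points by (simp add: fixpts_def)
    qed (use cF disjF in \<open>auto simp: F'_def\<close>)
    then have kb: "k dvd b" unfolding U' b_def by (metis dvd_triv_left)
    moreover have "k dvd a * p + b" using kl n by (metis b_def dvd_triv_left)
    ultimately have "k dvd a * p" using dvd_add_left_iff by blast
    moreover have "coprime k p" using kpos ka(2) prime_p
      by (metis coprime_commute nat_dvd_not_less prime_imp_coprime)
    ultimately have "k dvd a" using coprime_dvd_mult_left_iff by blast
    then have "k = 1" using kb cop by (metis b_def coprime_common_divisor_nat)
    then show ?thesis by (simp add: k_def)
  qed
qed

end

section \<open>Generating the alternating group by two elements of prime order\<close>

theorem generate_alt_group:
  fixes n a b p r l :: nat
  assumes c: "c \<in> carrier (alt_group n)" "c ^^ p = id" "card (fixpts {1..n} c) = b"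
    and d: "d \<in> carrier (alt_group n)" "d ^^ r = id" "fixpts {1..n} d = {}"
    and p: "prime p" "b < p" "a < p" "(b - 1)\<^sup>2 < p"
    and r: "prime r" "r dvd n" "a * b < r"
    and n: "n = a * p + b" "n < 2 ^ l"
    and a: "0 < a" "coprime a b" and b: "(a + 1) * (2 * (a + 1) + a * l) \<le> b"
  shows "generate (alt_group n) {c, d} = carrier (alt_group n)"
proof -
  interpret A: group "alt_group n" by (rule alt_group_is_group)
  define G where "G = generate (alt_group n) {c, d}"
  have cd: "{c, d} \<subseteq> carrier (alt_group n)" using c d by simp
  have Gsub: "subgroup G (alt_group n)" unfolding G_def by (rule A.generate_is_subgroup[OF cd])
  have bpos: "0 < b" using b by (cases b) auto
  have Gin: "g \<in> carrier (alt_group n)" if "g \<in> G" for g using subgroup.mem_carrier[OF Gsub that] .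
  have cG: "c \<in> G" "d \<in> G" unfolding G_def by (auto intro: generate.incl)
  have cn: "c \<noteq> id"
  proof
    assume "c = id"
    then have "fixpts {1..n} c = {1..n}" by (auto simp: fixpts_def)
    then have "card (fixpts {1..n} c) = n" by simp
    then show False using c(3) n a prime_gt_0_nat[OF p(1)] by simp
  qed
  interpret prime_perm_group "{1..n}" G c p
  proof
    show "finite {1..n}" by simp
    show "g permutes {1..n}" if "g \<in> G" for g using Gin[OF that] by (simp add: alt_group_carrier)
    show "id \<in> G" using subgroup.one_closed[OF Gsub] by (simp add: alt_group_one)
    show "g \<circ> h \<in> G" if "g \<in> G" "h \<in> G" for g h
      using subgroup.m_closed[OF Gsub that] by (simp add: alt_group_mult)
    show "inv' g \<in> G" if "g \<in> G" for g
      using subgroup.m_inv_closed[OF Gsub that] alt_group_inv_equality[OF Gin[OF that]] by simp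
  qed (use cG p c cn in auto)
  have n': "card {1..n} = a * p + card (fixpts {1..n} c)" using n c by simp
  have trans: "transitive"
    using transitive_of_orders[OF n' cG(2) r(1) d(2,3)] r a c by simp
  have prim: "primitive"
    using primitive_of_coprime[OF trans n'] a p c bpos by fastforce
  \<comment> \<open>As n < 2^l, the product a l is a value of j for which 2^j exceeds n^a.\<close>
  have pow: "card {1..n} ^ a < 2 ^ (a * l)"
  proof -
    have "n ^ a < (2 ^ l) ^ a" using n(2) a(1) by (intro power_strict_mono) auto
    then show ?thesis by (simp add: power_mult[symmetric] mult.commute)
  qed
  \<comment> \<open>From n \<le> (a + 1) p the density condition follows; this is where the factor a
    + 1 in the lower bound on b comes from.\<close>
  have "(2 * (a + 1) + a * l) * n \<le> (2 * (a + 1) + a * l) * ((a + 1) * p)"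
    using n p by (intro mult_left_mono) auto
  also have "\<dots> = ((a + 1) * (2 * (a + 1) + a * l)) * p" by (simp only: mult_ac)
  also have "\<dots> \<le> b * p" using b by (rule mult_right_mono) simp
  finally have dense: "(2 * (a + 1) + a * l) * card {1..n} \<le> card (fixpts {1..n} c) * p" using c by simp
  have F0: "fixpts {1..n} c \<noteq> {}" using c(3) bpos by auto
  have "three_cycles n \<subseteq> G"
  proof
    fix t assume "t \<in> three_cycles n"
    then obtain cs where cs: "t = cycle_of_list cs" "cycle cs" "length cs = 3" "set cs \<subseteq> {1..n}" by auto
    obtain u v w where uvw: "cs = [u, v, w]" using stupid_lemma[OF cs(3)] by auto
    have "tri u v w \<in> G"
      using primitive_contains_three_cycles[OF prim n' F0 _ pow dense, of u v w] cs uvw c p by simp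
    then show "t \<in> G" using cs uvw cycle_of_list_tri[of u v w] by simp
  qed
  then have "carrier (alt_group n) \<subseteq> G"
    using A.generate_subgroup_incl[OF _ Gsub] alt_group_carrier_as_three_cycles by blast
  then show ?thesis using Gin by (auto simp: G_def)
qed

text \<open>The points 1 to a p are cut into a consecutive runs of length p, and c rotates each run
  by one place.\<close>

lemma exists_prime_order_perm:
  fixes p a n :: nat
  assumes p: "prime p" "odd p" and n: "a * p \<le> n"
  obtains c where "c \<in> carrier (alt_group n)" "c ^^ p = id" "card (fixpts {1..n} c) = n - a * p"
proof -
  define c where "c x = (if 1 \<le> x \<and> x \<le> a * p then p * ((x - 1) div p) + ((x - 1) mod p + 1) mod p + 1 else x)" for x
  have p2: "2 \<le> p" using prime_ge_2_nat[OF p(1)] .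
  have range: "1 \<le> p * q + s + 1 \<and> p * q + s + 1 \<le> a * p" if "q < a" "s < p" for q s
  proof -
    have "p * q + s + 1 \<le> p * (q + 1)" using that by (simp add: algebra_simps)
    also have "\<dots> \<le> p * a" using that by (intro mult_left_mono) auto
    finally show ?thesis by (simp add: mult.commute)
  qed
  have c1: "c (p * q + s + 1) = p * q + (s + 1) mod p + 1" if "q < a" "s < p" for q s
    using range[OF that] that by (simp add: c_def)
  have ci: "(c ^^ i) (p * q + s + 1) = p * q + (s + i) mod p + 1" if "q < a" "s < p" for q s i
  proof (induction i)
    case (Suc i)
    have "(c ^^ Suc i) (p * q + s + 1) = c (p * q + (s + i) mod p + 1)" using Suc by simp
    also have "\<dots> = p * q + ((s + i) mod p + 1) mod p + 1" using that p2 by (intro c1) auto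
    finally show ?case by (simp add: mod_Suc_eq)
  qed (use that in simp)
  have rep: "\<exists>q s. q < a \<and> s < p \<and> x = p * q + s + 1" if "1 \<le> x" "x \<le> a * p" for x
  proof (intro exI conjI)
    show "(x - 1) div p < a" using that p2 by (simp add: less_mult_imp_div_less)
    show "(x - 1) mod p < p" using p2 by simp
    show "x = p * ((x - 1) div p) + (x - 1) mod p + 1" using that by simp
  qed
  have outside: "(c ^^ i) x = x" if "\<not> (1 \<le> x \<and> x \<le> a * p)" for x i
    using that by (induction i) (auto simp: c_def)
  have cp: "c ^^ p = id"
  proof
    fix x show "(c ^^ p) x = id x"
    proof (cases "1 \<le> x \<and> x \<le> a * p")
      case True
      then obtain q s where "q < a" "s < p" "x = p * q + s + 1" using rep by blast
      then show ?thesis using ci[of q s p] by simp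
    qed (simp add: outside)
  qed
  have cin: "c x \<in> {1..n}" if x: "x \<in> {1..n}" for x
  proof (cases "x \<le> a * p")
    case True
    moreover have "1 \<le> x" using x by simp
    ultimately obtain q s where "q < a" "s < p" "x = p * q + s + 1" using rep by blast
    then show ?thesis using c1[of q s] range[of q "(s + 1) mod p"] p2 n by auto
  next
    case False
    then have "c x = x" by (simp add: c_def)
    then show ?thesis using x by simp
  qed
  have cini: "(c ^^ i) x \<in> {1..n}" if "x \<in> {1..n}" for x i
    using that cin by (induction i) auto
  have "Suc (p - 1) = p" using p2 by simp
  then have inv1: "c ((c ^^ (p - 1)) x) = x" "(c ^^ (p - 1)) (c x) = x" for x
    using cp by (metis comp_apply funpow.simps(2) id_apply, metis cp funpow_Suc_right comp_apply id_apply)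
  have "bij_betw c {1..n} {1..n}"
    by (rule bij_betw_byWitness[where f' = "c ^^ (p - 1)"]) (use inv1 cin cini in auto)
  then have cperm: "c permutes {1..n}"
  proof (rule bij_imp_permutes)
    show "c x = x" if "x \<notin> {1..n}" for x using that n by (auto simp: c_def)
  qed
  \<comment> \<open>Since p is odd, c is the square of its power with exponent (p + 1)/2, hence
    even.\<close>
  define h where "h = c ^^ ((p + 1) div 2)"
  have "h permutes {1..n}" unfolding h_def by (rule permutes_funpow[OF cperm])
  then have "permutation h" using permutation_permutes by blast
  then have "evenperm (h \<circ> h)" by (simp add: evenperm_comp)
  moreover have "h \<circ> h = c"
  proof -
    have "(p + 1) div 2 + (p + 1) div 2 = p + 1" using p(2) by (auto elim: oddE)
    then have "h \<circ> h = c ^^ (p + 1)" unfolding h_def by (metis funpow_add)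
    then show ?thesis using cp by (simp add: funpow_add)
  qed
  ultimately have "c \<in> carrier (alt_group n)" using cperm by (simp add: alt_group_carrier)
  moreover have "fixpts {1..n} c = {a * p + 1..n}"
  proof (intro subset_antisym subsetI)
    fix x assume x: "x \<in> fixpts {1..n} c"
    show "x \<in> {a * p + 1..n}"
    proof (rule ccontr)
      assume "x \<notin> {a * p + 1..n}"
      then have "1 \<le> x" "x \<le> a * p" using x by (auto simp: fixpts_def)
      then obtain q s where qs: "q < a" "s < p" "x = p * q + s + 1" using rep by blast
      then have "(s + 1) mod p = s" using c1[of q s] x by (simp add: fixpts_def)
      then show False using qs p2 by (cases "s + 1 = p") auto
    qed
  qed (auto simp: fixpts_def c_def)
  ultimately show ?thesis using that cp by simp
qed

lemma alt_group_pow: "x \<in> carrier (alt_group n) \<Longrightarrow> x [^]\<^bsub>alt_group n\<^esub> (k::nat) = x ^^ k"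
proof (induction k)
  case 0 then show ?case by (simp add: alt_group_one nat_pow_def)
next
  case (Suc k)
  interpret A: group "alt_group n" by (rule alt_group_is_group)
  show ?case using Suc by (simp add: alt_group_mult funpow_Suc_right del: funpow.simps)
qed

lemma prime_order_class_exists:
  assumes c: "c \<in> carrier (alt_group n)" "c ^^ p = id" "prime p" "c \<noteq> id"
  obtains C where "prime_order_class (alt_group n) C"
    "\<And>x. x \<in> C \<Longrightarrow> x \<in> carrier (alt_group n) \<and> x ^^ p = id \<and> card (fixpts {1..n} x) = card (fixpts {1..n} c)"
proof -
  interpret A: group "alt_group n" by (rule alt_group_is_group)
  interpret P: perm_group "{1..n}" "carrier (alt_group n)"
  proof
    show "g permutes {1..n}" if "g \<in> carrier (alt_group n)" for g using that by (simp add: alt_group_carrier)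
    show "id \<in> carrier (alt_group n)" using A.one_closed by (simp add: alt_group_one)
    show "g \<circ> h \<in> carrier (alt_group n)" if "g \<in> carrier (alt_group n)" "h \<in> carrier (alt_group n)" for g h
      using A.m_closed[OF that] by (simp add: alt_group_mult)
    show "inv' g \<in> carrier (alt_group n)" if "g \<in> carrier (alt_group n)" for g
      using alt_group_inv_closed[OF that] .
  qed simp
  define C where "C = orbit (alt_group n) (\<lambda>g. \<lambda>h \<in> carrier (alt_group n).
    g \<otimes>\<^bsub>alt_group n\<^esub> h \<otimes>\<^bsub>alt_group n\<^esub> (inv\<^bsub>alt_group n\<^esub> g)) c"
  have C: "\<exists>g\<in>carrier (alt_group n). x = g \<circ> c \<circ> inv' g" if "x \<in> C" for x
    using that c unfolding C_def orbit_def by (auto simp: alt_group_mult alt_group_inv_equality)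
  have mem: "x \<in> carrier (alt_group n) \<and> x ^^ p = id \<and> card (fixpts {1..n} x) = card (fixpts {1..n} c) \<and> x \<noteq> id"
    if "x \<in> C" for x
  proof -
    obtain g where g: "g \<in> carrier (alt_group n)" "x = g \<circ> c \<circ> inv' g" using C[OF \<open>x \<in> C\<close>] by blast
    have 1: "x \<in> carrier (alt_group n)" unfolding g(2) by (rule P.conj_mem[OF g(1) c(1)])
    have 2: "x ^^ p = id" unfolding g(2) P.conj_funpow[OF g(1)] c(2) using g(1) by (simp add: fun_eq_iff)
    have "bij_betw g (fixpts {1..n} c) (fixpts {1..n} x)"
    proof (rule bij_betw_byWitness[where f' = "inv' g"])
      show "\<forall>x\<in>fixpts {1..n} c. inv' g (g x) = x" "\<forall>y\<in>fixpts {1..n} x. g (inv' g y) = y" using g(1) by auto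
      show "g ` fixpts {1..n} c \<subseteq> fixpts {1..n} x"
        using g P.mem_points[OF g(1)] by (auto simp: fixpts_def simp del: atLeastAtMost_iff)
      show "inv' g ` fixpts {1..n} x \<subseteq> fixpts {1..n} c"
      proof clarify
        fix y assume "y \<in> fixpts {1..n} x"
        then have y: "y \<in> {1..n}" "g (c (inv' g y)) = y" using g by (auto simp: fixpts_def)
        have "inv' g (g (c (inv' g y))) = inv' g y" using y by simp
        then have "c (inv' g y) = inv' g y" using g(1) by simp
        then show "inv' g y \<in> fixpts {1..n} c"
          using y P.mem_points[OF P.inv_mem[OF g(1)]] by (simp add: fixpts_def)
      qed
    qed
    from bij_betw_same_card[OF this] have 3: "card (fixpts {1..n} x) = card (fixpts {1..n} c)" by simp
    have "x \<noteq> id"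
    proof
      assume "x = id"
      then have "inv' g \<circ> x \<circ> g = inv' g \<circ> g" by simp
      then have "c = id" unfolding g(2) using g(1) by (simp add: fun_eq_iff)
      then show False using c by simp
    qed
    then show ?thesis using 1 2 3 by simp
  qed
  have "prime_order_class (alt_group n) C"
    unfolding prime_order_class_def
  proof (intro conjI ballI)
    show "C \<in> conjugacy_classes (alt_group n)"
      unfolding conjugacy_classes_def orbits_def C_def using c by blast
    fix x assume "x \<in> C"
    note x = mem[OF this]
    have "x [^]\<^bsub>alt_group n\<^esub> p = \<one>\<^bsub>alt_group n\<^esub>" using x alt_group_pow by (simp add: alt_group_one)
    then have "A.ord x dvd p" using A.pow_eq_id x by blast
    moreover have "A.ord x \<noteq> 1" using A.ord_eq_1 x by (metis alt_group_one)
    ultimately have "A.ord x = p" using c(3) by (metis prime_nat_iff)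
    then show "prime (A.ord x)" using c(3) by simp
  qed
  then show ?thesis using that mem by blast
qed

text \<open>C comes from a product of a cycles of length p, D from a product of n/r cycles of length
  r. The data that \<open>generate_alt_group\<close> asks for are constant on conjugacy classes, so
  all pairs generate.\<close>

theorem invariably_prime_generatedI:
  fixes n a b p r l :: nat
  assumes p: "prime p" "b < p" "a < p" "(b - 1)\<^sup>2 < p"
    and r: "prime r" "odd r" "r dvd n" "a * b < r"
    and n: "n = a * p + b" "n < 2 ^ l"
    and a: "0 < a" "coprime a b" and b: "(a + 1) * (2 * (a + 1) + a * l) \<le> b"
  shows "n \<in> invariably_prime_generated"
proof -
  have "4 \<le> (a + 1) * (2 * (a + 1) + a * l)" using a
    using mult_le_mono[of 2 "a + 1" 2 "2 * (a + 1) + a * l"] by simp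
  then have b4: "4 \<le> b" using b by simp
  then have "odd p" using p prime_odd_nat by fastforce
  have npos: "0 < n" using n a prime_gt_0_nat[OF p(1)] by simp
  obtain c where c: "c \<in> carrier (alt_group n)" "c ^^ p = id" "card (fixpts {1..n} c) = n - a * p"
    using exists_prime_order_perm[OF p(1) \<open>odd p\<close>, of a n] n by auto
  obtain s where s: "n = s * r" using r(3) by (metis dvdE mult.commute)
  obtain d where d: "d \<in> carrier (alt_group n)" "d ^^ r = id" "card (fixpts {1..n} d) = n - s * r"
    using exists_prime_order_perm[OF r(1,2), of s n] s by auto
  have fin: "finite (fixpts {1..n} f)" for f by (simp add: fixpts_def)
  have nid: "f \<noteq> id" if "card (fixpts {1..n} f) < n" for f
  proof
    assume "f = id"
    then have "fixpts {1..n} f = {1..n}" by (auto simp: fixpts_def)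
    then show False using that by simp
  qed
  have "c \<noteq> id" using c(3) n a prime_gt_0_nat[OF p(1)] by (intro nid) simp
  then obtain C where C: "prime_order_class (alt_group n) C"
    "\<And>x. x \<in> C \<Longrightarrow> x \<in> carrier (alt_group n) \<and> x ^^ p = id \<and> card (fixpts {1..n} x) = card (fixpts {1..n} c)"
    using prime_order_class_exists[OF c(1,2) p(1)] by blast
  have "d \<noteq> id" using d(3) s npos by (intro nid) simp
  then obtain D where D: "prime_order_class (alt_group n) D"
    "\<And>x. x \<in> D \<Longrightarrow> x \<in> carrier (alt_group n) \<and> x ^^ r = id \<and> card (fixpts {1..n} x) = card (fixpts {1..n} d)"
    using prime_order_class_exists[OF d(1,2) r(1)] by blast
  have "generate (alt_group n) {x, y} = carrier (alt_group n)" if x: "x \<in> C" and y: "y \<in> D" for x y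
  proof (rule generate_alt_group[where p = p and r = r and a = a and b = b and l = l])
    show "card (fixpts {1..n} x) = b" using C(2)[OF x] c(3) n by simp
    have "card (fixpts {1..n} y) = 0" using D(2)[OF y] d(3) s by simp
    then show "fixpts {1..n} y = {}" using fin by simp
  qed (use C(2)[OF x] D(2)[OF y] p r n a b in auto)
  then show ?thesis unfolding invariably_prime_generated_def using npos C(1) D(1)
    by (intro CollectI conjI exI[of _ C] exI[of _ D] ballI) auto
qed

section \<open>The Dickman function at 20\<close>

definition is_dickman :: "(real \<Rightarrow> real) \<Rightarrow> bool" where
  "is_dickman \<rho> \<longleftrightarrow>
     continuous_on {0..} \<rho> \<and> (\<forall>u<0. \<rho> u = 0) \<and> (\<forall>u\<in>{0..1}. \<rho> u = 1) \<and>
     (\<forall>u>1. \<exists>\<rho>'. (\<rho> has_real_derivative \<rho>') (at u) \<and> u * \<rho>' + \<rho> (u - 1) = 0)"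

text \<open>Picard iteration for the integrated equation. The delay reaches back a full unit, so
  stage k is already exact up to k + 1; for u < 1 the integral is over an empty interval and the
  value is 1.\<close>

primrec dickman_iter :: "nat \<Rightarrow> real \<Rightarrow> real" where
  "dickman_iter 0 u = 1"
| "dickman_iter (Suc k) u = 1 - integral {1..u} (\<lambda>t. dickman_iter k (t - 1) / t)"

lemma dickman_iter_le_1: "u \<le> 1 \<Longrightarrow> dickman_iter k u = 1"
proof (cases k)
  case (Suc m)
  assume "u \<le> 1"
  then have "{1..u} = {} \<or> {1..u} = {1}" by auto
  then show ?thesis using Suc by auto
qed simp

lemma continuous_dickman_iter: "continuous_on UNIV (dickman_iter k)"
proof (induction k)
  case 0 show ?case by (simp add: continuous_on_eq[OF continuous_on_const])
next
  case (Suc k)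
  let ?g = "\<lambda>t. dickman_iter k (t - 1) / t"
  have g: "continuous_on {1..b} ?g" for b
    by (intro continuous_intros continuous_on_compose2[OF Suc]) auto
  have "isCont (dickman_iter (Suc k)) x" for x
  proof -
    define b where "b = \<bar>x\<bar> + 2"
    have "continuous_on {1..b} (dickman_iter (Suc k))"
      unfolding dickman_iter.simps
      by (intro continuous_intros indefinite_integral_continuous_1 integrable_continuous_real g)
    moreover have "continuous_on {..1} (dickman_iter (Suc k))"
      by (rule continuous_on_eq[OF continuous_on_const[of _ 1]]) (simp only: dickman_iter_le_1 atMost_iff)
    ultimately have "continuous_on ({..1} \<union> {1..b}) (dickman_iter (Suc k))"
      by (intro continuous_on_closed_Un) auto
    moreover have "{..1} \<union> {1..b} = {..b}" by (auto simp: b_def)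
    ultimately have "continuous_on {..b} (dickman_iter (Suc k))" by simp
    then show ?thesis by (rule continuous_on_interior) (auto simp: b_def)
  qed
  then show ?case by (simp add: continuous_on_eq_continuous_at del: dickman_iter.simps)
qed

lemma dickman_iter_stable: "u \<le> real (Suc k) \<Longrightarrow> dickman_iter (Suc k) u = dickman_iter k u"
proof (induction k arbitrary: u)
  case 0
  then show ?case by (simp add: dickman_iter_le_1 del: dickman_iter.simps)
next
  case (Suc k)
  have "integral {1..u} (\<lambda>t. dickman_iter (Suc k) (t - 1) / t) = integral {1..u} (\<lambda>t. dickman_iter k (t - 1) / t)"
    using Suc by (intro integral_cong) (auto simp del: dickman_iter.simps)
  then show ?case by (simp only: dickman_iter.simps)
qed

lemma dickman_iter_eq: "k \<le> m \<Longrightarrow> u \<le> real (Suc k) \<Longrightarrow> dickman_iter m u = dickman_iter k u"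
proof (induction m rule: dec_induct)
  case (step m)
  then have "u \<le> real (Suc m)" by linarith
  then show ?case using step dickman_iter_stable by metis
qed simp

text \<open>Near each point the candidate agrees on its domain with one fixed stage of the
  iteration, which transfers continuity and the derivative.\<close>

lemma dickman_exists: "\<exists>\<rho>. is_dickman \<rho>"
proof -
  define \<rho> where "\<rho> u = (if u < 0 then 0 else dickman_iter (nat \<lceil>u\<rceil>) u)" for u
  have eq: "\<rho> u = dickman_iter k u" if "0 \<le> u" "u \<le> real k" for u k
  proof -
    have "nat \<lceil>u\<rceil> \<le> k" using that by (simp add: ceiling_le_iff)
    moreover have "u \<le> real (Suc (nat \<lceil>u\<rceil>))" using that by linarith
    ultimately show ?thesis using dickman_iter_eq[of "nat \<lceil>u\<rceil>" k u] that by (simp add: \<rho>_def)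
  qed
  have ev: "eventually (\<lambda>x. dickman_iter k x = \<rho> x) (nhds u)" if "0 < u" "u < real k" for u k
  proof -
    have "eventually (\<lambda>x. x \<in> {0<..<real k}) (nhds u)"
      using that by (intro eventually_nhds_in_open) auto
    then show ?thesis by eventually_elim (use eq[where k = k] in simp)
  qed
  have cont: "continuous_on {0..} \<rho>"
    unfolding continuous_on_eq_continuous_within
  proof
    fix x :: real assume x: "x \<in> {0..}"
    define k where "k = nat \<lceil>x\<rceil> + 1"
    have k: "x + 1 \<le> real k" using x unfolding k_def by (simp; linarith)
    show "continuous (at x within {0..}) \<rho>"
    proof (rule continuous_transform_within[where f = "dickman_iter k" and \<delta> = 1])
      show "continuous (at x within {0..}) (dickman_iter k)"
        using continuous_dickman_iter[of k] continuous_on_subset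
        by (metis continuous_on_eq_continuous_within subset_UNIV x)
      show "dickman_iter k x' = \<rho> x'" if "x' \<in> {0..}" "dist x' x < 1" for x'
        using eq[of x' k] that k by (auto simp: dist_real_def)
    qed (use x in auto)
  qed
  have deriv: "(\<rho> has_real_derivative - \<rho> (u - 1) / u) (at u)" if u: "u > 1" for u
  proof -
    define k where "k = nat \<lceil>u\<rceil> + 1"
    have k: "u + 1 \<le> real k" using u unfolding k_def by (simp; linarith)
    let ?g = "\<lambda>t. dickman_iter k (t - 1) / t"
    have "continuous_on {1..u + 1} ?g"
      by (intro continuous_intros continuous_on_compose2[OF continuous_dickman_iter]) auto
    then have "((\<lambda>x. integral {1..x} ?g) has_real_derivative ?g u) (at u within {1..u + 1})"
      using u by (intro integral_has_real_derivative) auto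
    then have "((\<lambda>x. integral {1..x} ?g) has_real_derivative ?g u) (at u)"
      using at_within_interior[of u "{1..u + 1}"] u by (simp add: interior_atLeastAtMost_real)
    then have "(dickman_iter (Suc k) has_real_derivative - ?g u) (at u)"
      unfolding dickman_iter.simps by (auto intro!: derivative_eq_intros)
    moreover have "eventually (\<lambda>x. dickman_iter (Suc k) x = \<rho> x) (nhds u)" using u k by (intro ev) auto
    ultimately have "(\<rho> has_real_derivative - ?g u) (at u)"
      using DERIV_cong_ev[OF refl _ refl] by blast
    moreover have "dickman_iter k (u - 1) = \<rho> (u - 1)" using eq[of "u - 1" k] u k by simp
    ultimately show ?thesis by simp
  qed
  have "is_dickman \<rho>"
    unfolding is_dickman_def
  proof (intro conjI allI ballI impI)
    show "continuous_on {0..} \<rho>" by (rule cont)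
    show "\<rho> u = 0" if "u < 0" for u using that by (simp add: \<rho>_def)
    show "\<rho> u = 1" if "u \<in> {0..1}" for u using that by (simp add: \<rho>_def dickman_iter_le_1)
    show "\<exists>\<rho>'. (\<rho> has_real_derivative \<rho>') (at u) \<and> u * \<rho>' + \<rho> (u - 1) = 0" if "1 < u" for u
      using deriv[OF that] that by (intro exI[of _ "- \<rho> (u - 1) / u"]) auto
  qed
  then show ?thesis by blast
qed

section \<open>Integral identity, convexity and numerical bounds for the Dickman function\<close>

context
  fixes \<rho> :: "real \<Rightarrow> real"
  assumes D: "is_dickman \<rho>"
begin

lemma dickman_cont: "continuous_on {0..} \<rho>" using D by (simp add: is_dickman_def)
lemma dickman_one: "0 \<le> u \<Longrightarrow> u \<le> 1 \<Longrightarrow> \<rho> u = 1" using D by (simp add: is_dickman_def)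
lemma dickman_neg: "u < 0 \<Longrightarrow> \<rho> u = 0" using D by (simp add: is_dickman_def)

lemma dickman_deriv:
  assumes "1 < u" shows "(\<rho> has_real_derivative - \<rho> (u - 1) / u) (at u)"
proof -
  obtain r where r: "(\<rho> has_real_derivative r) (at u)" "u * r + \<rho> (u - 1) = 0"
    using D assms by (auto simp: is_dickman_def)
  then have "r = - \<rho> (u - 1) / u" using assms by (simp add: field_simps)
  then show ?thesis using r by simp
qed

definition dickman_primitive :: "real \<Rightarrow> real" where "dickman_primitive u = integral {0..u} \<rho>"

lemma dickman_primitive_deriv: assumes "0 < u" shows "(dickman_primitive has_real_derivative \<rho> u) (at u)"
proof -
  have "continuous_on {0..u + 1} \<rho>" using dickman_cont continuous_on_subset by fastforce
  then have "(dickman_primitive has_real_derivative \<rho> u) (at u within {0..u + 1})"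
    unfolding dickman_primitive_def using assms by (intro integral_has_real_derivative) auto
  then show ?thesis using at_within_interior[of u "{0..u + 1}"] assms
    by (simp add: interior_atLeastAtMost_real)
qed

lemma dickman_primitive_cont: "continuous_on {0..b} dickman_primitive"
  unfolding dickman_primitive_def using dickman_cont
  by (intro indefinite_integral_continuous_1 integrable_continuous_real) (auto elim: continuous_on_subset)

lemma dickman_primitive_le_1: assumes "0 \<le> u" "u \<le> 1" shows "dickman_primitive u = u"
proof -
  have "integral {0..u} \<rho> = integral {0..u} (\<lambda>_. 1)"
    using assms dickman_one by (intro integral_cong) auto
  then show ?thesis using assms by (simp add: dickman_primitive_def)
qed

text \<open>For u > 1 both sides have derivative rho(u) - rho(u - 1), and they agree at 1.\<close>

lemma dickman_integral: assumes "1 \<le> u" shows "u * \<rho> u = dickman_primitive u - dickman_primitive (u - 1)"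
proof (cases "u = 1")
  case True
  then show ?thesis using dickman_primitive_le_1[of 1] dickman_primitive_le_1[of 0] dickman_one[of 1] by simp
next
  case False
  then have u: "1 < u" using assms by simp
  let ?F = "\<lambda>u. u * \<rho> u - dickman_primitive u + dickman_primitive (u - 1)"
  have "?F u = ?F 1"
  proof (rule DERIV_isconst_end[OF u])
    show "continuous_on {1..u} ?F"
      by (intro continuous_intros continuous_on_subset[OF dickman_cont] continuous_on_subset[OF dickman_primitive_cont[of u]]
          continuous_on_compose2[OF dickman_primitive_cont[of u]]) auto
    show "(?F has_real_derivative 0) (at x)" if "1 < x" "x < u" for x
    proof -
      have "((\<lambda>u. dickman_primitive (u - 1)) has_real_derivative \<rho> (x - 1)) (at x)"
        using dickman_primitive_deriv[of "x - 1"] that DERIV_shift[of dickman_primitive "\<rho> (x - 1)" x "-1"] by simp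
      then have "(?F has_real_derivative (1 * \<rho> x + x * (- \<rho> (x - 1) / x) - \<rho> x + \<rho> (x - 1))) (at x)"
        using that by (auto intro!: derivative_eq_intros dickman_deriv dickman_primitive_deriv)
      then show ?thesis using that by simp
    qed
  qed
  then show ?thesis using dickman_primitive_le_1[of 1] dickman_primitive_le_1[of 0] dickman_one[of 1] by simp
qed

text \<open>At the first point v where rho fails to be positive, v rho(v) would be the integral of
  rho over the preceding unit interval, on which rho is positive.\<close>

lemma dickman_pos: assumes "0 \<le> u" shows "0 < \<rho> u"
proof (rule ccontr)
  assume neg: "\<not> 0 < \<rho> u"
  define Z where "Z = {0..u} \<inter> \<rho> -` {..0}"
  have "closed Z" unfolding Z_def
    by (intro continuous_closed_preimage continuous_on_subset[OF dickman_cont]) auto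
  then have "compact Z" unfolding Z_def
    by (metis Z_def compact_Icc compact_Int_closed inf.left_idem)
  moreover have "u \<in> Z" using neg assms by (simp add: Z_def)
  then have "Z \<noteq> {}" by blast
  ultimately have "\<exists>v\<in>Z. \<forall>x\<in>Z. v \<le> x" by (rule compact_attains_inf)
  then obtain v where v: "v \<in> Z" "\<And>x. x \<in> Z \<Longrightarrow> v \<le> x" by auto
  have v0: "0 \<le> v" "v \<le> u" "\<rho> v \<le> 0" using v(1) by (auto simp: Z_def)
  have pos: "0 < \<rho> x" if "0 \<le> x" "x < v" for x
    using v(2)[of x] that v0 by (cases "\<rho> x \<le> 0") (auto simp: Z_def)
  have v1: "1 < v" using dickman_one[of v] v0 by (cases "v \<le> 1") auto
  have "dickman_primitive (v - 1) < dickman_primitive v"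
  proof (rule DERIV_pos_imp_increasing_open[of "v - 1" v dickman_primitive])
    show "v - 1 < v" by simp
    show "\<exists>y. (dickman_primitive has_real_derivative y) (at x) \<and> 0 < y" if "v - 1 < x" "x < v" for x
      using dickman_primitive_deriv[of x] pos[of x] that v1 by auto
    show "continuous_on {v - 1..v} dickman_primitive" using dickman_primitive_cont[of v] v1 by (auto elim: continuous_on_subset)
  qed
  then have "0 < v * \<rho> v" using dickman_integral[of v] v1 by simp
  then show False using v0 v1 by (simp add: zero_less_mult_iff)
qed

lemma dickman_antimono: assumes "0 \<le> u" "u \<le> v" shows "\<rho> v \<le> \<rho> u"
proof -
  have ge1: "\<rho> y \<le> \<rho> x" if "1 \<le> x" "x \<le> y" for x y
  proof -
    have "- \<rho> x \<le> - \<rho> y"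
    proof (rule DERIV_nonneg_imp_increasing_open[OF that(2), of "\<lambda>x. - \<rho> x"])
      show "continuous_on {x..y} (\<lambda>x. - \<rho> x)"
        using that by (intro continuous_intros continuous_on_subset[OF dickman_cont]) auto
      show "\<exists>z. ((\<lambda>x. - \<rho> x) has_real_derivative z) (at t) \<and> 0 \<le> z" if "x < t" "t < y" for t
      proof (intro exI conjI)
        show "((\<lambda>x. - \<rho> x) has_real_derivative - (- \<rho> (t - 1) / t)) (at t)"
          using that \<open>1 \<le> x\<close> by (intro DERIV_minus dickman_deriv) auto
        show "0 \<le> - (- \<rho> (t - 1) / t)" using dickman_pos[of "t - 1"] that \<open>1 \<le> x\<close> by simp
      qed
    qed
    then show ?thesis by simp
  qed
  show ?thesis
  proof (cases "v \<le> 1")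
    case True then show ?thesis using assms dickman_one by simp
  next
    case False
    show ?thesis
    proof (cases "u \<le> 1")
      case True
      then show ?thesis using ge1[of 1 v] False assms dickman_one[of 1] dickman_one[of u] by simp
    next
      case uF: False then show ?thesis using ge1[of u v] assms by simp
    qed
  qed
qed

text \<open>Convexity enters as monotonicity of the derivative -rho(x - 1)/x. With the mean value
  theorem it makes the excess of the trapezoid over the integral nondecreasing in the right end
  point.\<close>

lemma dickman_trapezoid:
  assumes "1 \<le> v" "v \<le> w"
  shows "dickman_primitive w - dickman_primitive v \<le> (w - v) * (\<rho> v + \<rho> w) / 2"
proof -
  let ?F = "\<lambda>x. (x - v) * (\<rho> v + \<rho> x) / 2 - dickman_primitive x"
  have "?F v \<le> ?F w"
  proof (rule DERIV_nonneg_imp_increasing_open[OF assms(2), of ?F])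
    show "continuous_on {v..w} ?F"
      using assms by (intro continuous_intros continuous_on_subset[OF dickman_cont] continuous_on_subset[OF dickman_primitive_cont[of w]]) auto
    fix x assume x: "v < x" "x < w"
    have x1: "1 < x" using x assms by simp
    let ?d = "\<lambda>x. - \<rho> (x - 1) / x"
    have "\<exists>l z. v < z \<and> z < x \<and> DERIV \<rho> z :> l \<and> \<rho> x - \<rho> v = (x - v) * l"
    proof (rule MVT[OF x(1)])
      show "continuous_on {v..x} \<rho>" using assms by (intro continuous_on_subset[OF dickman_cont]) auto
      show "\<rho> differentiable at t" if "v < t" "t < x" for t
        using dickman_deriv[of t] that assms real_differentiable_def by auto
    qed
    then obtain l z where z: "v < z" "z < x" "DERIV \<rho> z :> l" "\<rho> x - \<rho> v = (x - v) * l" by blast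
    have "DERIV \<rho> z :> ?d z" using z assms by (intro dickman_deriv) simp
    then have l: "l = ?d z" using z(3) DERIV_unique by blast
    have "\<rho> (x - 1) / x \<le> \<rho> (z - 1) / z"
      using z assms dickman_antimono[of "z - 1" "x - 1"] dickman_pos[of "z - 1"]
      by (intro frac_le) auto
    then have "?d z \<le> ?d x" by simp
    then have "(x - v) * ?d z \<le> (x - v) * ?d x" using x by (intro mult_left_mono) auto
    then have nn: "0 \<le> (\<rho> v + \<rho> x + (x - v) * ?d x) / 2 - \<rho> x"
      using z(4) unfolding l by (simp add: algebra_simps)
    have "(?F has_real_derivative (1 * (\<rho> v + \<rho> x) + (0 + ?d x) * (x - v)) / 2 - \<rho> x) (at x)"
      using x1 by (auto intro!: derivative_eq_intros dickman_deriv dickman_primitive_deriv)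
    then show "\<exists>y. (?F has_real_derivative y) (at x) \<and> 0 \<le> y"
      using nn by (intro exI conjI) (auto simp: algebra_simps)
  qed
  then show ?thesis by simp
qed

text \<open>The trapezoidal rule with five steps on [u - 1, u]. The unknown x i is also the last
  node, which turns 2 i into 2 i - 1. The kink of rho at 1 is the grid point 5, so no step contains
  it in its interior, and below it the rule is exact.\<close>

lemma dickman_step:
  fixes i :: nat
  assumes "6 \<le> i"
  defines "x \<equiv> \<lambda>i. \<rho> (real i / 5)"
  shows "(2 * real i - 1) * x i \<le> x (i - 5) + 2 * (x (i - 4) + x (i - 3) + x (i - 2) + x (i - 1))"
proof -
  have tr: "dickman_primitive (real (Suc m) / 5) - dickman_primitive (real m / 5) \<le> (x m + x (Suc m)) / 10" for m
  proof (cases "5 \<le> m")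
    case True
    have "dickman_primitive (real (Suc m) / 5) - dickman_primitive (real m / 5) \<le> (real (Suc m) / 5 - real m / 5) * (x m + x (Suc m)) / 2"
      unfolding x_def using True by (intro dickman_trapezoid) (auto simp: field_simps)
    also have "real (Suc m) / 5 - real m / 5 = 1 / 5" by (simp add: field_simps)
    finally show ?thesis by simp
  next
    case False
    then have "real (Suc m) / 5 \<le> 1" by simp
    moreover have "real m / 5 \<le> 1" using False by simp
    ultimately have "dickman_primitive (real (Suc m) / 5) = real (Suc m) / 5" "dickman_primitive (real m / 5) = real m / 5"
      "x m = 1" "x (Suc m) = 1"
      unfolding x_def by (intro dickman_primitive_le_1 dickman_one; simp)+
    then show ?thesis by (simp add: field_simps)
  qed
  define k where "k = i - 5"
  have i: "i = k + 5" using assms by (simp add: k_def)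
  have "real i / 5 * x i = dickman_primitive (real i / 5) - dickman_primitive (real i / 5 - 1)"
    unfolding x_def using assms by (intro dickman_integral) auto
  also have "real i / 5 - 1 = real k / 5" by (simp add: i field_simps)
  finally have eq: "real i / 5 * x i = dickman_primitive (real (k + 5) / 5) - dickman_primitive (real k / 5)" by (simp add: i)
  have "real i / 5 * x i \<le> (x k + 2 * (x (k + 1) + x (k + 2) + x (k + 3) + x (k + 4)) + x (k + 5)) / 10"
    using tr[of k] tr[of "k + 1"] tr[of "k + 2"] tr[of "k + 3"] tr[of "k + 4"] eq
    by (simp add: numeral_eq_Suc add_divide_distrib)
  then show ?thesis by (simp add: i algebra_simps)
qed

end

text \<open>Upper bounds for \<open>10\<^sup>4\<^sup>0 \<rho>(i/5)\<close> at five consecutive grid points, from the trapezoidal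
  rule applied to \<open>u \<rho>(u) = \<integral>\<rho>\<close> over \<open>[u - 1, u]\<close>, which overestimates because \<open>\<rho>\<close> is convex
  on \<open>[1, \<infinity>)\<close>.\<close>

fun dickman_upper :: "nat \<Rightarrow> int \<times> int \<times> int \<times> int \<times> int" where
  "dickman_upper 0 = (10 ^ 40, 10 ^ 40, 10 ^ 40, 10 ^ 40, 10 ^ 40)"
| "dickman_upper (Suc k) = (case dickman_upper k of (a, b, c, d, e) \<Rightarrow>
     (b, c, d, e, (a + 2 * (b + c + d + e)) div (2 * int k + 11) + 1))"

lemma dickman_upper_bound:
  assumes "is_dickman \<rho>" "dickman_upper k = (a, b, c, d, e)"
  shows "10 ^ 40 * \<rho> (real (k + 1) / 5) \<le> a \<and> 10 ^ 40 * \<rho> (real (k + 2) / 5) \<le> b \<and>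
    10 ^ 40 * \<rho> (real (k + 3) / 5) \<le> c \<and> 10 ^ 40 * \<rho> (real (k + 4) / 5) \<le> d \<and>
    10 ^ 40 * \<rho> (real (k + 5) / 5) \<le> e"
  using assms(2)
proof (induction k arbitrary: a b c d e)
  case 0
  then show ?case using dickman_one[OF assms(1)] by auto
next
  case (Suc k)
  obtain a' b' c' d' e' where prev: "dickman_upper k = (a', b', c', d', e')" by (metis prod_cases5)
  note IH = Suc.IH[OF prev]
  have eqs: "a = b'" "b = c'" "c = d'" "d = e'" "e = (a' + 2 * (b' + c' + d' + e')) div (2 * int k + 11) + 1"
    using Suc.prems prev by auto
  let ?x = "\<lambda>i. \<rho> (real i / 5)"
  define s where "s = a' + 2 * (b' + c' + d' + e')"
  define q where "q = 2 * int k + 11"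
  have q: "0 < q" "real_of_int q = 2 * real (k + 6) - 1" by (auto simp: q_def)
  have "real_of_int q * ?x (k + 6) \<le> ?x (k + 1) + 2 * (?x (k + 2) + ?x (k + 3) + ?x (k + 4) + ?x (k + 5))"
  proof -
    have "k + 6 - 5 = k + 1" "k + 6 - 4 = k + 2" "k + 6 - 3 = k + 3" "k + 6 - 2 = k + 4" "k + 6 - 1 = k + 5"
      by auto
    then show ?thesis using dickman_step[OF assms(1), of "k + 6"] unfolding q(2) by (simp only: le_add2)
  qed
  then have "10 ^ 40 * (real_of_int q * ?x (k + 6))
      \<le> 10 ^ 40 * ?x (k + 1) + 2 * (10 ^ 40 * ?x (k + 2) + 10 ^ 40 * ?x (k + 3) + 10 ^ 40 * ?x (k + 4) + 10 ^ 40 * ?x (k + 5))"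
    by (simp add: algebra_simps)
  also have "\<dots> \<le> real_of_int s" using IH unfolding s_def by simp
  finally have "10 ^ 40 * ?x (k + 6) \<le> real_of_int s / real_of_int q" using q(1) by (simp add: field_simps)
  \<comment> \<open>Rounding down and adding 1 keeps an upper bound and lets the recursion run in
    integers.\<close>
  also have "\<dots> \<le> real_of_int (s div q + 1)"
    using floor_divide_of_int_eq[of s q, where 'a = real] by linarith
  finally have "10 ^ 40 * ?x (k + 6) \<le> real_of_int e" using eqs by (simp add: s_def q_def)
  then show ?case using IH eqs by (simp add: numeral_eq_Suc)
qed

text \<open>The last entry at stage 95 belongs to the grid point 100/5 = 20, and 10^12 on the scale
  10^40 means 10^-28.\<close>

lemma dickman_upper_95: "snd (snd (snd (snd (dickman_upper 95)))) < 10 ^ 12"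
  by code_simp

text \<open>The method of steps: the derivative at x depends on the value at x - 1, so agreement
  spreads by one unit at a time.\<close>

lemma is_dickman_unique:
  assumes "is_dickman \<rho>" "is_dickman \<sigma>" shows "\<rho> = \<sigma>"
proof
  have upto: "\<rho> u = \<sigma> u" if "u \<le> real (Suc k)" for u k
    using that
  proof (induction k arbitrary: u)
    case 0
    then show ?case using dickman_one[OF assms(1), of u] dickman_one[OF assms(2), of u]
        dickman_neg[OF assms(1), of u] dickman_neg[OF assms(2), of u] by (cases "u < 0") auto
  next
    case (Suc k)
    show ?case
    proof (cases "u \<le> real (Suc k)")
      case True then show ?thesis using Suc by blast
    next
      case False
      let ?F = "\<lambda>x. \<rho> x - \<sigma> x"
      have "?F u = ?F (real (Suc k))"
      proof (rule DERIV_isconst_end[of "real (Suc k)" u ?F])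
        show "real (Suc k) < u" using False by simp
        show "continuous_on {real (Suc k)..u} ?F"
          by (intro continuous_intros continuous_on_subset[OF dickman_cont[OF assms(1)]]
              continuous_on_subset[OF dickman_cont[OF assms(2)]]) auto
        fix x assume x: "real (Suc k) < x" "x < u"
        have "(?F has_real_derivative (- \<rho> (x - 1) / x - (- \<sigma> (x - 1) / x))) (at x)"
          using x by (intro DERIV_diff dickman_deriv assms) auto
        moreover have "\<rho> (x - 1) = \<sigma> (x - 1)" using x Suc by (intro Suc.IH) auto
        ultimately show "(?F has_real_derivative 0) (at x)" by simp
      qed
      moreover have "\<rho> (real (Suc k)) = \<sigma> (real (Suc k))" by (rule Suc.IH) simp
      ultimately show ?thesis by simp
    qed
  qed
  fix u show "\<rho> u = \<sigma> u" using upto[of u "nat \<lceil>u\<rceil>"] by linarith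
qed

lemma is_dickman_dickman_rho: "is_dickman dickman_rho"
proof -
  obtain \<rho> where \<rho>: "is_dickman \<rho>" using dickman_exists by blast
  have "dickman_rho = (THE \<rho>. is_dickman \<rho>)" unfolding dickman_rho_def is_dickman_def ..
  also have "\<dots> = \<rho>" using \<rho> is_dickman_unique by blast
  finally show ?thesis using \<rho> by simp
qed

lemma dickman_rho_20: "0 < dickman_rho 20" "dickman_rho 20 < 1 / 10 ^ 28"
proof -
  show "0 < dickman_rho 20" using dickman_pos[OF is_dickman_dickman_rho, of 20] by simp
  obtain a b c d e where u: "dickman_upper 95 = (a, b, c, d, e)" by (metis prod_cases5)
  have "e < 10 ^ 12" using dickman_upper_95 unfolding u by simp
  then have "real_of_int e < 10 ^ 12" by simp
  then have "10 ^ 40 * dickman_rho 20 < 10 ^ 12"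
    using dickman_upper_bound[OF is_dickman_dickman_rho u] by simp
  then show "dickman_rho 20 < 1 / 10 ^ 28" by simp
qed

section \<open>Smooth numbers and primes in short windows\<close>

lemma prod_primes_dvd:
  fixes N :: nat
  assumes "finite S" "\<And>p. p \<in> S \<Longrightarrow> prime p \<and> p dvd N"
  shows "\<Prod>S dvd N"
  using assms
proof (induction S rule: finite_induct)
  case (insert p S)
  have "coprime p (\<Prod>S)"
    using insert by (intro prod_coprime_right) (metis insertCI primes_coprime)
  then show ?case using insert by (auto intro!: divides_mult)
qed simp

lemma ln_prime_nonneg: "prime p \<Longrightarrow> 0 \<le> ln (real p)" for p :: nat
  using prime_ge_1_nat[of p] by simp

text \<open>Every prime in (m, 2 m] divides the central binomial coefficient, which is at most
  4^m.\<close>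

lemma sum_ln_primes_dyadic:
  "(\<Sum>p | prime p \<and> m < p \<and> p \<le> 2 * m. ln (real p)) \<le> 2 * real m * ln 2"
proof -
  let ?S = "{p. prime p \<and> m < p \<and> p \<le> 2 * m}"
  have fin: "finite ?S" by (rule finite_subset[of _ "{..2 * m}"]) auto
  define B where "B = (2 * m) choose m"
  have B: "fact m * fact m * B = fact (2 * m)"
    using binomial_fact_lemma[of m "2 * m"] by (simp add: B_def mult_2)
  have "p dvd B" if "p \<in> ?S" for p
  proof -
    have "p dvd fact m * fact m * B" using that B by (simp add: prime_dvd_fact_iff)
    moreover have "\<not> p dvd fact m" using that by (simp add: prime_dvd_fact_iff)
    ultimately show ?thesis using that by (auto simp: prime_dvd_mult_iff)
  qed
  then have "\<Prod>?S dvd B" using prod_primes_dvd[OF fin, of B] by blast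
  moreover have Bpos: "0 < B" by (simp add: B_def)
  ultimately have le: "\<Prod>?S \<le> B" by (rule dvd_imp_le)
  have "(\<Sum>p\<in>?S. ln (real p)) = ln (real (\<Prod>?S))"
    using ln_prod[of ?S real] by (simp add: fin prime_gt_0_nat)
  also have "\<dots> \<le> ln (real B)"
  proof -
    have "0 < \<Prod>?S" by (rule prod_pos) (simp add: prime_gt_0_nat)
    then show ?thesis using le Bpos by (simp only: ln_le_cancel_iff of_nat_0_less_iff of_nat_le_iff)
  qed
  also have "B \<le> 2 ^ (2 * m)" unfolding B_def by (rule binomial_le_pow2)
  then have "ln (real B) \<le> ln (2 ^ (2 * m))"
    using Bpos by (intro ln_mono) (metis of_nat_le_iff of_nat_numeral of_nat_power, simp)
  also have "\<dots> = 2 * real m * ln 2" by (simp add: ln_realpow)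
  finally show ?thesis .
qed

text \<open>A Mertens-type upper bound: each dyadic range of primes contributes at most 2 ln
  2.\<close>

lemma sum_ln_over_primes:
  "(\<Sum>p | prime p \<and> p \<le> 2 ^ J. ln (real p) / real p) \<le> 2 * real J * ln 2"
proof (induction J)
  case 0
  have "{p :: nat. prime p \<and> p \<le> 2 ^ 0} = {}" by (auto dest: prime_gt_1_nat)
  then show ?case by (metis (no_types, lifting) card.empty le0 mult_zero_left mult_zero_right of_nat_0 order_refl sum.empty)
next
  case (Suc J)
  let ?A = "{p :: nat. prime p \<and> p \<le> 2 ^ J}" and ?B = "{p :: nat. prime p \<and> 2 ^ J < p \<and> p \<le> 2 * 2 ^ J}"
  have un: "{p :: nat. prime p \<and> p \<le> 2 ^ Suc J} = ?A \<union> ?B" by auto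
  have fin: "finite ?A" "finite ?B"
    by (auto intro: finite_subset[of _ "{..2 ^ J}"] finite_subset[of _ "{..2 * 2 ^ J}"])
  have "(\<Sum>p\<in>?B. ln (real p) / real p) \<le> (\<Sum>p\<in>?B. ln (real p) / 2 ^ J)"
  proof (rule sum_mono)
    fix p assume p: "p \<in> ?B"
    then have "(2::real) ^ J \<le> real p" by (metis (no_types, lifting) less_imp_le mem_Collect_eq of_nat_le_iff of_nat_numeral of_nat_power)
    moreover have "0 \<le> ln (real p)" using p by (simp add: ln_prime_nonneg)
    moreover have "0 < real p" using p by (simp add: prime_gt_0_nat)
    ultimately show "ln (real p) / real p \<le> ln (real p) / 2 ^ J" by (intro divide_left_mono) auto
  qed
  also have "\<dots> = (\<Sum>p\<in>?B. ln (real p)) / 2 ^ J" by (simp add: sum_divide_distrib)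
  also have "\<dots> \<le> (2 * real (2 ^ J) * ln 2) / 2 ^ J"
    using sum_ln_primes_dyadic[of "2 ^ J"] by (intro divide_right_mono) auto
  also have "\<dots> = 2 * ln 2" by simp
  finally have "(\<Sum>p\<in>?B. ln (real p) / real p) \<le> 2 * ln 2" .
  moreover have "(\<Sum>p\<in>?A \<union> ?B. ln (real p) / real p) = (\<Sum>p\<in>?A. ln (real p) / real p) + (\<Sum>p\<in>?B. ln (real p) / real p)"
    using fin by (intro sum.union_disjoint) auto
  ultimately show ?case using Suc unfolding un by (simp add: algebra_simps)
qed

lemma multiplicity_eq_card:
  fixes n p L :: nat
  assumes "prime p" "0 < n" "n \<le> L"
  shows "multiplicity p n = card {k \<in> {1..L}. p ^ k dvd n}"
proof -
  have iff: "p ^ k dvd n \<longleftrightarrow> k \<le> multiplicity p n" for k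
    using assms prime_gt_1_nat by (intro power_dvd_iff_le_multiplicity) auto
  have "multiplicity p n < n"
  proof -
    have "p ^ multiplicity p n \<le> n" using assms by (intro dvd_imp_le multiplicity_dvd)
    moreover have "multiplicity p n < 2 ^ multiplicity p n" by simp
    moreover have "2 ^ multiplicity p n \<le> p ^ multiplicity p n"
      using prime_ge_2_nat[OF assms(1)] by (intro power_mono) auto
    ultimately show ?thesis by linarith
  qed
  then have "{k \<in> {1..L}. p ^ k dvd n} = {1..multiplicity p n}" using assms by (auto simp: iff)
  then show ?thesis by simp
qed

lemma sum_multiplicity_le:
  fixes p N :: nat
  assumes "prime p"
  shows "(\<Sum>n\<in>{1..N}. real (multiplicity p n)) \<le> 2 * real N / real p"
proof -
  have p2: "2 \<le> p" using prime_ge_2_nat[OF assms] .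
  have "(\<Sum>n\<in>{1..N}. multiplicity p n) = (\<Sum>n\<in>{1..N}. \<Sum>k\<in>{k. k \<in> {1..N} \<and> p ^ k dvd n}. 1)"
    using multiplicity_eq_card[OF assms] by (intro sum.cong) auto
  also have "\<dots> = (\<Sum>k\<in>{1..N}. \<Sum>n\<in>{n. n \<in> {1..N} \<and> p ^ k dvd n}. 1)"
    by (rule sum.swap_restrict) auto
  finally have eq: "(\<Sum>n\<in>{1..N}. multiplicity p n) = (\<Sum>k\<in>{1..N}. card {n \<in> {1..N}. p ^ k dvd n})" by simp
  have le: "real (card {n \<in> {1..N}. q dvd n}) \<le> real N / real q" if "0 < q" for q
  proof -
    have "{n \<in> {1..N}. q dvd n} \<subseteq> (\<lambda>i. q * i) ` {1..N div q}"
    proof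
      fix n assume "n \<in> {n \<in> {1..N}. q dvd n}"
      then obtain i where i: "n = q * i" "1 \<le> n" "n \<le> N" by auto
      then have "i \<le> N div q" using that by (metis div_le_mono nonzero_mult_div_cancel_left not_gr_zero)
      moreover have "1 \<le> i" using i by (cases i) auto
      ultimately show "n \<in> (\<lambda>i. q * i) ` {1..N div q}" using i by auto
    qed
    then have "card {n \<in> {1..N}. q dvd n} \<le> card ((\<lambda>i. q * i) ` {1..N div q})" by (intro card_mono) auto
    also have "\<dots> \<le> N div q" using card_image_le[of "{1..N div q}"] by simp
    finally have "real (card {n \<in> {1..N}. q dvd n}) \<le> real (N div q)" by simp
    also have "\<dots> \<le> real N / real q" using of_nat_div_le_of_nat[of N q, where 'a = real] by simp
    finally show ?thesis .
  qed
  have geo: "(\<Sum>k\<in>{1..N}. (1 / real p) ^ k) \<le> 2 / real p"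
  proof -
    \<comment> \<open>Subtracting the last power strengthens the claim enough for induction, since
      2/p \<le> 1.\<close>
    have geo1: "(\<Sum>k\<in>{1..M}. (1 / real p) ^ k) \<le> 2 / real p - (1 / real p) ^ M" if "1 \<le> M" for M
      using that
    proof (induction M rule: dec_induct)
      case base show ?case using p2 by (simp add: field_simps power2_eq_square)
    next
      case (step M)
      have "(1 / real p) ^ M * (2 / real p) \<le> (1 / real p) ^ M * 1"
        using p2 by (intro mult_left_mono) auto
      then show ?case using step by (simp add: field_simps)
    qed
    moreover have "0 \<le> (1 / real p) ^ N" by simp
    ultimately show ?thesis using geo1[of N] by (cases "N = 0") (simp, linarith)
  qed
  have "(\<Sum>n\<in>{1..N}. real (multiplicity p n)) = (\<Sum>k\<in>{1..N}. real (card {n \<in> {1..N}. p ^ k dvd n}))"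
    using arg_cong[OF eq, of real] by simp
  also have "\<dots> \<le> (\<Sum>k\<in>{1..N}. real N / real (p ^ k))" using le[of "p ^ k" for k] p2 by (intro sum_mono) simp
  also have "\<dots> = real N * (\<Sum>k\<in>{1..N}. (1 / real p) ^ k)"
    by (simp add: sum_distrib_left power_divide)
  also have "\<dots> \<le> real N * (2 / real p)" using geo by (intro mult_left_mono) auto
  finally show ?thesis by (simp add: mult.commute)
qed

lemma ln_prime_factorization:
  fixes n :: nat
  assumes "0 < n" "\<And>p. prime p \<Longrightarrow> p dvd n \<Longrightarrow> p \<le> Y"
  shows "ln (real n) = (\<Sum>p | prime p \<and> p \<le> Y. real (multiplicity p n) * ln (real p))"
proof -
  let ?S = "{p. prime p \<and> p \<le> Y}"
  have fin: "finite ?S" by (rule finite_subset[of _ "{..Y}"]) auto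
  have "n = (\<Prod>p\<in>prime_factors n. p ^ multiplicity p n)" using assms(1) by (simp add: prime_factorization_nat)
  also have "\<dots> = (\<Prod>p\<in>?S. p ^ multiplicity p n)"
    using assms fin by (intro prod.mono_neutral_left) (auto simp: prime_factors_dvd not_dvd_imp_multiplicity_0)
  finally have "real n = (\<Prod>p\<in>?S. real p ^ multiplicity p n)" by (metis (no_types, lifting) of_nat_power of_nat_prod prod.cong)
  then have "ln (real n) = (\<Sum>p\<in>?S. ln (real p ^ multiplicity p n))"
    using ln_prod[of ?S "\<lambda>p. real p ^ multiplicity p n"] by (simp add: fin prime_gt_0_nat)
  also have "\<dots> = (\<Sum>p\<in>?S. real (multiplicity p n) * ln (real p))"
    by (simp add: ln_realpow)
  finally show ?thesis .
qed

text \<open>For smooth n all of ln n is supplied by primes up to 2^J. Over all n \<le> N together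
  these primes supply at most 2 N times the sum of ln p / p, while each counted n uses up at least
  ln X.\<close>

lemma card_smooth_le:
  fixes X N J :: nat
  assumes X: "1 < X"
  shows "real (card {n \<in> {X<..N}. \<forall>p. prime p \<longrightarrow> p dvd n \<longrightarrow> p \<le> 2 ^ J}) * ln (real X)
    \<le> 4 * real N * real J * ln 2"
proof -
  let ?E = "{n \<in> {X<..N}. \<forall>p. prime p \<longrightarrow> p dvd n \<longrightarrow> p \<le> 2 ^ J}"
  let ?S = "{p :: nat. prime p \<and> p \<le> 2 ^ J}"
  let ?L = "\<lambda>n. \<Sum>p\<in>?S. real (multiplicity p n) * ln (real p)"
  have nonneg: "0 \<le> ?L n" for n by (intro sum_nonneg mult_nonneg_nonneg) (auto simp: ln_prime_nonneg)
  have "real (card ?E) * ln (real X) = (\<Sum>n\<in>?E. ln (real X))" by simp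
  also have "\<dots> \<le> (\<Sum>n\<in>?E. ?L n)"
  proof (rule sum_mono)
    fix n assume n: "n \<in> ?E"
    then have "ln (real n) = ?L n" by (intro ln_prime_factorization) auto
    moreover have "ln (real X) \<le> ln (real n)" using n X by simp
    ultimately show "ln (real X) \<le> ?L n" by simp
  qed
  also have "\<dots> \<le> (\<Sum>n\<in>{1..N}. ?L n)" by (intro sum_mono2) (auto simp: nonneg)
  also have "\<dots> = (\<Sum>p\<in>?S. (\<Sum>n\<in>{1..N}. real (multiplicity p n)) * ln (real p))"
    by (subst sum.swap) (simp add: sum_distrib_right)
  also have "\<dots> \<le> (\<Sum>p\<in>?S. (2 * real N / real p) * ln (real p))"
    using sum_multiplicity_le by (intro sum_mono mult_right_mono) (auto simp: ln_prime_nonneg)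
  also have "\<dots> = 2 * real N * (\<Sum>p\<in>?S. ln (real p) / real p)" by (simp add: sum_distrib_left)
  also have "\<dots> \<le> 2 * real N * (2 * real J * ln 2)"
    using sum_ln_over_primes[of J] by (intro mult_left_mono) auto
  finally show ?thesis by simp
qed

section \<open>Chebyshev's lower bound and a window rich in primes\<close>

lemma multiplicity_fact:
  fixes p n L :: nat
  assumes "prime p" "n \<le> L"
  shows "multiplicity p (fact n) = (\<Sum>k\<in>{1..L}. n div p ^ k)"
  using assms(2)
proof (induction n)
  case 0 then show ?case by simp
next
  case (Suc n)
  have "multiplicity p (fact (Suc n)) = multiplicity p (Suc n) + multiplicity p (fact n)"
    using assms(1) by (simp add: prime_elem_multiplicity_mult_distrib del: mult_Suc)
  also have "multiplicity p (Suc n) = (\<Sum>k\<in>{1..L}. if p ^ k dvd Suc n then 1 else 0)"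
    using multiplicity_eq_card[OF assms(1), of "Suc n" L] Suc.prems by (simp add: sum.If_cases Int_def)
  also have "\<dots> + multiplicity p (fact n) = (\<Sum>k\<in>{1..L}. (if p ^ k dvd Suc n then 1 else 0) + n div p ^ k)"
    using Suc by (simp add: sum.distrib)
  also have "\<dots> = (\<Sum>k\<in>{1..L}. Suc n div p ^ k)"
    by (intro sum.cong) (auto simp: div_Suc dvd_eq_mod_eq_0)
  finally show ?case .
qed

text \<open>By Legendre's formula the exponent is a sum of terms floor(2m/p^k) - 2 floor(m/p^k),
  each of them 0 or 1, and 0 as soon as p^k > 2m.\<close>

lemma prime_power_central_binomial_le:
  fixes p m :: nat
  assumes "prime p" "0 < m"
  shows "p ^ multiplicity p ((2 * m) choose m) \<le> 2 * m"
proof -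
  define B where "B = (2 * m) choose m"
  have B: "fact m * fact m * B = fact (2 * m)"
    using binomial_fact_lemma[of m "2 * m"] by (simp add: B_def mult_2)
  have Bpos: "B \<noteq> 0" by (simp add: B_def)
  have "multiplicity p (fact (2 * m)) = multiplicity p (fact m) + multiplicity p (fact m) + multiplicity p B"
    using assms(1) Bpos unfolding B[symmetric] by (simp add: prime_elem_multiplicity_mult_distrib)
  then have eq: "(\<Sum>k\<in>{1..2 * m}. (2 * m) div p ^ k) = 2 * (\<Sum>k\<in>{1..2 * m}. m div p ^ k) + multiplicity p B"
    using multiplicity_fact[OF assms(1), of "2 * m" "2 * m"] multiplicity_fact[OF assms(1), of m "2 * m"] by simp
  let ?K = "{k \<in> {1..2 * m}. p ^ k \<le> 2 * m}"
  have "(2 * m) div p ^ k \<le> 2 * (m div p ^ k) + (if p ^ k \<le> 2 * m then 1 else 0)" for k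
  proof (cases "p ^ k \<le> 2 * m")
    case True
    have pos: "0 < p ^ k" using prime_gt_0_nat[OF assms(1)] by simp
    have "m < (m div p ^ k + 1) * p ^ k" using pos by (metis add.commute div_less_iff_less_mult less_add_one)
    then have "2 * m < (2 * (m div p ^ k) + 2) * p ^ k" by (simp add: algebra_simps)
    then have "(2 * m) div p ^ k < 2 * (m div p ^ k) + 2" using pos by (simp add: div_less_iff_less_mult)
    then show ?thesis using True by simp
  qed simp
  then have "(\<Sum>k\<in>{1..2 * m}. (2 * m) div p ^ k)
     \<le> (\<Sum>k\<in>{1..2 * m}. 2 * (m div p ^ k) + (if p ^ k \<le> 2 * m then 1 else 0))" by (intro sum_mono)
  also have "\<dots> = 2 * (\<Sum>k\<in>{1..2 * m}. m div p ^ k) + card ?K"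
    by (simp add: sum.distrib sum_distrib_left sum.If_cases Int_def)
  finally have mult: "multiplicity p B \<le> card ?K" using eq by linarith
  show ?thesis
  proof (cases "multiplicity p B = 0")
    case True then show ?thesis using assms(2) by (simp add: B_def)
  next
    case False
    have "\<exists>k\<in>?K. multiplicity p B \<le> k"
    proof (rule ccontr)
      assume "\<not> ?thesis"
      then have "?K \<subseteq> {1..<multiplicity p B}" by auto
      then have "card ?K \<le> card {1..<multiplicity p B}" by (intro card_mono) auto
      then show False using mult False by simp
    qed
    then obtain k where k: "multiplicity p B \<le> k" "p ^ k \<le> 2 * m" by auto
    have "p ^ multiplicity p B \<le> p ^ k" using k prime_ge_1_nat[OF assms(1)] by (intro power_increasing) auto
    then show ?thesis using k by (simp add: B_def)
  qed
qed

text \<open>The central binomial coefficient is at least 4^m/(2m), and each prime up to 2m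
  contributes to it a factor of at most 2m.\<close>

lemma chebyshev_lower:
  fixes m :: nat
  assumes "0 < m"
  shows "real m * ln 4 - ln (2 * real m) \<le> real (card {p. prime p \<and> p \<le> 2 * m}) * ln (2 * real m)"
proof -
  define B where "B = (2 * m) choose m"
  let ?S = "{p. prime p \<and> p \<le> 2 * m}"
  have fin: "finite ?S" by (rule finite_subset[of _ "{..2 * m}"]) auto
  have Bpos: "0 < B" by (simp add: B_def)
  have Bd: "B dvd fact (2 * m)"
    using binomial_fact_lemma[of m "2 * m"] by (metis B_def dvd_triv_right le_add2 mult_2)
  have small: "p \<le> 2 * m" if "prime p" "p dvd B" for p
    using dvd_trans[OF that(2) Bd] that(1) by (simp add: prime_dvd_fact_iff)
  have "4 ^ m / (2 * real m) \<le> real B"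
    using central_binomial_lower_bound[of m] assms by (simp add: B_def)
  then have "ln (4 ^ m / (2 * real m)) \<le> ln (real B)" using assms by (intro ln_mono) auto
  then have "real m * ln 4 - ln (2 * real m) \<le> ln (real B)"
    using assms by (simp add: ln_div ln_realpow)
  also have "\<dots> = (\<Sum>p\<in>?S. real (multiplicity p B) * ln (real p))"
    using ln_prime_factorization[OF Bpos small] .
  also have "\<dots> \<le> (\<Sum>p\<in>?S. ln (2 * real m))"
  proof (rule sum_mono)
    fix p assume p: "p \<in> ?S"
    then have p0: "0 < p" by (simp add: prime_gt_0_nat)
    have "real (p ^ multiplicity p B) \<le> real (2 * m)"
      using prime_power_central_binomial_le[of p m] p assms by (simp only: B_def of_nat_le_iff mem_Collect_eq)
    then have "ln (real p ^ multiplicity p B) \<le> ln (2 * real m)"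
      using p0 by (intro ln_mono) auto
    then show "real (multiplicity p B) * ln (real p) \<le> ln (2 * real m)" using p0 by (simp add: ln_realpow)
  qed
  finally show ?thesis by simp
qed

definition prime_window :: "nat \<Rightarrow> nat set" where
  "prime_window P = {p. prime p \<and> P < p \<and> p \<le> 2 * P}"

lemma finite_prime_window: "finite (prime_window P)"
  unfolding prime_window_def by (rule finite_subset[of _ "{..2 * P}"]) auto

lemma card_primes_power2:
  "card {p :: nat. prime p \<and> p \<le> 2 ^ K} \<le> (\<Sum>i<K. card (prime_window (2 ^ i)))"
proof (induction K)
  case 0
  have "{p :: nat. prime p \<and> p \<le> 2 ^ 0} = {}" by (auto dest: prime_gt_1_nat)
  then show ?case by (metis (no_types, lifting) card.empty le0 mult_zero_left mult_zero_right of_nat_0 order_refl sum.empty)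
next
  case (Suc K)
  have "{p :: nat. prime p \<and> p \<le> 2 ^ Suc K} \<subseteq> {p. prime p \<and> p \<le> 2 ^ K} \<union> prime_window (2 ^ K)"
    by (auto simp: prime_window_def)
  moreover have "finite {p :: nat. prime p \<and> p \<le> 2 ^ K}" by (rule finite_subset[of _ "{..2 ^ K}"]) auto
  ultimately have "card {p :: nat. prime p \<and> p \<le> 2 ^ Suc K}
      \<le> card ({p. prime p \<and> p \<le> 2 ^ K} \<union> prime_window (2 ^ K))"
    using finite_prime_window by (intro card_mono) auto
  also have "\<dots> \<le> card {p :: nat. prime p \<and> p \<le> 2 ^ K} + card (prime_window (2 ^ K))" by (rule card_Un_le)
  finally show ?case using Suc by simp
qed

text \<open>Pigeonhole over dyadic windows: if each window were short or poor in primes, there would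
  be at most 3 2^K/K^2 primes up to 2^K, against the Chebyshev bound of order 2^K/K. The loss K^2 in
  length and density is logarithmic, which a power saving absorbs later.\<close>

lemma prime_window_exists:
  fixes K :: nat
  assumes K: "8 \<le> K"
  shows "\<exists>i<K. 2 ^ K \<le> 2 ^ i * real K ^ 2 \<and> 2 ^ i \<le> real (card (prime_window (2 ^ i))) * real K ^ 2"
proof (rule ccontr)
  assume neg: "\<not> ?thesis"
  \<comment> \<open>The short windows. Their primes are bounded by the length alone, and these
    lengths sum geometrically.\<close>
  define I where "I = {i. i < K \<and> 2 ^ i * real K ^ 2 < 2 ^ K}"
  have K0: "0 < real K" using K by simp
  have each: "real (card (prime_window (2 ^ i))) \<le> (if i \<in> I then 2 ^ i else 0) + 2 ^ i / real K ^ 2" if "i < K" for i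
  proof (cases "i \<in> I")
    case True
    have "prime_window (2 ^ i) \<subseteq> {2 ^ i<..2 * 2 ^ i}" by (auto simp: prime_window_def)
    then have "card (prime_window (2 ^ i)) \<le> card {2 ^ i<..2 * 2 ^ i :: nat}" by (intro card_mono) auto
    then have "card (prime_window (2 ^ i)) \<le> 2 ^ i" by simp
    then have "real (card (prime_window (2 ^ i))) \<le> 2 ^ i"
      by (metis of_nat_le_iff of_nat_numeral of_nat_power)
    also have "\<dots> \<le> 2 ^ i + 2 ^ i / real K ^ 2" by simp
    finally show ?thesis using True by simp
  next
    case False
    then have "2 ^ K \<le> 2 ^ i * real K ^ 2" using that by (simp add: I_def)
    then have "\<not> 2 ^ i \<le> real (card (prime_window (2 ^ i))) * real K ^ 2" using neg that by blast
    then have "real (card (prime_window (2 ^ i))) * real K ^ 2 < 2 ^ i" by simp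
    then show ?thesis using False K0 by (simp add: field_simps)
  qed
  have geo: "(\<Sum>i<k. (2::real) ^ i) \<le> 2 ^ k" for k by (induction k) auto
  have sumI: "(\<Sum>i<K. if i \<in> I then 2 ^ i else 0) \<le> 2 * 2 ^ K / real K ^ 2"
  proof (cases "I = {}")
    case False
    have finI: "finite I" by (simp add: I_def)
    define M where "M = Max I"
    have M: "M \<in> I" unfolding M_def using finI False by simp
    have "(\<Sum>i<K. if i \<in> I then (2::real) ^ i else 0) = (\<Sum>i\<in>I. 2 ^ i)"
      by (simp add: sum.If_cases I_def Int_def)
    also have "\<dots> \<le> (\<Sum>i<Suc M. 2 ^ i)"
      using finI by (intro sum_mono2) (auto simp: M_def less_Suc_eq_le)
    also have "\<dots> \<le> 2 ^ Suc M" by (rule geo)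
    also have "\<dots> = 2 * 2 ^ M" by simp
    also have "\<dots> \<le> 2 * (2 ^ K / real K ^ 2)"
      using M K0 by (intro mult_left_mono) (auto simp: I_def field_simps)
    finally show ?thesis by simp
  qed simp
  have "real (card {p :: nat. prime p \<and> p \<le> 2 ^ K}) \<le> (\<Sum>i<K. real (card (prime_window (2 ^ i))))"
    using card_primes_power2[of K] by (simp flip: of_nat_sum)
  also have "\<dots> \<le> (\<Sum>i<K. (if i \<in> I then 2 ^ i else 0) + 2 ^ i / real K ^ 2)"
    using each by (intro sum_mono) auto
  also have "\<dots> = (\<Sum>i<K. if i \<in> I then 2 ^ i else 0) + (\<Sum>i<K. 2 ^ i) / real K ^ 2"
    by (simp add: sum.distrib sum_divide_distrib)
  also have "\<dots> \<le> 2 * 2 ^ K / real K ^ 2 + 2 ^ K / real K ^ 2"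
    using sumI geo[of K] by (intro add_mono divide_right_mono) auto
  also have "\<dots> = 3 * 2 ^ K / real K ^ 2" by (simp add: field_simps)
  finally have upper: "real (card {p :: nat. prime p \<and> p \<le> 2 ^ K}) \<le> 3 * 2 ^ K / real K ^ 2" .
  obtain k where k: "K = Suc k" using K by (cases K) auto
  have "real (2 ^ k) * ln 4 - ln (2 * real (2 ^ k)) \<le> real (card {p :: nat. prime p \<and> p \<le> 2 * 2 ^ k}) * ln (2 * real (2 ^ k))"
    by (rule chebyshev_lower) simp
  moreover have "ln (2 * real (2 ^ k)) = real K * ln 2" using k by (simp add: ln_mult ln_realpow algebra_simps)
  moreover have "real (2 ^ k) * ln 4 = 2 ^ K * ln 2"
    using k ln_realpow[of 2 2] by simp
  ultimately have "(2 ^ K - real K) * ln 2 \<le> (real (card {p :: nat. prime p \<and> p \<le> 2 ^ K}) * real K) * ln 2"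
    using k by (simp add: algebra_simps)
  then have "2 ^ K - real K \<le> real (card {p :: nat. prime p \<and> p \<le> 2 ^ K}) * real K" by simp
  also have "\<dots> \<le> (3 * 2 ^ K / real K ^ 2) * real K" using upper by (intro mult_right_mono) auto
  also have "\<dots> = 3 * 2 ^ K / real K" using K0 by (simp add: power2_eq_square)
  also have "\<dots> \<le> 3 * 2 ^ K / 8" using K by (intro divide_left_mono) auto
  finally have "5 * 2 ^ K \<le> 8 * real K" by simp
  moreover have "real K < 2 ^ K" by (rule of_nat_less_two_power)
  moreover have "2 * real K \<le> 2 ^ K"
  proof -
    have "real k < 2 ^ k" by (rule of_nat_less_two_power)
    then have "real (Suc k) \<le> 2 ^ k" by (metis Suc_leI less_exp of_nat_le_iff of_nat_numeral of_nat_power)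
    then show ?thesis using k by simp
  qed
  ultimately show False using K0 by simp
qed

section \<open>Exponential sums\<close>

definition fdiff :: "(nat \<Rightarrow> real) \<Rightarrow> nat \<Rightarrow> real" where "fdiff f j = f (Suc j) - f j"

lemma norm_cis_minus_one_ge: assumes "0 \<le> g" "g \<le> 1" shows "g / 2 \<le> norm (cis g - 1)"
proof -
  have "sin 0 - 0 / 2 \<le> sin g - g / 2"
  proof (rule DERIV_nonneg_imp_nondecreasing[OF assms(1)])
    fix x :: real assume x: "0 \<le> x" "x \<le> g"
    have "cos (pi / 3) \<le> cos x" using x assms pi_gt3 by (intro cos_monotone_0_pi_le) auto
    then have "0 \<le> cos x - 1 / 2" by (simp add: cos_60)
    moreover have "((\<lambda>x. sin x - x / 2) has_real_derivative cos x - 1 / 2) (at x)"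
      by (auto intro!: derivative_eq_intros)
    ultimately show "\<exists>y. ((\<lambda>x. sin x - x / 2) has_real_derivative y) (at x) \<and> 0 \<le> y" by blast
  qed
  then have "g / 2 \<le> sin g" by simp
  also have "\<dots> \<le> \<bar>Im (cis g - 1)\<bar>" by simp
  also have "\<dots> \<le> norm (cis g - 1)" by (rule abs_Im_le_cmod)
  finally show ?thesis .
qed

lemma norm_cis_diff_le: "norm (cis x - cis y) \<le> \<bar>x - y\<bar>"
proof -
  have eq: "cis x - cis y = cis y * (cis (x - y) - 1)" by (simp add: algebra_simps cis_mult)
  have "norm (cis t - 1) \<le> \<bar>t\<bar>" for t
  proof -
    have "(norm (cis t - 1))\<^sup>2 = (cos t - 1)\<^sup>2 + (sin t)\<^sup>2" by (simp add: cmod_power2)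
    also have "\<dots> = 2 - 2 * cos t" using sin_cos_squared_add[of t] by (simp add: power2_diff)
    also have "\<dots> = 4 * (sin (t / 2))\<^sup>2" using cos_double_sin[of "t / 2"] by simp
    also have "\<dots> \<le> t\<^sup>2"
    proof -
      have "\<bar>sin (t / 2)\<bar> \<le> \<bar>t / 2\<bar>" by (rule abs_sin_x_le_abs_x)
      then have "(sin (t / 2))\<^sup>2 \<le> (t / 2)\<^sup>2" by (simp only: abs_le_square_iff)
      then show ?thesis by (simp add: power_divide)
    qed
    finally show ?thesis by (metis abs_le_square_iff abs_norm_cancel)
  qed
  then show ?thesis unfolding eq by (simp add: norm_mult)
qed

lemma abel_identity:
  fixes z c :: "nat \<Rightarrow> complex"
  shows "(\<Sum>j<Suc m. (z (Suc j) - z j) * c j)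
    = z (Suc m) * c m - z 0 * c 0 - (\<Sum>j<m. z (Suc j) * (c (Suc j) - c j))"
  by (induction m) (simp_all add: algebra_simps)

text \<open>The Kusmin-Landau inequality with phases in radians. Each term is (z(j+1) - z(j)) c(j)
  with c(j) = 1/(cis(difference) - 1); after summation by parts the variation of c is controlled
  because the differences are monotone and bounded below by \<gamma>.\<close>

lemma kusmin_landau:
  fixes F :: "nat \<Rightarrow> real"
  assumes lo: "\<And>j. j < M \<Longrightarrow> \<gamma> \<le> fdiff F j" and hi: "\<And>j. j < M \<Longrightarrow> fdiff F j \<le> r * \<gamma>"
    and anti: "\<And>j. Suc j < M \<Longrightarrow> fdiff F (Suc j) \<le> fdiff F j"
    and g: "0 < \<gamma>" "r * \<gamma> \<le> 1" "1 \<le> r"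
  shows "norm (\<Sum>j<M. cis (F j)) \<le> 8 * r / \<gamma>"
proof (cases M)
  case 0 then show ?thesis using g by simp
next
  case (Suc m)
  define z where "z j = cis (F j)" for j
  define w where "w j = cis (fdiff F j) - 1" for j
  define c where "c j = 1 / w j" for j
  have w: "\<gamma> / 2 \<le> norm (w j)" if "j < M" for j
  proof -
    have "\<gamma> / 2 \<le> fdiff F j / 2" using lo[OF that] by simp
    also have "\<dots> \<le> norm (w j)" unfolding w_def
      using lo[OF that] hi[OF that] g by (intro norm_cis_minus_one_ge) auto
    finally show ?thesis .
  qed
  have w0: "w j \<noteq> 0" if "j < M" for j using w[OF that] g by auto
  have cn: "norm (c j) \<le> 2 / \<gamma>" if "j < M" for j
  proof -
    have "1 / norm (w j) \<le> 1 / (\<gamma> / 2)" using w[OF that] g by (intro frac_le) auto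
    then show ?thesis by (simp add: c_def norm_divide)
  qed
  have zj: "z j = (z (Suc j) - z j) * c j" if "j < M" for j
  proof -
    have "z (Suc j) = z j * cis (fdiff F j)" by (simp add: z_def cis_mult fdiff_def)
    then have "z (Suc j) - z j = z j * w j" by (simp add: w_def algebra_simps)
    then show ?thesis using w0[OF that] by (simp add: c_def)
  qed
  have cd: "norm (c (Suc j) - c j) \<le> (fdiff F j - fdiff F (Suc j)) * (4 / \<gamma>\<^sup>2)" if "Suc j < M" for j
  proof -
    have j: "j < M" using that by simp
    have "c (Suc j) - c j = (w j - w (Suc j)) / (w j * w (Suc j))"
      using w0[OF that] w0[OF j] by (simp add: c_def field_simps)
    then have "norm (c (Suc j) - c j) = norm (w j - w (Suc j)) / (norm (w j) * norm (w (Suc j)))"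
      by (simp add: norm_divide norm_mult)
    also have "\<dots> \<le> (fdiff F j - fdiff F (Suc j)) / (\<gamma> / 2 * (\<gamma> / 2))"
    proof (rule frac_le)
      show "norm (w j - w (Suc j)) \<le> fdiff F j - fdiff F (Suc j)"
        using norm_cis_diff_le[of "fdiff F j" "fdiff F (Suc j)"] anti[OF that] by (simp add: w_def)
      show "\<gamma> / 2 * (\<gamma> / 2) \<le> norm (w j) * norm (w (Suc j))"
        using w[OF that] w[OF j] g by (intro mult_mono) auto
    qed (use g anti[OF that] in auto)
    finally show ?thesis by (simp add: power2_eq_square)
  qed
  have tele: "(\<Sum>j<m. fdiff F j - fdiff F (Suc j)) = fdiff F 0 - fdiff F m"
    by (rule sum_lessThan_telescope')
  have "norm (\<Sum>j<M. z j) = norm (\<Sum>j<Suc m. (z (Suc j) - z j) * c j)"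
    using zj Suc by (intro arg_cong[where f = norm] sum.cong) auto
  also have "\<dots> \<le> norm (z (Suc m) * c m) + norm (z 0 * c 0) + norm (\<Sum>j<m. z (Suc j) * (c (Suc j) - c j))"
    unfolding abel_identity by (meson add_mono_thms_linordered_semiring(3) norm_triangle_ineq4 order_trans)
  also have "\<dots> \<le> 2 / \<gamma> + 2 / \<gamma> + (\<Sum>j<m. norm (c (Suc j) - c j))"
    using cn[of m] cn[of 0] Suc
    by (intro add_mono order_trans[OF norm_sum] sum_mono) (auto simp: norm_mult z_def)
  also have "(\<Sum>j<m. norm (c (Suc j) - c j)) \<le> (\<Sum>j<m. (fdiff F j - fdiff F (Suc j)) * (4 / \<gamma>\<^sup>2))"
    using cd Suc by (intro sum_mono) auto
  also have "\<dots> = (fdiff F 0 - fdiff F m) * (4 / \<gamma>\<^sup>2)" by (simp only: sum_distrib_right[symmetric] tele)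
  also have "\<dots> \<le> (r * \<gamma>) * (4 / \<gamma>\<^sup>2)"
    using hi[of 0] lo[of m] Suc g by (intro mult_right_mono) auto
  also have "\<dots> = 4 * r / \<gamma>" using g by (simp add: power2_eq_square field_simps)
  also have "2 / \<gamma> + 2 / \<gamma> + 4 * r / \<gamma> \<le> 8 * r / \<gamma>" using g by (simp add: field_simps)
  finally show ?thesis by (simp add: z_def)
qed

text \<open>R times the sum is a sum over m of R shifted terms. Cauchy-Schwarz in m and expansion of
  the square leave correlations with shift h < R, the diagonal giving the term M/R.\<close>

lemma van_der_corput:
  fixes z :: "nat \<Rightarrow> complex"
  assumes R: "0 < R" and z: "\<And>j. norm (z j) \<le> 1"
    and B: "\<And>h. 0 < h \<Longrightarrow> h < R \<Longrightarrow> norm (\<Sum>j<M - h. z (j + h) * cnj (z j)) \<le> B"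
    and B0: "0 \<le> B"
  shows "(norm (\<Sum>j<M. z j))\<^sup>2 \<le> real (M + R) * (real M / real R + B)"
proof -
  define S where "S = (\<Sum>j<M. z j)"
  \<comment> \<open>The r-th shift of the sequence, padded with zeros so that all shifts share the
    index range below M + R.\<close>
  define v where "v m r = (if r \<le> m \<and> m - r < M then z (m - r) else 0)" for m r
  define C where "C h = (\<Sum>j<M - h. z (j + h) * cnj (z j))" for h
  have col: "(\<Sum>m<M + R. v m r) = S" if "r < R" for r
  proof -
    have "(\<Sum>m<M + R. v m r) = (\<Sum>m\<in>{r..<M + r}. v m r)"
      using that by (intro sum.mono_neutral_right) (auto simp: v_def)
    also have "\<dots> = (\<Sum>i\<in>{0..<M}. v (i + r) r)"
      using sum.shift_bounds_nat_ivl[of "\<lambda>m. v m r" 0 r M] by simp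
    also have "\<dots> = S" by (auto simp: S_def v_def lessThan_atLeast0 intro!: sum.cong)
    finally show ?thesis .
  qed
  have cross: "(\<Sum>m<M + R. v m r * cnj (v m (r + h))) = C h" if "r + h < R" for r h
  proof -
    have "(\<Sum>m<M + R. v m r * cnj (v m (r + h))) = (\<Sum>m\<in>{r + h..<(M - h) + (r + h)}. v m r * cnj (v m (r + h)))"
      using that by (intro sum.mono_neutral_right) (auto simp: v_def)
    also have "\<dots> = (\<Sum>i\<in>{0..<M - h}. v (i + (r + h)) r * cnj (v (i + (r + h)) (r + h)))"
      using sum.shift_bounds_nat_ivl[of "\<lambda>m. v m r * cnj (v m (r + h))" 0 "r + h" "M - h"] by simp
    also have "\<dots> = C h"
      unfolding C_def lessThan_atLeast0 by (intro sum.cong) (auto simp: v_def)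
    finally show ?thesis .
  qed
  have C0: "norm (C 0) \<le> real M"
  proof -
    have "norm (C 0) \<le> (\<Sum>j<M. norm (z j * cnj (z j)))" unfolding C_def using norm_sum by simp
    also have "\<dots> \<le> (\<Sum>j<M. 1)" using z by (intro sum_mono) (auto simp: norm_mult intro!: mult_le_one)
    finally show ?thesis by simp
  qed
  have crossn: "norm (\<Sum>m<M + R. v m r * cnj (v m r')) \<le> (if r = r' then real M else B)"
    if rr: "r < R" "r' < R" for r r'
  proof -
    consider "r = r'" | "r < r'" | "r' < r" by linarith
    then show ?thesis
    proof cases
      case 1 then show ?thesis using cross[of r 0] rr C0 by simp
    next
      case 2
      then show ?thesis using cross[of r "r' - r"] B[of "r' - r"] rr by (simp add: C_def)
    next
      case 3
      have "(\<Sum>m<M + R. v m r * cnj (v m r')) = cnj (\<Sum>m<M + R. v m r' * cnj (v m r))"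
        by (simp add: mult.commute)
      also have "norm \<dots> = norm (C (r - r'))" using cross[of r' "r - r'"] 3 rr by simp
      also have "\<dots> \<le> B" unfolding C_def using 3 rr by (intro B) auto
      finally show ?thesis using 3 by simp
    qed
  qed
  have "real R * norm S = norm (\<Sum>r<R. \<Sum>m<M + R. v m r)"
    using col by (simp add: norm_mult)
  also have "\<dots> = norm (\<Sum>m<M + R. \<Sum>r<R. v m r)"
    by (rule arg_cong[where f = norm], rule sum.swap)
  also have "\<dots> \<le> (\<Sum>m<M + R. norm (\<Sum>r<R. v m r))" by (rule norm_sum)
  finally have "(real R * norm S)\<^sup>2 \<le> (\<Sum>m<M + R. norm (\<Sum>r<R. v m r))\<^sup>2"
    by (rule power_mono) auto
  also have "\<dots> = (\<Sum>m<M + R. 1 * norm (\<Sum>r<R. v m r))\<^sup>2" by simp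
  also have "\<dots> \<le> (\<Sum>m<M + R. 1\<^sup>2) * (\<Sum>m<M + R. (norm (\<Sum>r<R. v m r))\<^sup>2)"
    by (rule Cauchy_Schwarz_ineq_sum)
  also have "\<dots> = real (M + R) * (\<Sum>m<M + R. (norm (\<Sum>r<R. v m r))\<^sup>2)" by simp
  also have "(\<Sum>m<M + R. (norm (\<Sum>r<R. v m r))\<^sup>2) \<le> real R * real M + (real R)\<^sup>2 * B"
  proof -
    have "complex_of_real (\<Sum>m<M + R. (norm (\<Sum>r<R. v m r))\<^sup>2)
      = (\<Sum>m<M + R. (\<Sum>r<R. v m r) * cnj (\<Sum>r'<R. v m r'))"
      by (simp only: of_real_sum complex_norm_square)
    also have "\<dots> = (\<Sum>m<M + R. \<Sum>r<R. \<Sum>r'<R. v m r * cnj (v m r'))"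
      by (simp only: sum_product cnj_sum)
    also have "\<dots> = (\<Sum>r<R. \<Sum>m<M + R. \<Sum>r'<R. v m r * cnj (v m r'))" by (rule sum.swap)
    also have "\<dots> = (\<Sum>r<R. \<Sum>r'<R. \<Sum>m<M + R. v m r * cnj (v m r'))"
      by (intro sum.cong refl sum.swap)
    finally have eq: "complex_of_real (\<Sum>m<M + R. (norm (\<Sum>r<R. v m r))\<^sup>2)
      = (\<Sum>r<R. \<Sum>r'<R. \<Sum>m<M + R. v m r * cnj (v m r'))" .
    have nn: "0 \<le> (\<Sum>m<M + R. (norm (\<Sum>r<R. v m r))\<^sup>2)" by (intro sum_nonneg) auto
    have "(\<Sum>m<M + R. (norm (\<Sum>r<R. v m r))\<^sup>2) = norm (complex_of_real (\<Sum>m<M + R. (norm (\<Sum>r<R. v m r))\<^sup>2))"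
      using nn by (simp only: norm_of_real abs_of_nonneg)
    also have "\<dots> \<le> (\<Sum>r<R. \<Sum>r'<R. norm (\<Sum>m<M + R. v m r * cnj (v m r')))"
      unfolding eq by (intro order_trans[OF norm_sum] sum_mono norm_sum)
    also have "\<dots> \<le> (\<Sum>r<R. \<Sum>r'<R. (if r = r' then real M else 0) + B)"
      using crossn B0 by (intro sum_mono) (smt (verit) lessThan_iff of_nat_0_le_iff)
    also have "\<dots> = real R * real M + (real R)\<^sup>2 * B"
      by (simp add: sum.distrib power2_eq_square algebra_simps)
    finally show ?thesis .
  qed
  finally have "(real R)\<^sup>2 * (norm S)\<^sup>2 \<le> real (M + R) * (real R * real M + (real R)\<^sup>2 * B)"
    by (simp add: power_mult_distrib mult_left_mono)
  also have "\<dots> = (real R)\<^sup>2 * (real (M + R) * (real M / real R + B))"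
    using R by (simp add: field_simps power2_eq_square)
  finally show ?thesis using R by (simp add: S_def)
qed

lemma fdiff_funpow_sum_shift:
  "(fdiff ^^ k) (\<lambda>j. \<Sum>i<h. \<phi> (j + i)) j = (\<Sum>i<h. (fdiff ^^ k) \<phi> (j + i))"
proof (induction k arbitrary: \<phi> j)
  case (Suc k)
  have "fdiff (\<lambda>j. \<Sum>i<h. \<phi> (j + i)) = (\<lambda>j. \<Sum>i<h. fdiff \<phi> (j + i))"
    by (simp add: fdiff_def sum_subtractf fun_eq_iff)
  then show ?case using Suc[of "fdiff \<phi>"] by (simp add: funpow_swap1)
qed simp

text \<open>Weyl differencing. Each round lowers the order k by one and takes a square root, which
  halves the exponent of T; \<open>kusmin_landau\<close> at k = 1 saves the full R. A shift h with 0
  < h < R multiplies the size lm by h, so the lower bound lmin persists and the upper condition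
  carries the factor R^(k-1).\<close>

lemma weyl_bound:
  fixes f :: "nat \<Rightarrow> real" and T :: nat
  assumes k: "0 < k" "k \<le> D" and T: "0 < T"
    and R: "R = T ^ (2 ^ (D - 1))" "real R \<le> M0" and lam0: "0 < lmin" "r / lmin \<le> M0 / real R" and r: "1 \<le> r"
    and M: "real M \<le> M0" and lam: "lmin \<le> lm" "r * lm * real R ^ (k - 1) \<le> 1"
    and lo: "\<And>j. j < M \<Longrightarrow> lm \<le> (fdiff ^^ k) f j" and hi: "\<And>j. j < M \<Longrightarrow> (fdiff ^^ k) f j \<le> r * lm"
    and anti: "\<And>j. Suc j < M \<Longrightarrow> (fdiff ^^ k) f (Suc j) \<le> (fdiff ^^ k) f j"
  shows "norm (\<Sum>j<M. cis (f j)) \<le> 8 * M0 / real T ^ (2 ^ (D - k))"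
  using k M lam lo hi anti
proof (induction k arbitrary: f M lm)
  case 0 then show ?case by simp
next
  case (Suc k)
  have R0: "0 < R" using R T by simp
  have M00: "0 < M0" using R(2) R0 by linarith
  show ?case
  proof (cases "k = 0")
    case True
    have "norm (\<Sum>j<M. cis (f j)) \<le> 8 * r / lm"
      using Suc.prems True lam0 r by (intro kusmin_landau) auto
    also have "\<dots> \<le> 8 * r / lmin" using Suc.prems lam0 r by (intro divide_left_mono) auto
    also have "\<dots> \<le> 8 * (M0 / real R)" using lam0 by simp
    finally show ?thesis using R True by simp
  next
    case False
    define B where "B = 8 * M0 / real T ^ (2 ^ (D - k))"
    define Q where "Q = real T ^ (2 ^ (D - Suc k))"
    have Q1: "1 \<le> Q" using T by (simp add: Q_def)
    have QB: "real T ^ (2 ^ (D - k)) = Q\<^sup>2"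
    proof -
      have "D - k = Suc (D - Suc k)" using Suc.prems by simp
      then show ?thesis by (simp add: Q_def power_mult[symmetric] mult.commute)
    qed
    have RQ: "Q\<^sup>2 \<le> real R"
    proof -
      have "(2::nat) ^ (D - k) \<le> 2 ^ (D - 1)" using False by (intro power_increasing) auto
      then have "real T ^ (2 ^ (D - k)) \<le> real T ^ (2 ^ (D - 1))" using T by (intro power_increasing) auto
      then show ?thesis using QB R by simp
    qed
    have inner: "norm (\<Sum>j<M - h. cis (f (j + h)) * cnj (cis (f j))) \<le> B" if h: "0 < h" "h < R" for h
    proof -
      \<comment> \<open>Writing f(j + h) - f(j) as a sum of h first differences transfers the bounds
        and the monotonicity of the (k+1)-st differences of f to the k-th differences of fh.\<close>
      define fh where "fh j = (\<Sum>i<h. fdiff f (j + i))" for j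
      have fh: "fh j = f (j + h) - f j" for j
      proof -
        have "(\<Sum>i<h. f (j + Suc i) - f (j + i)) = f (j + h) - f (j + 0)" by (rule sum_lessThan_telescope)
        then show ?thesis by (simp add: fh_def fdiff_def)
      qed
      have dk: "(fdiff ^^ k) fh j = (\<Sum>i<h. (fdiff ^^ Suc k) f (j + i))" for j
        unfolding fh_def fdiff_funpow_sum_shift by (simp add: funpow_swap1)
      have "norm (\<Sum>j<M - h. cis (fh j)) \<le> 8 * M0 / real T ^ (2 ^ (D - k))"
      proof (rule Suc.IH[where lm = "real h * lm"])
        show "0 < k" using False by simp
        show "k \<le> D" using Suc.prems by simp
        show "real (M - h) \<le> M0" using Suc.prems(3) by linarith
        have "1 * lm \<le> real h * lm" using h Suc.prems lam0 by (intro mult_right_mono) auto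
        then show "lmin \<le> real h * lm" using Suc.prems by simp
        have "r * (real h * lm) * real R ^ (k - 1) \<le> r * (real R * lm) * real R ^ (k - 1)"
          using h Suc.prems lam0 r by (intro mult_right_mono mult_left_mono) auto
        also have "\<dots> = r * lm * real R ^ (Suc k - 1)" using False by (cases k) auto
        also have "\<dots> \<le> 1" using Suc.prems by simp
        finally show "r * (real h * lm) * real R ^ (k - 1) \<le> 1" .
        show "real h * lm \<le> (fdiff ^^ k) fh j" if "j < M - h" for j
        proof -
          have "(\<Sum>i<h. lm) \<le> (\<Sum>i<h. (fdiff ^^ Suc k) f (j + i))"
            using that by (intro sum_mono Suc.prems) auto
          then show ?thesis by (simp only: dk) simp
        qed
        show "(fdiff ^^ k) fh j \<le> r * (real h * lm)" if "j < M - h" for j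
        proof -
          have "(\<Sum>i<h. (fdiff ^^ Suc k) f (j + i)) \<le> (\<Sum>i<h. r * lm)"
            using that by (intro sum_mono Suc.prems) auto
          also have "\<dots> = r * (real h * lm)" by simp
          finally show ?thesis by (simp only: dk)
        qed
        show "(fdiff ^^ k) fh (Suc j) \<le> (fdiff ^^ k) fh j" if "Suc j < M - h" for j
        proof -
          have "(\<Sum>i<h. (fdiff ^^ Suc k) f (Suc (j + i))) \<le> (\<Sum>i<h. (fdiff ^^ Suc k) f (j + i))"
            using that by (intro sum_mono Suc.prems) auto
          then show ?thesis by (simp only: dk add_Suc)
        qed
      qed
      moreover have "cis (f (j + h)) * cnj (cis (f j)) = cis (fh j)" for j
        by (simp add: fh cis_cnj cis_mult)
      ultimately show ?thesis by (simp add: B_def)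
    qed
    have "(norm (\<Sum>j<M. cis (f j)))\<^sup>2 \<le> real (M + R) * (real M / real R + B)"
      using M00 T inner by (intro van_der_corput[OF R0]) (auto simp: B_def)
    also have "\<dots> \<le> (2 * M0) * (M0 / Q\<^sup>2 + 8 * M0 / Q\<^sup>2)"
    proof (intro mult_mono add_mono)
      show "real (M + R) \<le> 2 * M0" using Suc.prems(3) R by simp
      show "real M / real R \<le> M0 / Q\<^sup>2" using Suc.prems(3) RQ Q1 M00 by (intro frac_le) auto
      show "B \<le> 8 * M0 / Q\<^sup>2" by (simp add: B_def QB)
    qed (use M00 in \<open>auto simp: B_def\<close>)
    \<comment> \<open>The constant 8 reproduces itself because 2 (1 + 8) = 18 \<le> 64.\<close>
    also have "\<dots> \<le> (8 * M0 / Q)\<^sup>2" 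
    proof -
      have "(2 * M0) * (M0 / Q\<^sup>2 + 8 * M0 / Q\<^sup>2) = 18 * (M0\<^sup>2 / Q\<^sup>2)"
        by (simp add: power2_eq_square add_divide_distrib[symmetric])
      also have "\<dots> \<le> 64 * (M0\<^sup>2 / Q\<^sup>2)" by (intro mult_right_mono) auto
      finally show ?thesis by (simp add: power_divide power_mult_distrib)
    qed
    finally have "(norm (\<Sum>j<M. cis (f j)))\<^sup>2 \<le> (8 * M0 / Q)\<^sup>2" .
    moreover have "0 \<le> 8 * M0 / Q" using M00 Q1 by simp
    ultimately have "norm (\<Sum>j<M. cis (f j)) \<le> 8 * M0 / Q" by (rule power2_le_imp_le)
    then show ?thesis by (simp add: Q_def)
  qed
qed

section \<open>Logarithmic phases and the sums over a\<close>

definition rdiff :: "(real \<Rightarrow> real) \<Rightarrow> real \<Rightarrow> real" where "rdiff f x = f (x + 1) - f x"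

lemma fdiff_rdiff: "(fdiff ^^ d) (\<lambda>j. F (real j)) j = (rdiff ^^ d) F (real j)"
proof (induction d arbitrary: j)
  case (Suc d)
  then show ?case by (simp add: fdiff_def rdiff_def add.commute)
qed simp

lemma rdiff_deriv:
  fixes G :: "nat \<Rightarrow> real \<Rightarrow> real"
  assumes "\<And>k x. 0 \<le> x \<Longrightarrow> (G k has_real_derivative G (Suc k) x) (at x)" "0 \<le> x"
  shows "((rdiff ^^ d) (G k) has_real_derivative (rdiff ^^ d) (G (Suc k)) x) (at x)"
  using assms(2)
proof (induction d arbitrary: x)
  case 0 then show ?case using assms(1) by simp
next
  case (Suc d)
  have "((\<lambda>y. (rdiff ^^ d) (G k) (y + 1)) has_real_derivative (rdiff ^^ d) (G (Suc k)) (x + 1)) (at x)"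
    using Suc.IH[of "x + 1"] Suc.prems unfolding DERIV_shift[symmetric] by simp
  then have "((\<lambda>y. (rdiff ^^ d) (G k) (y + 1) - (rdiff ^^ d) (G k) y) has_real_derivative
      (rdiff ^^ d) (G (Suc k)) (x + 1) - (rdiff ^^ d) (G (Suc k)) x) (at x)"
    using Suc by (intro DERIV_diff) auto
  then show ?case by (simp add: rdiff_def[abs_def])
qed

text \<open>The mean value theorem trades one difference for one derivative, at the price of letting
  the argument wander by at most 1 each time.\<close>

lemma rdiff_bounds:
  fixes G :: "nat \<Rightarrow> real \<Rightarrow> real"
  assumes G: "\<And>k x. 0 \<le> x \<Longrightarrow> (G k has_real_derivative G (Suc k) x) (at x)" and "0 \<le> x"
    and "\<And>y. x \<le> y \<Longrightarrow> y \<le> x + real d \<Longrightarrow> l \<le> G (k + d) y \<and> G (k + d) y \<le> u"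
  shows "l \<le> (rdiff ^^ d) (G k) x \<and> (rdiff ^^ d) (G k) x \<le> u"
  using assms(2,3)
proof (induction d arbitrary: k x)
  case 0 then show ?case by simp
next
  case (Suc d)
  have "\<exists>z. x < z \<and> z < x + 1 \<and> (rdiff ^^ d) (G k) (x + 1) - (rdiff ^^ d) (G k) x
      = (x + 1 - x) * (rdiff ^^ d) (G (Suc k)) z"
    using Suc.prems(1) by (intro MVT2 rdiff_deriv[of G, OF G]) auto
  then obtain z where z: "x < z" "z < x + 1" "(rdiff ^^ Suc d) (G k) x = (rdiff ^^ d) (G (Suc k)) z"
    by (auto simp: rdiff_def)
  have "l \<le> (rdiff ^^ d) (G (Suc k)) z \<and> (rdiff ^^ d) (G (Suc k)) z \<le> u"
    using z Suc.prems by (intro Suc.IH) auto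
  then show ?case using z by simp
qed

text \<open>The D-th derivative of t ln(c + V x) is, up to sign, t (D - 1)! (V/(c + V x))^D, which
  varies by a factor of at most (A2/A1)^D and is monotone. A2 reaches past the last term because
  iterated differences look ahead.\<close>

lemma log_phase_sum:
  fixes c V t A1 A2 M0 :: real and T R D M :: nat
  assumes D: "0 < D" and T: "0 < T" and R: "R = T ^ (2 ^ (D - 1))" "real R \<le> M0"
    and V: "0 < V" and A: "0 < A1" "A1 \<le> c" "c + V * real (M + D + 1) \<le> A2" and t: "0 < t"
    and M: "real M \<le> M0"
    and up: "t * fact (D - 1) * (V / A1) ^ D * real R ^ (D - 1) \<le> 1"
    and low: "(A2 / A1) ^ D / (t * fact (D - 1) * (V / A2) ^ D) \<le> M0 / real R"
  shows "norm (\<Sum>m<M. cis (t * ln (c + V * real m))) \<le> 8 * M0 / real T"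
proof -
  \<comment> \<open>The sign makes the D-th derivative positive; negating the phase conjugates the
    sum and leaves its norm unchanged.\<close>
  define s :: real where "s = (-1) ^ (D - 1)"
  define G where "G k x = (if k = 0 then s * t * ln (c + V * x)
      else s * t * ((-1) ^ (k - 1) * fact (k - 1) * V ^ k / (c + V * x) ^ k))" for k x
  have ss: "s = 1 \<or> s = -1" by (simp add: s_def power_minus1_even power_minus1_odd minus_one_power_iff)
  have pos: "A1 \<le> c + V * x" "0 < c + V * x" if "0 \<le> x" for x
    using that A V by (smt (verit) mult_nonneg_nonneg)+
  have A2: "A1 \<le> A2" using pos(1)[of "real (M + D + 1)"] A by simp
  have deriv: "(G k has_real_derivative G (Suc k) x) (at x)" if x: "0 \<le> x" for k x
  proof (cases k)
    case 0
    have "((\<lambda>x. s * t * ln (c + V * x)) has_real_derivative s * t * (V / (c + V * x))) (at x)"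
      using pos(2)[OF x] by (auto intro!: derivative_eq_intros)
    then show ?thesis using 0 by (simp add: G_def[abs_def])
  next
    case (Suc j)
    define w where "w = c + V * x"
    have w: "0 < w" using pos(2)[OF x] by (simp add: w_def)
    define K where "K = s * t * ((-1) ^ j * fact j * V ^ Suc j)"
    have "((\<lambda>x. K / (c + V * x) ^ Suc j) has_real_derivative
        (0 * (c + V * x) ^ Suc j - K * (real (Suc j) * (c + V * x) ^ j * V)) / ((c + V * x) ^ Suc j * (c + V * x) ^ Suc j)) (at x)"
      using w by (auto intro!: derivative_eq_intros simp: w_def simp del: power_Suc)
    moreover have "(0 * w ^ Suc j - K * (real (Suc j) * w ^ j * V)) / (w ^ Suc j * w ^ Suc j) = G (Suc (Suc j)) x"
      using w by (simp add: G_def K_def w_def[symmetric] field_simps)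
    moreover have "G k = (\<lambda>x. K / (c + V * x) ^ Suc j)" using Suc by (simp add: G_def[abs_def] K_def)
    ultimately show ?thesis using Suc by (simp add: w_def)
  qed
  define lam where "lam = t * fact (D - 1) * (V / A2) ^ D"
  define r where "r = (A2 / A1) ^ D"
  have lampos: "0 < lam" using t V A A2 by (simp add: lam_def)
  have r1: "1 \<le> r" using A A2 by (simp add: r_def)
  have rl: "r * lam = t * fact (D - 1) * (V / A1) ^ D"
    using A A2 by (simp add: r_def lam_def power_divide)
  have GD: "G D x = t * fact (D - 1) * (V / (c + V * x)) ^ D" for x
    using D ss by (simp add: G_def s_def power_divide mult.assoc[symmetric] power_add[symmetric] flip: power_mult_distrib)
  have bnd: "lam \<le> (rdiff ^^ D) (G 0) x \<and> (rdiff ^^ D) (G 0) x \<le> r * lam" if x: "0 \<le> x" "x \<le> real M" for x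
  proof (rule rdiff_bounds[of G, OF deriv x(1)])
    fix y assume y: "x \<le> y" "y \<le> x + real D"
    have y0: "0 \<le> y" using x y by simp
    have "V * y \<le> V * real (M + D + 1)" using x y V by (intro mult_left_mono) auto
    then have yA: "c + V * y \<le> A2" using A by linarith
    have "(V / A2) ^ D \<le> (V / (c + V * y)) ^ D"
      using yA pos[OF y0] V A by (intro power_mono divide_left_mono) auto
    moreover have "(V / (c + V * y)) ^ D \<le> (V / A1) ^ D"
      using pos[OF y0] V A by (intro power_mono divide_left_mono) auto
    ultimately show "lam \<le> G (0 + D) y \<and> G (0 + D) y \<le> r * lam"
      unfolding rl GD add_0 unfolding lam_def using t by (auto intro!: mult_left_mono)
  qed
  have neg: "(rdiff ^^ Suc D) (G 0) x \<le> 0" if x: "0 \<le> x" for x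
  proof -
    have "G (0 + Suc D) y \<le> 0" if "x \<le> y" for y
    proof -
      have "G (Suc D) y = - (t * (fact D * V ^ Suc D / (c + V * y) ^ Suc D))"
      proof -
        obtain d where d: "D = Suc d" using D by (cases D) auto
        have "s * (-1) ^ D = -1" unfolding s_def d by (simp add: minus_one_power_iff)
        then have "s * t * ((-1) ^ D * fact D * V ^ Suc D / (c + V * y) ^ Suc D)
          = -1 * (t * (fact D * V ^ Suc D / (c + V * y) ^ Suc D))"
          by (metis (no_types, lifting) mult.assoc mult.left_commute times_divide_eq_right)
        then show ?thesis by (simp add: G_def)
      qed
      then show ?thesis using t V pos(2)[of y] x that by simp
    qed
    \<comment> \<open>\<open>rdiff_bounds\<close> asks for a two-sided bound; only the upper bound 0
      matters, and compactness supplies some lower one.\<close>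
    moreover have "\<exists>l. \<forall>y\<in>{x..x + real (Suc D)}. l \<le> G (0 + Suc D) y"
    proof -
      have "continuous_on {x..x + real (Suc D)} (G (Suc D))"
        using x by (intro DERIV_continuous_on[OF has_field_derivative_at_within[OF deriv]]) auto
      then show ?thesis
        using continuous_attains_inf[of "{x..x + real (Suc D)}" "G (Suc D)"] by auto
    qed
    then obtain l where "\<forall>y\<in>{x..x + real (Suc D)}. l \<le> G (0 + Suc D) y" by blast
    ultimately show ?thesis using rdiff_bounds[of G x "Suc D" l 0 0, OF deriv x] by auto
  qed
  define f where "f j = G 0 (real j)" for j :: nat
  have "norm (\<Sum>m<M. cis (f m)) \<le> 8 * M0 / real T ^ (2 ^ (D - D))"
  proof (rule weyl_bound[where k = D and lmin = lam and lm = lam and r = r, OF D _ T R])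
    show "r / lam \<le> M0 / real R" using low by (simp add: r_def lam_def)
    show "r * lam * real R ^ (D - 1) \<le> 1" using up by (simp add: rl)
    show "lam \<le> (fdiff ^^ D) f j" "(fdiff ^^ D) f j \<le> r * lam" if "j < M" for j
      using bnd[of "real j"] that by (auto simp: f_def[abs_def] fdiff_rdiff)
    show "(fdiff ^^ D) f (Suc j) \<le> (fdiff ^^ D) f j" if "Suc j < M" for j
      using neg[of "real j"] by (simp add: f_def[abs_def] fdiff_rdiff rdiff_def add.commute)
  qed (use lampos r1 M in auto)
  moreover have "norm (\<Sum>m<M. cis (f m)) = norm (\<Sum>m<M. cis (t * ln (c + V * real m)))"
    using ss
  proof
    assume "s = -1"
    then have "cis (f m) = cnj (cis (t * ln (c + V * real m)))" for m by (simp add: f_def G_def cis_cnj)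
    then have "(\<Sum>m<M. cis (f m)) = cnj (\<Sum>m<M. cis (t * ln (c + V * real m)))" by simp
    then show ?thesis by (metis complex_mod_cnj)
  qed (simp add: f_def G_def)
  ultimately show ?thesis by simp
qed

text \<open>The sum of a^(-1+it) over a = 1 + W j. The end point 64 J makes the range of a have
  ratio nearly 64, to match frequencies t for which t ln 64 is a multiple of 2 pi.\<close>

definition dirichlet_sum :: "nat \<Rightarrow> nat \<Rightarrow> real \<Rightarrow> complex" where
  "dirichlet_sum W J t = (\<Sum>j\<in>{J..<64 * J}. cis (t * ln (1 + real W * real j)) / of_real (1 + real W * real j))"

lemma norm_cis_taylor: assumes "0 \<le> x" shows "norm (cis x - 1 - \<i> * of_real x) \<le> x\<^sup>2"
proof -
  have 1: "\<bar>cos x - 1\<bar> \<le> x\<^sup>2 / 2"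
  proof -
    have "1 - cos x = 2 * (sin (x / 2))\<^sup>2" using cos_double_sin[of "x / 2"] by simp
    moreover have "(sin (x / 2))\<^sup>2 \<le> (x / 2)\<^sup>2" using abs_sin_x_le_abs_x[of "x / 2"] by (simp only: abs_le_square_iff)
    ultimately have "1 - cos x \<le> x\<^sup>2 / 2" by (simp add: power_divide)
    moreover have "cos x \<le> 1" by simp
    ultimately show ?thesis by linarith
  qed
  have 2: "\<bar>sin x - x\<bar> \<le> x\<^sup>2 / 2"
  proof -
    have "sin x - x \<le> 0" using assms sin_x_le_x by simp
    moreover have "0 - 0 + 0\<^sup>2 / 2 \<le> sin x - x + x\<^sup>2 / 2"
    proof -
      have "sin 0 - 0 + 0\<^sup>2 / 2 \<le> sin x - x + x\<^sup>2 / 2"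
      proof (rule DERIV_nonneg_imp_nondecreasing[OF assms])
        fix y :: real assume y: "0 \<le> y" "y \<le> x"
        have d: "((\<lambda>x. sin x - x + x\<^sup>2 / 2) has_real_derivative cos y - 1 + y) (at y)"
          by (auto intro!: derivative_eq_intros)
        have "0 - sin 0 \<le> y - sin y" using sin_x_le_x[OF y(1)] by simp
        have "cos 0 - 1 + 0 \<le> cos y - 1 + y"
        proof (rule DERIV_nonneg_imp_nondecreasing[OF y(1)])
          fix z :: real assume "0 \<le> z" "z \<le> y"
          have "((\<lambda>y. cos y - 1 + y) has_real_derivative - sin z + 1) (at z)"
            by (auto intro!: derivative_eq_intros)
          moreover have "0 \<le> - sin z + 1" by simp
          ultimately show "\<exists>w. ((\<lambda>y. cos y - 1 + y) has_real_derivative w) (at z) \<and> 0 \<le> w" by blast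
        qed
        then show "\<exists>w. ((\<lambda>x. sin x - x + x\<^sup>2 / 2) has_real_derivative w) (at y) \<and> 0 \<le> w" using d by auto
      qed
      then show ?thesis by simp
    qed
    ultimately show ?thesis by simp
  qed
  have "norm (cis x - 1 - \<i> * of_real x) \<le> \<bar>Re (cis x - 1 - \<i> * of_real x)\<bar> + \<bar>Im (cis x - 1 - \<i> * of_real x)\<bar>"
    by (rule cmod_le)
  also have "\<dots> = \<bar>cos x - 1\<bar> + \<bar>sin x - x\<bar>" by simp
  also have "\<dots> \<le> x\<^sup>2" using 1 2 by linarith
  finally show ?thesis .
qed

text \<open>The increments of a^(it) are nearly i t W times the terms of the sum, so the sum
  telescopes up to second order errors. The condition on t makes the two end values nearly equal,
  which is what gives cancellation even for bounded t.\<close>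

lemma dirichlet_sum_small_t:
  fixes W J u :: nat and t :: real
  assumes W: "0 < W" and J: "0 < J" and t: "0 < t" "t * ln 64 = 2 * pi * real u"
  shows "norm (dirichlet_sum W J t) \<le> (64 * t + 200) / real J"
proof -
  define a where "a j = 1 + real W * real j" for j :: nat
  define w where "w j = cis (t * ln (a j))" for j
  have apos: "0 < a j" for j by (simp add: a_def add_pos_nonneg)
  have aJ: "real W * real J \<le> a j" if "J \<le> j" for j
  proof -
    have "real W * real J \<le> real W * real j" using that by (intro mult_left_mono) auto
    then show ?thesis by (simp add: a_def)
  qed
  have WJ: "0 < real W * real J" using W J by simp
  have step: "norm (w (Suc j) - w j - \<i> * of_real (t * W) * (w j / of_real (a j))) \<le> (t\<^sup>2 + t) / (real J)\<^sup>2"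
    if j: "J \<le> j" for j
  proof -
    define q where "q = real W / a j"
    have q0: "0 < q" using W apos[of j] by (simp add: q_def)
    have qJ: "q \<le> 1 / real J"
    proof -
      have "q \<le> real W / (real W * real J)" unfolding q_def using aJ[OF j] WJ apos[of j] by (intro divide_left_mono) auto
      then show ?thesis using W by simp
    qed
    define \<theta> where "\<theta> = t * ln (1 + q)"
    have l1: "ln (1 + q) \<le> q" using ln_add_one_self_le_self[of q] q0 by simp
    have "1 / real J \<le> 1" using J by simp
    then have "q \<le> 1" using qJ by linarith
    then have l2: "q - q\<^sup>2 \<le> ln (1 + q)" using ln_one_plus_pos_lower_bound[of q] q0 by simp
    have \<theta>0: "0 \<le> \<theta>" using t q0 by (simp add: \<theta>_def)
    have \<theta>1: "\<theta> \<le> t * q" using l1 t by (simp add: \<theta>_def)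
    have "a (Suc j) = a j * (1 + q)" using apos[of j] by (simp add: q_def a_def field_simps)
    then have "ln (a (Suc j)) = ln (a j) + ln (1 + q)" using apos[of j] q0 by (simp add: ln_mult)
    then have "w (Suc j) = w j * cis \<theta>" by (simp add: w_def \<theta>_def cis_mult distrib_left)
    then have "w (Suc j) - w j - \<i> * of_real (t * W) * (w j / of_real (a j))
        = w j * ((cis \<theta> - 1 - \<i> * of_real \<theta>) + \<i> * of_real (\<theta> - t * q))"
      by (simp add: q_def algebra_simps)
    also have "norm \<dots> = norm ((cis \<theta> - 1 - \<i> * of_real \<theta>) + \<i> * of_real (\<theta> - t * q))" by (simp add: norm_mult w_def)
    also have "\<dots> \<le> norm (cis \<theta> - 1 - \<i> * of_real \<theta>) + norm (\<i> * of_real (\<theta> - t * q))" by (rule norm_triangle_ineq)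
    also have "norm (\<i> * of_real (\<theta> - t * q)) = \<bar>\<theta> - t * q\<bar>" by (simp only: norm_mult norm_ii norm_of_real mult_1)
    also have "norm (cis \<theta> - 1 - \<i> * of_real \<theta>) \<le> \<theta>\<^sup>2" by (rule norm_cis_taylor[OF \<theta>0])
    also have "\<theta>\<^sup>2 \<le> (t * q)\<^sup>2" using \<theta>0 \<theta>1 by (intro power_mono) auto
    also have "\<bar>\<theta> - t * q\<bar> \<le> t * q\<^sup>2"
    proof -
      have "t * (q - q\<^sup>2) \<le> \<theta>" unfolding \<theta>_def using l2 t by (intro mult_left_mono) auto
      then show ?thesis using \<theta>1 by (simp add: algebra_simps)
    qed
    also have "(t * q)\<^sup>2 + t * q\<^sup>2 = (t\<^sup>2 + t) * q\<^sup>2" by (simp add: algebra_simps power_mult_distrib)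
    also have "\<dots> \<le> (t\<^sup>2 + t) * (1 / real J)\<^sup>2"
      using qJ q0 t by (intro mult_left_mono power_mono) auto
    finally show ?thesis by (simp add: power_divide)
  qed
  define N where "N = 64 * J"
  have JN: "J \<le> N" by (simp add: N_def)
  have "(\<Sum>j\<in>{J..<N}. w (Suc j) - w j) = w N - w J" by (rule sum_Suc_diff'[OF JN])
  then have eqn: "\<i> * of_real (t * W) * dirichlet_sum W J t = (w N - w J) -
      (\<Sum>j\<in>{J..<N}. w (Suc j) - w j - \<i> * of_real (t * W) * (w j / of_real (a j)))"
    by (simp add: dirichlet_sum_def sum_subtractf sum_distrib_left N_def w_def a_def)
  have "norm (\<i> * of_real (t * W) * dirichlet_sum W J t) \<le> norm (w N - w J) +
      norm (\<Sum>j\<in>{J..<N}. w (Suc j) - w j - \<i> * of_real (t * W) * (w j / of_real (a j)))"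
    unfolding eqn by (rule norm_triangle_ineq4)
  also have "norm (\<Sum>j\<in>{J..<N}. w (Suc j) - w j - \<i> * of_real (t * W) * (w j / of_real (a j))) \<le>
      (\<Sum>j\<in>{J..<N}. norm (w (Suc j) - w j - \<i> * of_real (t * W) * (w j / of_real (a j))))"
    by (rule norm_sum)
  also have "(\<Sum>j\<in>{J..<N}. norm (w (Suc j) - w j - \<i> * of_real (t * W) * (w j / of_real (a j))))
      \<le> (\<Sum>j\<in>{J..<N}. (t\<^sup>2 + t) / (real J)\<^sup>2)" using step by (intro sum_mono) auto
  also have "\<dots> = 63 * (t\<^sup>2 + t) / real J" using J by (simp add: N_def power2_eq_square)
  also have "norm (w N - w J) \<le> t / real J"
  proof -
    \<comment> \<open>Multiplying a by exactly 64 does not change the phase; what remains is the gap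
      between 64 (1 + W J) and 1 + 64 W J.\<close>
    have "t * ln (64 * a J) = t * ln (a J) + 2 * pi * real u"
      using apos[of J] t(2) by (simp add: ln_mult distrib_left)
    then have "cis (t * ln (64 * a J)) = w J"
      by (simp add: w_def cis_mult[symmetric])
    then have "norm (w N - w J) = norm (cis (t * ln (a N)) - cis (t * ln (64 * a J)))" by (simp add: w_def)
    also have "\<dots> \<le> \<bar>t * ln (a N) - t * ln (64 * a J)\<bar>" by (rule norm_cis_diff_le)
    also have "\<dots> = t * \<bar>ln (64 * a J) - ln (a N)\<bar>" using t by (simp add: abs_mult right_diff_distrib[symmetric] abs_minus_commute)
    also have "\<bar>ln (64 * a J) - ln (a N)\<bar> \<le> 1 / real J"
    proof -
      have eq: "64 * a J = a N * (1 + 63 / a N)" using apos[of N] by (simp add: field_simps a_def N_def)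
      have "ln (64 * a J) - ln (a N) = ln (1 + 63 / a N)"
      proof -
        have "0 < 1 + 63 / a N" using apos[of N] by (simp add: add_pos_pos)
        then show ?thesis unfolding eq using apos[of N] by (simp add: ln_mult)
      qed
      moreover have "0 \<le> ln (1 + 63 / a N)" using apos[of N] by simp
      moreover have "ln (1 + 63 / a N) \<le> 63 / a N" using apos[of N] by (intro ln_add_one_self_le_self) simp
      moreover have "63 / a N \<le> 63 / (64 * real J)"
      proof (rule divide_left_mono)
        have "1 * real (64 * J) \<le> real W * real (64 * J)" using W by (intro mult_right_mono) auto
        then show "64 * real J \<le> a N" by (simp add: a_def N_def)
      qed (use J apos[of N] in auto)
      moreover have "63 / (64 * real J) \<le> 1 / real J" using J by (simp add: field_simps)
      ultimately show ?thesis by linarith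
    qed
    finally show ?thesis using t by (simp add: mult_left_mono)
  qed
  finally have "t * real W * norm (dirichlet_sum W J t) \<le> t / real J + 63 * (t\<^sup>2 + t) / real J"
    using t by (simp add: norm_mult)
  also have "\<dots> = t * ((64 + 63 * t) / real J)" using J by (simp add: field_simps power2_eq_square)
  finally have 1: "real W * norm (dirichlet_sum W J t) \<le> (64 + 63 * t) / real J" using t
    by (simp only: mult.assoc mult_le_cancel_left_pos)
  have "1 * norm (dirichlet_sum W J t) \<le> real W * norm (dirichlet_sum W J t)" using W by (intro mult_right_mono) auto
  also note 1
  also have "(64 + 63 * t) / real J \<le> (64 * t + 200) / real J" using t by (intro divide_right_mono) auto
  finally show ?thesis by simp
qed

text \<open>Abel's inequality, used to strip the decreasing weights 1/a from the pure phase
  sums.\<close>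

lemma abel_weight_bound:
  fixes z :: "nat \<Rightarrow> complex" and u :: "nat \<Rightarrow> real"
  assumes part: "\<And>m. m \<le> M \<Longrightarrow> norm (\<Sum>j<m. z j) \<le> B"
    and dec: "\<And>j. u (Suc j) \<le> u j" and nn: "\<And>j. 0 \<le> u j"
  shows "norm (\<Sum>j<M. of_real (u j) * z j) \<le> u 0 * B"
proof -
  define S where "S m = (\<Sum>j<m. z j)" for m
  have B0: "0 \<le> B" using part[of 0] by simp
  have id: "(\<Sum>j<m. of_real (u j) * z j) = of_real (u m) * S m + (\<Sum>j<m. of_real (u j - u (Suc j)) * S (Suc j))" for m
    by (induction m) (simp_all add: S_def algebra_simps)
  have "norm (\<Sum>j<M. of_real (u j) * z j) \<le> norm (of_real (u M) * S M) + norm (\<Sum>j<M. of_real (u j - u (Suc j)) * S (Suc j))"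
    unfolding id by (rule norm_triangle_ineq)
  also have "\<dots> \<le> u M * B + (\<Sum>j<M. (u j - u (Suc j)) * B)"
  proof (intro add_mono order_trans[OF norm_sum] sum_mono)
    show "norm (of_real (u M) * S M) \<le> u M * B"
      using nn[of M] part[of M] by (simp add: norm_mult S_def mult_left_mono)
    show "norm (of_real (u j - u (Suc j)) * S (Suc j)) \<le> (u j - u (Suc j)) * B" if "j \<in> {..<M}" for j
      using dec[of j] part[of "Suc j"] that unfolding norm_mult norm_of_real S_def
      by (intro mult_mono) auto
  qed
  also have "(\<Sum>j<M. (u j - u (Suc j)) * B) = (u 0 - u M) * B"
    by (simp only: sum_distrib_right[symmetric] sum_lessThan_telescope')
  also have "u M * B + (u 0 - u M) * B = u 0 * B" by (simp add: algebra_simps)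
  finally show ?thesis .
qed

lemma sum_residue_classes:
  fixes f :: "nat \<Rightarrow> 'a :: comm_monoid_add"
  assumes "0 < s"
  shows "(\<Sum>x<N. f x) = (\<Sum>i<s. \<Sum>m<(N + s - 1 - i) div s. f (i + s * m))"
proof -
  \<comment> \<open>The limit is (N - i)/s rounded up, which counts the m with i + s m < N.\<close>
  have iff: "m < (N + s - 1 - i) div s \<longleftrightarrow> i + s * m < N" if "i < s" for i m
  proof -
    have "m < (N + s - 1 - i) div s \<longleftrightarrow> Suc m \<le> (N + s - 1 - i) div s" by auto
    also have "\<dots> \<longleftrightarrow> Suc m * s \<le> N + s - 1 - i" using assms by (rule less_eq_div_iff_mult_less_eq)
    also have "\<dots> \<longleftrightarrow> i + s * m < N" using that by (auto simp: algebra_simps)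
    finally show ?thesis .
  qed
  have "(\<Sum>i<s. \<Sum>m<(N + s - 1 - i) div s. f (i + s * m))
      = (\<Sum>(i, m)\<in>(SIGMA i:{..<s}. {..<(N + s - 1 - i) div s}). f (i + s * m))"
    by (rule sum.Sigma) auto
  also have "\<dots> = (\<Sum>x<N. f x)"
  proof (rule sum.reindex_bij_witness[where i = "\<lambda>x. (x mod s, x div s)" and j = "\<lambda>(i, m). i + s * m"])
    fix p assume "p \<in> (SIGMA i:{..<s}. {..<(N + s - 1 - i) div s})"
    then obtain i m where p: "p = (i, m)" "i < s" "i + s * m < N" using iff by auto
    show "((case p of (i, m) \<Rightarrow> i + s * m) mod s, (case p of (i, m) \<Rightarrow> i + s * m) div s) = p" using p by simp
    show "(case p of (i, m) \<Rightarrow> i + s * m) \<in> {..<N}" using p by simp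
    show "f (case p of (i, m) \<Rightarrow> i + s * m) = (case p of (i, m) \<Rightarrow> f (i + s * m))" using p by simp
  next
    fix x assume "x \<in> {..<N}"
    then show "(x mod s, x div s) \<in> (SIGMA i:{..<s}. {..<(N + s - 1 - i) div s})"
      using iff[of "x mod s" "x div s"] assms by simp
  qed auto
  finally show ?thesis by simp
qed

lemma powr_power_nat: "0 < x \<Longrightarrow> (x powr a) ^ n = x powr (a * real n)" for x :: real
proof (induction n)
  case (Suc n)
  have "(x powr a) ^ Suc n = x powr a * x powr (a * real n)" using Suc by simp
  also have "\<dots> = x powr (a + a * real n)" by (simp only: powr_add)
  finally show ?case by (simp add: algebra_simps)
qed simp

text \<open>The sum is split into progressions of step s about J/Q, so that the ratio V/c is about
  1/Q and the D-th difference has size about t Q^(-D) = Q^(-1/2), up to constants, whatever t is.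
  This lies between 1 and the reciprocal of the length, about 64 Q. The exponent \<theta> makes R at
  most Q^(1/(8 D)), so all powers of R that occur stay below Q^(1/8).\<close>

lemma dirichlet_sum_large_t:
  fixes W D :: nat
  assumes W: "0 < W" and D: "2 \<le> D"
  shows "\<exists>J0. \<forall>J\<ge>J0. \<forall>Q t. t = Q powr (real D - 1 / 2) \<and> real J powr (1 / 4) \<le> Q \<and> Q \<le> real J powr (1 / 2)
    \<longrightarrow> norm (dirichlet_sum W J t) \<le> 1024 * real J powr (- 1 / (16 * real D * 2 ^ D))"
proof -
  define \<theta> :: real where "\<theta> = 1 / (4 * real D * 2 ^ D)"
  have \<theta>: "0 < \<theta>" using D by (simp add: \<theta>_def)
  have "eventually (\<lambda>Q::real. 2 \<le> Q powr \<theta> \<and> fact (D - 1) * Q powr (1/8) \<le> Q powr (1/2) \<and>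
      32768 ^ D * Q powr (1/8) \<le> 64 * Q powr (1/2) \<and> 1 \<le> Q) at_top"
    using \<theta> by (intro eventually_conj; real_asymp)
  then obtain Q0 where Q0: "\<And>Q. Q \<ge> Q0 \<Longrightarrow> 2 \<le> Q powr \<theta> \<and> fact (D - 1) * Q powr (1/8) \<le> Q powr (1/2) \<and>
      32768 ^ D * Q powr (1/8) \<le> 64 * Q powr (1/2) \<and> 1 \<le> Q"
    unfolding eventually_at_top_linorder by blast
  have "eventually (\<lambda>J::nat. Q0 \<le> real J powr (1/4) \<and> real J powr (3/4) * (real D + 2) \<le> real J \<and>
      2 * real J powr (1/2) \<le> real J \<and> 1 \<le> J) at_top"
    by (intro eventually_conj; real_asymp)
  then obtain J0 where J0: "\<And>J. J \<ge> J0 \<Longrightarrow> Q0 \<le> real J powr (1/4) \<and> real J powr (3/4) * (real D + 2) \<le> real J \<and>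
      2 * real J powr (1/2) \<le> real J \<and> 1 \<le> J"
    unfolding eventually_at_top_linorder by blast
  show ?thesis
  proof (intro exI allI impI)
    fix J :: nat and Q t :: real
    assume "J0 \<le> J" and Qt: "t = Q powr (real D - 1 / 2) \<and> real J powr (1 / 4) \<le> Q \<and> Q \<le> real J powr (1 / 2)"
    note J = J0[OF \<open>J0 \<le> J\<close>]
    have Q: "2 \<le> Q powr \<theta>" "fact (D - 1) * Q powr (1/8) \<le> Q powr (1/2)"
      "32768 ^ D * Q powr (1/8) \<le> 64 * Q powr (1/2)" "1 \<le> Q"
      using Q0[of Q] J Qt by auto
    have Qpos: "0 < Q" using Q by simp
    have Jpos: "0 < real J" using J by simp
    have tpos: "0 < t" using Qt Qpos by simp
    define s where "s = nat \<lfloor>real J / Q\<rfloor>"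
    have JQ: "2 \<le> real J / Q"
    proof -
      have "2 * Q \<le> 2 * real J powr (1/2)" using Qt by simp
      also have "\<dots> \<le> real J" using J by simp
      finally show ?thesis using Qpos by (simp add: field_simps)
    qed
    have s1: "real s \<le> real J / Q" "real J / Q - 1 < real s" using JQ unfolding s_def by linarith+
    have s2: "real J / Q \<le> 2 * real s" using s1 JQ by linarith
    have spos: "0 < s" using s1 JQ by linarith
    have sQ: "real s / real J \<le> 1 / Q" "1 / (2 * Q) \<le> real s / real J"
      using s1 s2 Jpos Qpos by (simp_all add: field_simps)
    define M0 where "M0 = 64 * real J / real s"
    have M0Q: "64 * Q \<le> M0"
      using s1 spos Qpos by (simp add: M0_def field_simps)
    have sJ: "real s * (real D + 2) \<le> real J"
    proof -
      have "real J / Q \<le> real J / real J powr (1/4)"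
        using Qt Jpos Qpos by (intro divide_left_mono) auto
      also have "\<dots> = real J powr (3/4)" using powr_diff[of "real J" 1 "1/4"] Jpos by simp
      finally have "real s \<le> real J powr (3/4)" using s1 by simp
      then have "real s * (real D + 2) \<le> real J powr (3/4) * (real D + 2)" by (intro mult_right_mono) auto
      then show ?thesis using J by linarith
    qed
    define T where "T = nat \<lfloor>Q powr \<theta>\<rfloor>"
    have T1: "real T \<le> Q powr \<theta>" "Q powr \<theta> - 1 < real T" using Q(1) unfolding T_def by linarith+
    have T2: "Q powr \<theta> \<le> 2 * real T" using T1 Q(1) by linarith
    have Tpos: "0 < T" using T1 Q(1) by linarith
    define R where "R = T ^ (2 ^ (D - 1))"
    have RQ: "real R \<le> Q powr (1 / (8 * real D))"
    proof -
      have "real R \<le> (Q powr \<theta>) ^ (2 ^ (D - 1))" unfolding R_def using T1 by (simp add: power_mono)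
      also have "\<dots> = Q powr (\<theta> * real (2 ^ (D - 1)))" by (rule powr_power_nat[OF Qpos])
      also have "\<theta> * real (2 ^ (D - 1)) = 1 / (8 * real D)"
      proof -
        have "(2::real) ^ D = 2 * 2 ^ (D - 1)" using D by (cases D) auto
        then show ?thesis using D by (simp add: \<theta>_def)
      qed
      finally show ?thesis .
    qed
    have R1: "1 \<le> real R" using Tpos by (simp add: R_def)
    have RD: "real R ^ D \<le> Q powr (1/8)"
    proof -
      have "real R ^ D \<le> (Q powr (1 / (8 * real D))) ^ D" using RQ by (intro power_mono) auto
      also have "\<dots> = Q powr (1 / (8 * real D) * real D)" by (rule powr_power_nat[OF Qpos])
      finally show ?thesis using D by simp
    qed
    have RDm: "real R ^ (D - 1) \<le> Q powr (1/8)" "real R \<le> Q powr (1/8)"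
    proof -
      have "real R ^ (D - 1) \<le> real R ^ D" "real R ^ 1 \<le> real R ^ D"
        using R1 D by (intro power_increasing; simp)+
      then show "real R ^ (D - 1) \<le> Q powr (1/8)" "real R \<le> Q powr (1/8)"
        using RD unfolding power_one_right by (meson order_trans)+
    qed
    \<comment> \<open>The tuned size of the D-th difference: half a power of Q away from 1 and from
      1/Q.\<close>
    have tQ: "t * (1 / Q) ^ D = Q powr (- 1/2)"
    proof -
      have "(1 / Q) ^ D = Q powr (- real D)" using Qpos by (simp add: powr_minus powr_realpow power_one_over inverse_eq_divide)
      then have "t * (1 / Q) ^ D = Q powr (real D - 1/2 + (- real D))" using Qt by (simp only: powr_add)
      then show ?thesis by simp
    qed
    have Qhalf: "Q powr (1/2) * Q powr (- 1/2) = 1" using Qpos by (simp add: powr_add[symmetric])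
    have up: "t * fact (D - 1) * (real (W * s) / (real W * real J)) ^ D * real R ^ (D - 1) \<le> 1"
    proof -
      have "t * fact (D - 1) * (real (W * s) / (real W * real J)) ^ D * real R ^ (D - 1)
          = t * fact (D - 1) * (real s / real J) ^ D * real R ^ (D - 1)" using W by simp
      also have "\<dots> \<le> t * fact (D - 1) * (1 / Q) ^ D * Q powr (1/8)"
        using tpos sQ RDm Qpos by (intro mult_mono power_mono mult_nonneg_nonneg) auto
      also have "\<dots> = fact (D - 1) * Q powr (1/8) * (t * (1 / Q) ^ D)" by simp
      also have "\<dots> \<le> Q powr (1/2) * Q powr (- 1/2)" unfolding tQ using Q by (intro mult_right_mono) auto
      finally show ?thesis using Qhalf by simp
    qed
    have low: "((128 * real W * real J) / (real W * real J)) ^ D / (t * fact (D - 1) * (real (W * s) / (128 * real W * real J)) ^ D) \<le> M0 / real R"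
    proof -
      have "(1 / (256 * Q)) ^ D \<le> (real s / (128 * real J)) ^ D"
      proof (rule power_mono)
        have "1 / (256 * Q) = (1 / (2 * Q)) / 128" by simp
        also have "\<dots> \<le> (real s / real J) / 128" using sQ(2) by (rule divide_right_mono) simp
        finally show "1 / (256 * Q) \<le> real s / (128 * real J)" by (simp add: mult.commute)
      qed (use Qpos in simp)
      also have "real s / (128 * real J) = real (W * s) / (128 * real W * real J)" using W by simp
      finally have ge: "t * 1 * (1 / (256 * Q)) ^ D \<le> t * fact (D - 1) * (real (W * s) / (128 * real W * real J)) ^ D"
        using tpos Qpos by (intro mult_mono) (auto simp: fact_ge_1)
      have num: "((128 * real W * real J) / (real W * real J)) ^ D = 128 ^ D" using W Jpos by simp
      have posA: "0 < t * 1 * (1 / (256 * Q)) ^ D" using tpos Qpos by simp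
      have "((128 * real W * real J) / (real W * real J)) ^ D / (t * fact (D - 1) * (real (W * s) / (128 * real W * real J)) ^ D)
          \<le> 128 ^ D / (t * 1 * (1 / (256 * Q)) ^ D)"
        unfolding num by (rule divide_left_mono[OF ge _ mult_pos_pos[OF less_le_trans[OF posA ge] posA]]) simp
      \<comment> \<open>32768 = 128 * 256: the ratio 128 of the range, and once more 128 times 2
        from rounding the step s down.\<close>
      also have "\<dots> = 32768 ^ D / (t * (1 / Q) ^ D)"
      proof -
        have "(1 / (256 * Q)) ^ D = (1 / Q) ^ D / 256 ^ D" by (simp add: power_divide power_mult_distrib)
        moreover have "(32768::real) ^ D = 128 ^ D * 256 ^ D" by (simp add: power_mult_distrib[symmetric])
        ultimately show ?thesis by simp
      qed
      also have "\<dots> = 32768 ^ D * Q powr (1/2)" unfolding tQ using Qhalf Qpos by (simp only: divide_eq_eq mult.assoc) simp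
      also have "\<dots> \<le> M0 / real R"
      proof -
        have "32768 ^ D * Q powr (1/2) * real R \<le> 32768 ^ D * Q powr (1/2) * Q powr (1/8)"
          using RDm by (intro mult_left_mono) auto
        also have "\<dots> = Q powr (1/2) * (32768 ^ D * Q powr (1/8))" by simp
        also have "\<dots> \<le> Q powr (1/2) * (64 * Q powr (1/2))" using Q by (intro mult_left_mono) auto
        also have "\<dots> = 64 * Q" using Qpos by (simp add: powr_add[symmetric])
        also have "\<dots> \<le> M0" by (rule M0Q)
        finally show ?thesis using R1 by (simp add: field_simps)
      qed
      finally show ?thesis .
    qed
    have RM0: "real R \<le> M0"
    proof -
      have "Q powr (1/8) \<le> Q powr 1" using Q by (intro powr_mono) auto
      then show ?thesis using RDm M0Q Q by simp
    qed
    have phase: "norm (\<Sum>m<M. cis (t * ln (1 + real W * real (J + i) + real (W * s) * real m))) \<le> 8 * M0 / real T"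
      if i: "i < s" and M: "real M \<le> M0" for i M
    proof (rule log_phase_sum[where ?A1.0 = "real W * real J" and ?A2.0 = "128 * real W * real J" and D = D, OF _ Tpos R_def RM0])
      show "0 < D" using D by simp
      show "0 < real (W * s)" using W spos by simp
      show "0 < real W * real J" using W Jpos by simp
      show "real W * real J \<le> 1 + real W * real (J + i)" by (simp add: distrib_left)
      have sM: "real s * (real M + real D + 1) \<le> 65 * real J"
      proof -
        have "real s * real M \<le> real s * M0" using M by (intro mult_left_mono) auto
        also have "\<dots> = 64 * real J" using spos by (simp add: M0_def)
        finally show ?thesis using sJ spos by (simp add: algebra_simps)
      qed
      have "real W * (real s * (real M + real D + 1)) \<le> real W * (65 * real J)"
        using sM by (rule mult_left_mono) simp
      then have "real (W * s) * real (M + D + 1) \<le> 65 * (real W * real J)" by (simp add: mult_ac add_ac)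
      moreover have "real W * real (J + i) \<le> 2 * (real W * real J)"
      proof -
        have "real s \<le> real J" using sJ mult_left_mono[of 1 "real D + 2" "real s"] by simp
        then have "real (J + i) \<le> 2 * real J" using i by simp
        then have "real W * real (J + i) \<le> real W * (2 * real J)" by (rule mult_left_mono) simp
        then show ?thesis by (simp add: mult_ac)
      qed
      moreover have "1 * 1 \<le> real W * real J" using W J by (intro mult_mono) auto
      moreover have "128 * real W * real J = 128 * (real W * real J)" by simp
      moreover have "0 \<le> real W * real J" by simp
      ultimately show "1 + real W * real (J + i) + real (W * s) * real (M + D + 1) \<le> 128 * real W * real J"
        by linarith
    qed (use tpos M up low in auto)
    define a where "a j = 1 + real W * real j" for j :: nat
    have apos: "0 < a j" for j by (simp add: a_def add_pos_nonneg)
    have a_mono: "a x \<le> a y" if "x \<le> y" for x y using that by (simp add: a_def mult_left_mono)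
    have "dirichlet_sum W J t = (\<Sum>x<63 * J. cis (t * ln (a (J + x))) / of_real (a (J + x)))"
      using sum.shift_bounds_nat_ivl[of "\<lambda>j. cis (t * ln (a j)) / of_real (a j)" 0 J "63 * J"]
      by (simp add: dirichlet_sum_def a_def[symmetric] lessThan_atLeast0 add.commute)
    also have "\<dots> = (\<Sum>i<s. \<Sum>m<(63 * J + s - 1 - i) div s. cis (t * ln (a (J + (i + s * m)))) / of_real (a (J + (i + s * m))))"
      by (rule sum_residue_classes[OF spos])
    finally have eq: "dirichlet_sum W J t = (\<Sum>i<s. \<Sum>m<(63 * J + s - 1 - i) div s.
        of_real (1 / a (J + (i + s * m))) * cis (t * ln (a (J + (i + s * m)))))"
      by (simp add: divide_inverse mult.commute)
    have each: "norm (\<Sum>m<(63 * J + s - 1 - i) div s. of_real (1 / a (J + (i + s * m))) * cis (t * ln (a (J + (i + s * m)))))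
        \<le> 1 / (real W * real J) * (8 * M0 / real T)" if i: "i < s" for i
    proof -
      have Mle: "real ((63 * J + s - 1 - i) div s) \<le> M0"
      proof -
        have "real ((63 * J + s - 1 - i) div s) \<le> real (63 * J + s) / real s"
          by (rule order_trans[OF of_nat_div_le_of_nat]) (auto intro!: divide_right_mono)
        also have "\<dots> \<le> M0" unfolding M0_def
        proof (rule divide_right_mono)
          have "real s \<le> real J" using sJ mult_left_mono[of 1 "real D + 2" "real s"] by simp
          then show "real (63 * J + s) \<le> 64 * real J" by simp
        qed simp
        finally show ?thesis .
      qed
      have "norm (\<Sum>m<(63 * J + s - 1 - i) div s. of_real (1 / a (J + (i + s * m))) * cis (t * ln (a (J + (i + s * m)))))
          \<le> 1 / a (J + (i + s * 0)) * (8 * M0 / real T)"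
      proof (rule abel_weight_bound[where u = "\<lambda>m. 1 / a (J + (i + s * m))"
            and z = "\<lambda>m. cis (t * ln (a (J + (i + s * m))))"])
        fix m assume "m \<le> (63 * J + s - 1 - i) div s"
        then have "real m \<le> M0" using Mle by linarith
        from phase[OF i this] show "norm (\<Sum>j<m. cis (t * ln (a (J + (i + s * j))))) \<le> 8 * M0 / real T"
          by (simp add: a_def algebra_simps)
      next
        fix j
        show "1 / a (J + (i + s * Suc j)) \<le> 1 / a (J + (i + s * j))"
          using apos by (intro divide_left_mono a_mono mult_pos_pos) auto
        show "0 \<le> 1 / a (J + (i + s * j))" using apos[of "J + (i + s * j)"] by simp
      qed
      also have "\<dots> \<le> 1 / (real W * real J) * (8 * M0 / real T)"
      proof (rule mult_right_mono)
        show "1 / a (J + (i + s * 0)) \<le> 1 / (real W * real J)"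
        proof (rule divide_left_mono)
          have "real W * real J \<le> a J" by (simp add: a_def)
          also have "a J \<le> a (J + (i + s * 0))" by (rule a_mono) simp
          finally show "real W * real J \<le> a (J + (i + s * 0))" .
          show "0 < a (J + (i + s * 0)) * (real W * real J)" using apos W Jpos by (intro mult_pos_pos) auto
        qed simp
      qed (simp add: M0_def)
      finally show ?thesis .
    qed
    have "norm (dirichlet_sum W J t) \<le> (\<Sum>i<s. 1 / (real W * real J) * (8 * M0 / real T))"
      unfolding eq by (rule order_trans[OF norm_sum sum_mono]) (rule each, simp)
    also have "\<dots> = 512 / (real W * real T)" using spos Jpos by (simp add: M0_def)
    also have "\<dots> \<le> 512 / (1 * real T)" using W Tpos by (intro divide_left_mono mult_right_mono) auto
    also have "\<dots> = 1024 / (2 * real T)" by simp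
    also have "\<dots> \<le> 1024 / Q powr \<theta>" using Tpos Q(1) by (intro divide_left_mono[OF T2] mult_pos_pos) auto
    also have "\<dots> \<le> 1024 / (real J powr (1/4)) powr \<theta>"
      using Qt \<theta> Jpos by (intro divide_left_mono powr_mono2 mult_pos_pos) auto
    also have "\<dots> = 1024 * real J powr (- 1 / (16 * real D * 2 ^ D))"
    proof -
      have e: "1 / 4 * \<theta> = 1 / (16 * real D * 2 ^ D)" by (simp add: \<theta>_def)
      have "(real J powr (1/4)) powr \<theta> = real J powr (1 / (16 * real D * 2 ^ D))" by (simp only: powr_powr e)
      then show ?thesis using powr_minus_divide[of "real J" "1 / (16 * real D * 2 ^ D)"] by simp
    qed
    finally show "norm (dirichlet_sum W J t) \<le> 1024 * real J powr (- 1 / (16 * real D * 2 ^ D))" .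
  qed
qed

text \<open>Write t = J^e. For e \<le> 1/2 the telescoping estimate suffices; beyond that D is
  chosen from e so that Q lies between J^(1/4) and J^(1/2). As e \<le> E only finitely many D occur,
  and the largest one fixes the saving.\<close>

lemma dirichlet_sum_bound:
  fixes W :: nat and E :: real
  assumes W: "0 < W" and E: "1 \<le> E"
  shows "\<exists>\<eta>>0. \<exists>J0. \<forall>J\<ge>J0. \<forall>t (u::nat). 0 < t \<and> t \<le> real J powr E \<and> t * ln 64 = 2 * pi * real u
    \<longrightarrow> norm (dirichlet_sum W J t) \<le> 1024 * real J powr (- \<eta>)"
proof -
  define Dm where "Dm = nat \<lceil>2 * E + 1 / 2\<rceil>"
  define \<eta> where "\<eta> = 1 / (16 * real Dm * 2 ^ Dm)"
  have Dm2: "3 \<le> Dm" using E unfolding Dm_def by linarith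
  have "1 * 1 \<le> real Dm * 2 ^ Dm" using Dm2 by (intro mult_mono) auto
  then have "1 / (16 * (real Dm * 2 ^ Dm)) \<le> 1 / 16" by (intro divide_left_mono) auto
  then have \<eta>: "0 < \<eta>" "\<eta> \<le> 1/2" using Dm2 by (auto simp: \<eta>_def mult.assoc)
  have "\<forall>D. \<exists>J0. 2 \<le> D \<longrightarrow> (\<forall>J\<ge>J0. \<forall>Q t. t = Q powr (real D - 1 / 2) \<and> real J powr (1 / 4) \<le> Q \<and> Q \<le> real J powr (1 / 2)
    \<longrightarrow> norm (dirichlet_sum W J t) \<le> 1024 * real J powr (- 1 / (16 * real D * 2 ^ D)))"
    using dirichlet_sum_large_t[OF W] by blast
  then obtain J0 where J0: "\<And>D J Q t. 2 \<le> D \<Longrightarrow> J0 D \<le> J \<Longrightarrow> t = Q powr (real D - 1 / 2) \<Longrightarrow> real J powr (1 / 4) \<le> Q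
    \<Longrightarrow> Q \<le> real J powr (1 / 2) \<Longrightarrow> norm (dirichlet_sum W J t) \<le> 1024 * real J powr (- 1 / (16 * real D * 2 ^ D))"
    by metis
  define J1 where "J1 = Max (insert 2 (J0 ` {2..Dm}))"
  show ?thesis
  proof (intro exI[of _ \<eta>] conjI exI[of _ J1] allI impI)
    show "0 < \<eta>" by fact
    fix J :: nat and t :: real and u :: nat
    assume J: "J1 \<le> J" and tt: "0 < t \<and> t \<le> real J powr E \<and> t * ln 64 = 2 * pi * real u"
    have J2: "2 \<le> J" using J unfolding J1_def by (simp add: Max_ge_iff)
    have JD: "J0 D \<le> J" if "D \<in> {2..Dm}" for D
      using J that unfolding J1_def by (meson Max_ge finite.insertI finite_atLeastAtMost finite_imageI image_eqI insertCI order_trans)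
    have Jr: "1 < real J" using J2 by simp
    show "norm (dirichlet_sum W J t) \<le> 1024 * real J powr (- \<eta>)"
    proof (cases "t \<le> real J powr (1/2)")
      case True
      have "norm (dirichlet_sum W J t) \<le> (64 * t + 200) / real J"
        using dirichlet_sum_small_t[OF W, of J t u] tt J2 by auto
      also have "\<dots> \<le> (264 * real J powr (1/2)) / real J"
      proof (rule divide_right_mono)
        have "1 \<le> real J powr (1/2)" using Jr by (simp add: ge_one_powr_ge_zero)
        then show "64 * t + 200 \<le> 264 * real J powr (1/2)" using True by linarith
      qed simp
      also have "\<dots> = 264 * real J powr (- 1/2)" using Jr powr_diff[of "real J" "1/2" 1] by simp
      also have "\<dots> \<le> 1024 * real J powr (- \<eta>)"
        using Jr \<eta> by (intro mult_mono powr_mono) auto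
      finally show ?thesis .
    next
      case False
      define e where "e = ln t / ln (real J)"
      have lnJ: "0 < ln (real J)" using Jr by simp
      have te: "t = real J powr e" using tt Jr lnJ by (simp add: e_def powr_def)
      have e1: "1/2 < e" using False te Jr by (metis not_le powr_le_cancel_iff)
      have e2: "e \<le> E" using tt te Jr by (metis powr_le_cancel_iff)
      define D where "D = nat \<lceil>2 * e + 1/2\<rceil>"
      have D1: "2 * e + 1/2 \<le> real D" "real D < 2 * e + 3/2" using e1 unfolding D_def by linarith+
      have D2: "2 \<le> D" using D1 e1 by linarith
      have "\<lceil>2 * e + 1/2\<rceil> \<le> \<lceil>2 * E + 1/2\<rceil>" using e2 by (intro ceiling_mono) simp
      then have DDm: "D \<le> Dm" unfolding D_def Dm_def by (rule nat_mono)
      \<comment> \<open>D - 1/2 lies between 2 e and 4 e, the upper bound because e > 1/2; so e/k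
        lies between 1/4 and 1/2.\<close>
      define k where "k = real D - 1/2"
      have k: "0 < k" "2 * e \<le> k" "k \<le> 4 * e" using D1 e1 by (auto simp: k_def)
      define Q where "Q = real J powr (e / k)"
      have "t = Q powr (real D - 1/2)" using te k by (simp add: Q_def powr_powr k_def[symmetric])
      moreover have "real J powr (1/4) \<le> Q" unfolding Q_def using Jr k e1 by (intro powr_mono) (auto simp: field_simps)
      moreover have "Q \<le> real J powr (1/2)" unfolding Q_def using Jr k by (intro powr_mono) (auto simp: field_simps)
      ultimately have "norm (dirichlet_sum W J t) \<le> 1024 * real J powr (- 1 / (16 * real D * 2 ^ D))"
        using J0[OF D2 JD] D2 DDm by simp
      also have "\<dots> \<le> 1024 * real J powr (- \<eta>)"
      proof (intro mult_left_mono powr_mono)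
        have "16 * real D * 2 ^ D \<le> 16 * real Dm * 2 ^ Dm" using DDm by (intro mult_mono power_increasing) auto
        then have "\<eta> \<le> 1 / (16 * real D * 2 ^ D)" unfolding \<eta>_def using D2 DDm by (intro divide_left_mono mult_pos_pos) auto
        then show "- 1 / (16 * real D * 2 ^ D) \<le> - \<eta>" by simp
      qed (use Jr in auto)
      finally show ?thesis .
    qed
  qed
qed

section \<open>A Fejer kernel large sieve\<close>

text \<open>Normalized to mean 1 and maximum K. Written as a square it is visibly nonnegative, and
  expanding the square gives frequencies k - l with the Fejer weights as multiplicities.\<close>

definition fejer :: "nat \<Rightarrow> real \<Rightarrow> real" where
  "fejer K x = (norm (\<Sum>k<K. cis (real k * x)))\<^sup>2 / real K"

lemma fejer_nonneg: "0 \<le> fejer K x" by (simp add: fejer_def)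

lemma fejer_minus: "fejer K (- x) = fejer K x"
proof -
  have "(\<Sum>k<K. cis (real k * - x)) = cnj (\<Sum>k<K. cis (real k * x))" by (simp add: cis_cnj)
  then have "norm (\<Sum>k<K. cis (real k * - x)) = norm (\<Sum>k<K. cis (real k * x))" by (metis complex_mod_cnj)
  then show ?thesis by (simp add: fejer_def)
qed

lemma fejer_expand:
  "complex_of_real (fejer K x) = (\<Sum>k<K. \<Sum>l<K. cis ((real k - real l) * x)) / of_nat K"
proof -
  have "complex_of_real ((norm (\<Sum>k<K. cis (real k * x)))\<^sup>2)
      = (\<Sum>k<K. cis (real k * x)) * cnj (\<Sum>l<K. cis (real l * x))" by (rule complex_norm_square)
  also have "\<dots> = (\<Sum>k<K. \<Sum>l<K. cis (real k * x) * cnj (cis (real l * x)))" by (simp only: cnj_sum sum_product)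
  also have "\<dots> = (\<Sum>k<K. \<Sum>l<K. cis ((real k - real l) * x))" by (simp add: cis_cnj cis_mult left_diff_distrib)
  finally show ?thesis by (simp add: fejer_def)
qed

lemma fejer_le_K: "fejer K x \<le> real K"
proof (cases "K = 0")
  case False
  have "norm (\<Sum>k<K. cis (real k * x)) \<le> (\<Sum>k<K. norm (cis (real k * x)))" by (rule norm_sum)
  then have "norm (\<Sum>k<K. cis (real k * x)) \<le> real K" by simp
  then have "(norm (\<Sum>k<K. cis (real k * x)))\<^sup>2 \<le> (real K)\<^sup>2" by (rule power_mono) simp
  then show ?thesis using False by (simp add: fejer_def field_simps power2_eq_square)
qed (simp add: fejer_def)

lemma fejer_le_inverse:
  assumes "cis x \<noteq> 1"
  shows "fejer K x \<le> 4 / (real K * (norm (cis x - 1))\<^sup>2)"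
proof -
  have "(\<Sum>k<K. cis (real k * x)) = (\<Sum>k<K. cis x ^ k)"
    by (intro sum.cong refl) (rule Complex.DeMoivre[symmetric])
  also have "\<dots> = (cis x ^ K - 1) / (cis x - 1)" using geometric_sum[OF assms] by simp
  finally have "norm (\<Sum>k<K. cis (real k * x)) = norm (cis x ^ K - 1) / norm (cis x - 1)" by (simp add: norm_divide)
  also have "\<dots> \<le> 2 / norm (cis x - 1)"
  proof (rule divide_right_mono)
    have "norm (cis x ^ K - 1) \<le> norm (cis x ^ K) + norm (1::complex)" by (rule norm_triangle_ineq4)
    then show "norm (cis x ^ K - 1) \<le> 2" by (simp add: norm_power)
  qed simp
  finally have "(norm (\<Sum>k<K. cis (real k * x)))\<^sup>2 \<le> (2 / norm (cis x - 1))\<^sup>2" by (rule power_mono) simp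
  then have "fejer K x \<le> (2 / norm (cis x - 1))\<^sup>2 / real K" unfolding fejer_def by (rule divide_right_mono) simp
  then show ?thesis by (simp add: power_divide mult.commute)
qed

text \<open>The left side of the bound is measured in periods. The limit 5/6 is ln 32 / ln 64, the
  largest distance that numbers within a factor 32 can have; the next zero is at distance 1, and at
  5/6 the chord still has length 1.\<close>

lemma norm_cis_minus_one_period:
  fixes y :: real
  assumes "\<bar>y\<bar> \<le> 5 / 6"
  shows "\<bar>y\<bar> \<le> norm (cis (2 * pi * y) - 1)"
proof -
  have sq: "(norm (cis (2 * pi * y) - 1))\<^sup>2 = (2 * sin (pi * y))\<^sup>2"
  proof -
    have "(norm (cis (2 * pi * y) - 1))\<^sup>2 = (cos (2 * pi * y) - 1)\<^sup>2 + (sin (2 * pi * y))\<^sup>2" by (simp add: cmod_power2)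
    also have "\<dots> = 2 - 2 * cos (2 * (pi * y))"
      using sin_cos_squared_add[of "2 * pi * y"] by (simp add: power2_diff mult.assoc)
    also have "\<dots> = 4 * (sin (pi * y))\<^sup>2" by (simp only: cos_double_sin) simp
    finally show ?thesis by (simp add: power_mult_distrib)
  qed
  have n: "norm (cis (2 * pi * y) - 1) = 2 * \<bar>sin (pi * y)\<bar>"
  proof (rule power2_eq_imp_eq)
    show "(norm (cis (2 * pi * y) - 1))\<^sup>2 = (2 * \<bar>sin (pi * y)\<bar>)\<^sup>2"
      unfolding sq by (simp add: power_mult_distrib)
  qed simp_all
  define s where "s = \<bar>y\<bar>"
  have s: "0 \<le> s" "s \<le> 5/6" using assms by (auto simp: s_def)
  have abs: "\<bar>sin (pi * y)\<bar> = \<bar>sin (pi * s)\<bar>" unfolding s_def by (cases "0 \<le> y") auto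
  have "s / 2 \<le> sin (pi * s)"
  proof (cases "pi * s \<le> 1")
    case True
    have "sin 0 - 0 / 2 \<le> sin (pi * s) - (pi * s) / 2"
    proof (rule DERIV_nonneg_imp_nondecreasing[of 0 "pi * s" "\<lambda>x. sin x - x / 2"])
      show "0 \<le> pi * s" using s by simp
      fix x :: real assume x: "0 \<le> x" "x \<le> pi * s"
      have "cos (pi / 3) \<le> cos x" using x True pi_gt3 by (intro cos_monotone_0_pi_le) auto
      then have "0 \<le> cos x - 1 / 2" by (simp add: cos_60)
      moreover have "((\<lambda>x. sin x - x / 2) has_real_derivative cos x - 1 / 2) (at x)"
        by (auto intro!: derivative_eq_intros)
      ultimately show "\<exists>y. ((\<lambda>x. sin x - x / 2) has_real_derivative y) (at x) \<and> 0 \<le> y" by blast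
    qed
    then have "pi * s / 2 \<le> sin (pi * s)" by simp
    moreover have "1 * s \<le> pi * s" using pi_gt3 s by (intro mult_right_mono) auto
    ultimately show ?thesis by simp
  next
    case False
    have "pi * s \<le> 4 * s" using pi_less_4 s by (intro mult_right_mono) auto
    then have "1 / 6 \<le> s" using False by linarith
    then have pis: "pi * (1 / 6) \<le> pi * s" by (intro mult_left_mono) auto
    have "1 / 2 \<le> sin (pi * s)"
    proof (cases "pi * s \<le> pi / 2")
      case True
      have "sin (pi / 6) \<le> sin (pi * s)"
        using True pis pi_gt3 by (intro sin_monotone_2pi_le) auto
      then show ?thesis by (simp add: sin_30)
    next
      case gt: False
      have "pi * s \<le> pi * (5 / 6)" using s by (intro mult_left_mono) auto
      then have "sin (pi / 6) \<le> sin (pi - pi * s)" using gt pi_gt3 by (intro sin_monotone_2pi_le) auto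
      then show ?thesis by (simp add: sin_30)
    qed
    then show ?thesis using s by simp
  qed
  then show ?thesis using n abs by (simp add: s_def)
qed

text \<open>After splitting by sign, points of mutual distance at least l fall into different cells
  of length l, so the sum is dominated by one over multiples of l.\<close>

lemma spaced_sum_bound:
  fixes V :: "real set" and l H :: real
  assumes fin: "finite V" and l: "0 < l" and H: "0 < H"
    and sp: "\<And>x y. x \<in> V \<Longrightarrow> y \<in> V \<Longrightarrow> x \<noteq> y \<Longrightarrow> l \<le> \<bar>x - y\<bar>"
  shows "(\<Sum>v\<in>V. 1 / (v\<^sup>2 + H\<^sup>2)) \<le> 2 / H\<^sup>2 + 4 / (l * H)"
proof -
  have one: "(\<Sum>v\<in>V. 1 / (v\<^sup>2 + H\<^sup>2)) \<le> 1 / H\<^sup>2 + 2 / (l * H)"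
    if fin: "finite V" and sp: "\<And>x y. x \<in> V \<Longrightarrow> y \<in> V \<Longrightarrow> x \<noteq> y \<Longrightarrow> l \<le> \<bar>x - y\<bar>" and nn: "\<And>v. v \<in> V \<Longrightarrow> 0 \<le> v" for V
  proof -
    define k where "k v = nat \<lfloor>v / l\<rfloor>" for v
    have kv: "real (k v) \<le> v / l" "v / l < real (k v) + 1" if "v \<in> V" for v
    proof -
      have "0 \<le> v / l" using nn[OF that] l by simp
      then show "real (k v) \<le> v / l" "v / l < real (k v) + 1" unfolding k_def by linarith+
    qed
    have inj: "inj_on k V"
    proof (rule inj_onI, rule ccontr)
      fix x y assume xy: "x \<in> V" "y \<in> V" "k x = k y" "x \<noteq> y"
      have "\<bar>x / l - y / l\<bar> < 1" using kv[OF xy(1)] kv[OF xy(2)] xy(3) by linarith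
      then have "\<bar>x - y\<bar> < l" using l by (simp add: diff_divide_distrib[symmetric] abs_divide)
      then show False using sp[OF xy(1,2,4)] by simp
    qed
    define g where "g i = 1 / ((real i * l)\<^sup>2 + H\<^sup>2)" for i :: nat
    have "(\<Sum>v\<in>V. 1 / (v\<^sup>2 + H\<^sup>2)) \<le> (\<Sum>v\<in>V. g (k v))"
    proof (rule sum_mono)
      fix v assume v: "v \<in> V"
      have "real (k v) * l \<le> v" using kv(1)[OF v] l by (simp add: field_simps)
      then have "(real (k v) * l)\<^sup>2 \<le> v\<^sup>2" using l by (intro power_mono) auto
      then show "1 / (v\<^sup>2 + H\<^sup>2) \<le> g (k v)" unfolding g_def using H
        by (intro divide_left_mono mult_pos_pos add_nonneg_pos) auto
    qed
    also have "\<dots> = (\<Sum>i\<in>k ` V. g i)" using inj by (simp add: sum.reindex)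
    also have "\<dots> \<le> (\<Sum>i<Suc (Max (insert 0 (k ` V))). g i)"
      using fin H by (intro sum_mono2) (auto simp: less_Suc_eq_le g_def)
    also have "\<dots> \<le> 1 / H\<^sup>2 + 2 / (l * H)"
    proof -
      \<comment> \<open>A telescoping majorant: 1/(u^2 + H^2) \<le> 2/(u + H)^2, and the latter is
        bounded by a difference of reciprocals.\<close>
      have "(\<Sum>i<Suc N. g i) \<le> 1 / H\<^sup>2 + 2 / l * (1 / H - 1 / (real N * l + H))" for N
      proof (induction N)
        case 0 then show ?case using H by (simp add: g_def)
      next
        case (Suc N)
        define x where "x = real N * l + H"
        have x: "0 < x" using H l by (simp add: x_def add_nonneg_pos)
        have xs: "real (Suc N) * l + H = x + l" by (simp add: x_def algebra_simps)
        have "g (Suc N) \<le> 2 / (x + l)\<^sup>2"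
        proof -
          have "(x + l)\<^sup>2 \<le> 2 * ((real (Suc N) * l)\<^sup>2 + H\<^sup>2)"
            unfolding xs[symmetric] using sum_squares_bound[of "real (Suc N) * l" H] by (simp add: power2_sum)
          then have "1 / ((real (Suc N) * l)\<^sup>2 + H\<^sup>2) \<le> 1 / ((x + l)\<^sup>2 / 2)"
            using x l H by (intro divide_left_mono mult_pos_pos) (auto intro!: add_nonneg_pos)
          then show ?thesis by (simp add: g_def)
        qed
        also have "\<dots> \<le> 2 / l * (1 / x - 1 / (x + l))"
        proof -
          have "1 / x - 1 / (x + l) = l / (x * (x + l))" using x l by (simp add: field_simps)
          then have "2 / l * (1 / x - 1 / (x + l)) = 2 / (x * (x + l))" using l by simp
          moreover have "2 / (x + l)\<^sup>2 \<le> 2 / (x * (x + l))"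
            using x l by (intro divide_left_mono mult_pos_pos) (auto simp: power2_eq_square)
          ultimately show ?thesis by simp
        qed
        finally have gS: "g (Suc N) \<le> 2 / l * (1 / x - 1 / (x + l))" .
        have IH: "(\<Sum>i<Suc N. g i) \<le> 1 / H\<^sup>2 + 2 / l * (1 / H - 1 / x)" using Suc by (simp only: x_def)
        have "(\<Sum>i<Suc (Suc N). g i) = (\<Sum>i<Suc N. g i) + g (Suc N)" by simp
        also have "\<dots> \<le> 1 / H\<^sup>2 + 2 / l * (1 / H - 1 / x) + 2 / l * (1 / x - 1 / (x + l))" using IH gS by (rule add_mono)
        also have "\<dots> = 1 / H\<^sup>2 + 2 / l * (1 / H - 1 / (x + l))" by (simp add: algebra_simps)
        finally show ?case by (simp only: xs)
      qed
      note bd = this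
      have "2 / l * (1 / H - 1 / (real N * l + H)) \<le> 2 / (l * H)" for N
      proof -
        have "0 \<le> 1 / (real N * l + H)" using H l by simp
        then have "2 / l * (1 / H - 1 / (real N * l + H)) \<le> 2 / l * (1 / H)" using l by (intro mult_left_mono) auto
        then show ?thesis by simp
      qed
      from bd[of "Max (insert 0 (k ` V))"] this[of "Max (insert 0 (k ` V))"] show ?thesis by linarith
    qed
    finally show ?thesis .
  qed
  let ?P = "{v \<in> V. 0 \<le> v}" and ?N = "{v \<in> V. v < 0}"
  have "(\<Sum>v\<in>V. 1 / (v\<^sup>2 + H\<^sup>2)) = (\<Sum>v\<in>?P. 1 / (v\<^sup>2 + H\<^sup>2)) + (\<Sum>v\<in>?N. 1 / (v\<^sup>2 + H\<^sup>2))"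
    using fin by (subst sum.union_disjoint[symmetric]) (auto intro!: sum.cong)
  also have "(\<Sum>v\<in>?N. 1 / (v\<^sup>2 + H\<^sup>2)) = (\<Sum>v\<in>uminus ` ?N. 1 / (v\<^sup>2 + H\<^sup>2))"
    by (subst sum.reindex) (auto simp: inj_on_def)
  also have "(\<Sum>v\<in>?P. 1 / (v\<^sup>2 + H\<^sup>2)) \<le> 1 / H\<^sup>2 + 2 / (l * H)" using fin sp by (intro one) auto
  also have "(\<Sum>v\<in>uminus ` ?N. 1 / (v\<^sup>2 + H\<^sup>2)) \<le> 1 / H\<^sup>2 + 2 / (l * H)"
  proof (rule one)
    show "finite (uminus ` ?N)" using fin by simp
    fix x y assume "x \<in> uminus ` ?N" "y \<in> uminus ` ?N" "x \<noteq> y"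
    then have "l \<le> \<bar>(- x) - (- y)\<bar>" by (intro sp) auto
    then show "l \<le> \<bar>x - y\<bar>" by (simp add: abs_minus_commute)
  qed auto
  finally show ?thesis by (simp add: algebra_simps)
qed

text \<open>In the expansion of the kernel the pairs k = l give the main term. For the others the
  sum over A is at most \<eta>, and Cauchy-Schwarz over the pairs separates E from P; each resulting
  mean square folds back into a double sum of kernels.\<close>

lemma fejer_bilinear:
  fixes xe :: "'e \<Rightarrow> real" and xa :: "'a \<Rightarrow> real" and xp :: "'p \<Rightarrow> real" and u :: "'a \<Rightarrow> real"
  assumes K: "0 < K" and \<eta>: "0 \<le> \<eta>" and fin: "finite A" "finite E" "finite P"
    and small: "\<And>d. 0 < d \<Longrightarrow> d < K \<Longrightarrow> norm (\<Sum>a\<in>A. of_real (u a) * cis (real d * xa a)) \<le> \<eta>"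
  shows "real (card E) * real (card P) * (\<Sum>a\<in>A. u a) -
      \<eta> * sqrt (\<Sum>e\<in>E. \<Sum>f\<in>E. fejer K (xe e - xe f)) * sqrt (\<Sum>p\<in>P. \<Sum>q\<in>P. fejer K (xp p - xp q))
    \<le> (\<Sum>e\<in>E. \<Sum>a\<in>A. \<Sum>p\<in>P. u a * fejer K (xe e - xa a - xp p))"
proof -
  define Eh where "Eh \<delta> = (\<Sum>e\<in>E. cis (\<delta> * xe e))" for \<delta> :: real
  define Ph where "Ph \<delta> = (\<Sum>p\<in>P. cis (\<delta> * xp p))" for \<delta> :: real
  define Ah where "Ah \<delta> = (\<Sum>a\<in>A. of_real (u a) * cis (\<delta> * xa a))" for \<delta> :: real
  define \<delta> where "\<delta> z = real (fst z) - real (snd z)" for z :: "nat \<times> nat"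
  define Z where "Z = {..<K} \<times> {..<K}"
  have finZ: "finite Z" by (simp add: Z_def)
  have fx: "complex_of_real (real K * fejer K x) = (\<Sum>z\<in>Z. cis (\<delta> z * x))" for x
    using fejer_expand[of K x] K by (simp add: Z_def \<delta>_def sum.cartesian_product case_prod_beta)
  have conj: "cnj (Ah d) = Ah (- d)" for d by (simp add: Ah_def cis_cnj)
  have Asmall: "norm (Ah (\<delta> z)) \<le> \<eta>" if z: "z \<in> Z" "fst z \<noteq> snd z" for z
  proof (cases "snd z < fst z")
    case True
    then have "\<delta> z = real (fst z - snd z)" by (simp add: \<delta>_def)
    moreover have "fst z - snd z < K" using z by (auto simp: Z_def)
    ultimately show ?thesis using small[of "fst z - snd z"] True by (simp add: Ah_def)
  next
    case False
    then have "snd z - fst z > 0" "snd z - fst z < K" using z by (auto simp: Z_def)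
    moreover have "- \<delta> z = real (snd z - fst z)" using False by (simp add: \<delta>_def)
    ultimately have "norm (Ah (- \<delta> z)) \<le> \<eta>" using small[of "snd z - fst z"] by (simp add: Ah_def)
    then show ?thesis using conj[of "\<delta> z"] by (metis complex_mod_cnj)
  qed
  \<comment> \<open>The expansion read backwards: mean squares over frequency pairs are sums of the
    kernel over differences.\<close>
  have quad: "(\<Sum>z\<in>Z. (norm (\<Sum>x\<in>S. cis (\<delta> z * h x)))\<^sup>2) = real K * (\<Sum>x\<in>S. \<Sum>y\<in>S. fejer K (h x - h y))"
    for S :: "'s set" and h :: "'s \<Rightarrow> real"
  proof -
    have "complex_of_real (\<Sum>z\<in>Z. (norm (\<Sum>x\<in>S. cis (\<delta> z * h x)))\<^sup>2)
        = (\<Sum>z\<in>Z. \<Sum>x\<in>S. \<Sum>y\<in>S. cis (\<delta> z * (h x - h y)))"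
      by (simp only: of_real_sum complex_norm_square cnj_sum sum_product cis_cnj cis_mult right_diff_distrib)
         (simp add: cis_cnj cis_mult)
    also have "\<dots> = (\<Sum>x\<in>S. \<Sum>z\<in>Z. \<Sum>y\<in>S. cis (\<delta> z * (h x - h y)))" by (rule sum.swap)
    also have "\<dots> = (\<Sum>x\<in>S. \<Sum>y\<in>S. \<Sum>z\<in>Z. cis (\<delta> z * (h x - h y)))" by (intro sum.cong refl sum.swap)
    also have "\<dots> = complex_of_real (real K * (\<Sum>x\<in>S. \<Sum>y\<in>S. fejer K (h x - h y)))"
      unfolding fx[symmetric] by (simp only: of_real_sum sum_distrib_left)
    finally show ?thesis by (simp only: of_real_eq_iff)
  qed
  define TT where "TT = (\<Sum>e\<in>E. \<Sum>a\<in>A. \<Sum>p\<in>P. u a * fejer K (xe e - xa a - xp p))"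
  have main: "complex_of_real (real K * TT) = (\<Sum>z\<in>Z. Eh (\<delta> z) * cnj (Ah (\<delta> z)) * cnj (Ph (\<delta> z)))"
  proof -
    have "complex_of_real (real K * TT)
        = (\<Sum>e\<in>E. \<Sum>a\<in>A. \<Sum>p\<in>P. of_real (u a) * complex_of_real (real K * fejer K (xe e - xa a - xp p)))"
      by (simp add: TT_def sum_distrib_left mult_ac)
    also have "\<dots> = (\<Sum>e\<in>E. \<Sum>a\<in>A. \<Sum>p\<in>P. \<Sum>z\<in>Z. of_real (u a) * cis (\<delta> z * (xe e - xa a - xp p)))"
      by (simp only: fx sum_distrib_left)
    also have "\<dots> = (\<Sum>e\<in>E. \<Sum>a\<in>A. \<Sum>z\<in>Z. \<Sum>p\<in>P. of_real (u a) * cis (\<delta> z * (xe e - xa a - xp p)))"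
      by (intro sum.cong refl sum.swap)
    also have "\<dots> = (\<Sum>e\<in>E. \<Sum>z\<in>Z. \<Sum>a\<in>A. \<Sum>p\<in>P. of_real (u a) * cis (\<delta> z * (xe e - xa a - xp p)))"
      by (intro sum.cong refl sum.swap)
    also have "\<dots> = (\<Sum>z\<in>Z. \<Sum>e\<in>E. \<Sum>a\<in>A. \<Sum>p\<in>P. of_real (u a) * cis (\<delta> z * (xe e - xa a - xp p)))"
      by (rule sum.swap)
    also have "\<dots> = (\<Sum>z\<in>Z. Eh (\<delta> z) * cnj (Ah (\<delta> z)) * cnj (Ph (\<delta> z)))"
    proof (intro sum.cong refl)
      fix z
      have "Eh (\<delta> z) * cnj (Ah (\<delta> z)) * cnj (Ph (\<delta> z))
        = (\<Sum>e\<in>E. \<Sum>a\<in>A. \<Sum>p\<in>P. cis (\<delta> z * xe e) * (of_real (u a) * cis (- (\<delta> z * xa a))) * cis (- (\<delta> z * xp p)))"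
      proof -
        have "Eh (\<delta> z) * cnj (Ah (\<delta> z)) = (\<Sum>e\<in>E. \<Sum>a\<in>A. cis (\<delta> z * xe e) * (of_real (u a) * cis (- (\<delta> z * xa a))))"
          unfolding Eh_def Ah_def cnj_sum sum_product by (simp add: cis_cnj)
        moreover have "cnj (Ph (\<delta> z)) = (\<Sum>p\<in>P. cis (- (\<delta> z * xp p)))" by (simp add: Ph_def cis_cnj)
        ultimately have "Eh (\<delta> z) * cnj (Ah (\<delta> z)) * cnj (Ph (\<delta> z))
          = (\<Sum>e\<in>E. \<Sum>a\<in>A. cis (\<delta> z * xe e) * (of_real (u a) * cis (- (\<delta> z * xa a))) * (\<Sum>p\<in>P. cis (- (\<delta> z * xp p))))"
          by (simp only: sum_distrib_right)
        then show ?thesis by (simp only: sum_distrib_left)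
      qed
      also have "\<dots> = (\<Sum>e\<in>E. \<Sum>a\<in>A. \<Sum>p\<in>P. of_real (u a) * cis (\<delta> z * (xe e - xa a - xp p)))"
      proof (intro sum.cong refl)
        fix e a p
        have "cis (\<delta> z * xe e) * cis (- (\<delta> z * xa a)) * cis (- (\<delta> z * xp p)) = cis (\<delta> z * (xe e - xa a - xp p))"
          by (simp add: cis_mult algebra_simps)
        then show "cis (\<delta> z * xe e) * (of_real (u a) * cis (- (\<delta> z * xa a))) * cis (- (\<delta> z * xp p))
            = of_real (u a) * cis (\<delta> z * (xe e - xa a - xp p))" by (metis mult.assoc mult.left_commute)
      qed
      finally show "(\<Sum>e\<in>E. \<Sum>a\<in>A. \<Sum>p\<in>P. of_real (u a) * cis (\<delta> z * (xe e - xa a - xp p)))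
          = Eh (\<delta> z) * cnj (Ah (\<delta> z)) * cnj (Ph (\<delta> z))" by simp
    qed
    finally show ?thesis .
  qed
  let ?diag = "{z \<in> Z. fst z = snd z}" and ?off = "{z \<in> Z. fst z \<noteq> snd z}"
  let ?f = "\<lambda>z. Eh (\<delta> z) * cnj (Ah (\<delta> z)) * cnj (Ph (\<delta> z))"
  have split: "(\<Sum>z\<in>Z. ?f z) = (\<Sum>z\<in>?diag. ?f z) + (\<Sum>z\<in>?off. ?f z)"
    using finZ by (subst sum.union_disjoint[symmetric]) (auto intro!: sum.cong)
  have cdiag: "card ?diag = K"
  proof -
    have "?diag = (\<lambda>k. (k, k)) ` {..<K}" by (auto simp: Z_def)
    then show ?thesis by (simp add: card_image inj_on_def)
  qed
  have "(\<Sum>z\<in>?diag. ?f z) = (\<Sum>z\<in>?diag. of_real (real (card E) * real (card P) * (\<Sum>a\<in>A. u a)))"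
    by (intro sum.cong refl) (simp add: \<delta>_def Eh_def Ah_def Ph_def)
  then have diag: "(\<Sum>z\<in>?diag. ?f z) = of_real (real K * (real (card E) * real (card P) * (\<Sum>a\<in>A. u a)))"
    by (simp add: cdiag)
  have "norm (\<Sum>z\<in>?off. ?f z) \<le> (\<Sum>z\<in>?off. norm (Eh (\<delta> z)) * \<eta> * norm (Ph (\<delta> z)))"
    using Asmall by (intro order_trans[OF norm_sum] sum_mono) (auto simp: norm_mult \<eta> intro!: mult_mono mult_nonneg_nonneg)
  also have "\<dots> \<le> (\<Sum>z\<in>Z. norm (Eh (\<delta> z)) * \<eta> * norm (Ph (\<delta> z)))"
    using finZ \<eta> by (intro sum_mono2) auto
  also have "\<dots> = \<eta> * (\<Sum>z\<in>Z. norm (Eh (\<delta> z)) * norm (Ph (\<delta> z)))" by (simp add: sum_distrib_left mult_ac)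
  also have "(\<Sum>z\<in>Z. norm (Eh (\<delta> z)) * norm (Ph (\<delta> z))) \<le> sqrt ((\<Sum>z\<in>Z. (norm (Eh (\<delta> z)))\<^sup>2) * (\<Sum>z\<in>Z. (norm (Ph (\<delta> z)))\<^sup>2))"
    by (rule real_le_rsqrt) (rule Cauchy_Schwarz_ineq_sum)
  also have "\<dots> = real K * (sqrt (\<Sum>e\<in>E. \<Sum>f\<in>E. fejer K (xe e - xe f)) * sqrt (\<Sum>p\<in>P. \<Sum>q\<in>P. fejer K (xp p - xp q)))"
    unfolding Eh_def Ph_def quad by (simp add: real_sqrt_mult)
  finally have off: "norm (\<Sum>z\<in>?off. ?f z) \<le> \<eta> * (real K * (sqrt (\<Sum>e\<in>E. \<Sum>f\<in>E. fejer K (xe e - xe f)) * sqrt (\<Sum>p\<in>P. \<Sum>q\<in>P. fejer K (xp p - xp q))))"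
    using \<eta> by (simp add: mult_left_mono)
  have "complex_of_real (real K * TT) - of_real (real K * (real (card E) * real (card P) * (\<Sum>a\<in>A. u a))) = (\<Sum>z\<in>?off. ?f z)"
    unfolding main split diag by simp
  then have "norm (complex_of_real (real K * TT - real K * (real (card E) * real (card P) * (\<Sum>a\<in>A. u a)))) = norm (\<Sum>z\<in>?off. ?f z)"
    by simp
  then have "\<bar>real K * TT - real K * (real (card E) * real (card P) * (\<Sum>a\<in>A. u a))\<bar> = norm (\<Sum>z\<in>?off. ?f z)"
    by (simp only: norm_of_real)
  then have "real K * (real (card E) * real (card P) * (\<Sum>a\<in>A. u a)) - \<eta> * (real K * (sqrt (\<Sum>e\<in>E. \<Sum>f\<in>E. fejer K (xe e - xe f)) * sqrt (\<Sum>p\<in>P. \<Sum>q\<in>P. fejer K (xp p - xp q)))) \<le> real K * TT"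
    using off by linarith
  then have "real K * (real (card E) * real (card P) * (\<Sum>a\<in>A. u a) - \<eta> * sqrt (\<Sum>e\<in>E. \<Sum>f\<in>E. fejer K (xe e - xe f)) * sqrt (\<Sum>p\<in>P. \<Sum>q\<in>P. fejer K (xp p - xp q))) \<le> real K * TT"
    by (simp add: algebra_simps)
  then show ?thesis using K by (simp add: TT_def)
qed

section \<open>Kernel sums over logarithms of spaced numbers, with period ln 64\<close>

definition tau :: real where "tau = 2 * pi / ln 64"

lemma ln_64: "ln 64 = 6 * ln (2::real)" "ln 32 = 5 * ln (2::real)" "0 < ln (64::real)" "(ln (64::real))\<^sup>2 \<le> 18"
proof -
  show l64: "ln 64 = 6 * ln (2::real)" using ln_realpow[of 2 6] by simp
  show "ln 32 = 5 * ln (2::real)" using ln_realpow[of 2 5] by simp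
  show "0 < ln (64::real)" by simp
  have "ln (64::real) \<le> 6 * (25 / 36)" unfolding l64 using ln2_le_25_over_36 by (intro mult_left_mono) auto
  then have "(ln (64::real))\<^sup>2 \<le> (6 * (25 / 36))\<^sup>2" by (intro power_mono) auto
  then show "(ln (64::real))\<^sup>2 \<le> 18" by (simp add: power2_eq_square)
qed

lemma ln_diff_ge:
  fixes v m B :: real
  assumes "0 < v" "0 < m" "v \<le> B" "m \<le> B"
  shows "\<bar>v - m\<bar> / B \<le> \<bar>ln v - ln m\<bar>"
proof -
  have le: "(v - m) / B \<le> ln v - ln m" if "0 < m" "m \<le> v" "v \<le> B" for v m :: real
  proof -
    have "ln (m / v) \<le> m / v - 1" using that by (intro ln_le_minus_one) auto
    then have "(v - m) / v \<le> ln v - ln m" using that by (simp add: ln_div diff_divide_distrib)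
    moreover have "(v - m) / B \<le> (v - m) / v" using that by (intro divide_left_mono) auto
    ultimately show ?thesis by linarith
  qed
  show ?thesis
  proof (cases "m \<le> v")
    case True
    then show ?thesis using le[of m v] assms by (simp add: abs_of_nonneg)
  next
    case False
    then show ?thesis using le[of v m] assms by (simp add: abs_if)
  qed
qed

lemma fejer_log_tail:
  fixes v m B :: real
  assumes v: "0 < v" "v \<le> B" and m: "0 < m" "m \<le> B" and r: "v \<le> 32 * m" "m \<le> 32 * v" and K: "0 < K" and ne: "v \<noteq> m"
  shows "fejer K (tau * (ln v - ln m)) \<le> 72 * B\<^sup>2 / (real K * (v - m)\<^sup>2)"
proof -
  define s where "s = ln v - ln m"
  define y where "y = s / ln 64"
  have lm: "ln (32 * x) = ln 32 + ln x" if "0 < x" for x :: real using that by (simp add: ln_mult)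
  have "ln v \<le> ln (32 * m)" "ln m \<le> ln (32 * v)" using r v m by (intro ln_mono; simp)+
  then have "ln v \<le> ln 32 + ln m" "ln m \<le> ln 32 + ln v" using lm v m by auto
  then have "\<bar>s\<bar> \<le> ln 32" by (simp add: s_def abs_le_iff)
  then have y: "\<bar>y\<bar> \<le> 5 / 6" using ln_64 by (simp add: y_def abs_divide field_simps)
  have B: "0 < B" using v by simp
  have sge: "\<bar>v - m\<bar> / B \<le> \<bar>s\<bar>" unfolding s_def by (rule ln_diff_ge[OF v(1) m(1) v(2) m(2)])
  have dpos: "0 < \<bar>v - m\<bar> / B" using ne B by simp
  have ts: "tau * s = 2 * pi * y" by (simp add: tau_def y_def)
  have n: "\<bar>y\<bar> \<le> norm (cis (tau * s) - 1)" unfolding ts by (rule norm_cis_minus_one_period[OF y])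
  have "0 < \<bar>s\<bar>" using sge dpos by linarith
  then have ypos: "0 < \<bar>y\<bar>" using ln_64(3) by (simp add: y_def)
  have "cis (tau * s) \<noteq> 1" using n ypos by auto
  then have "fejer K (tau * s) \<le> 4 / (real K * (norm (cis (tau * s) - 1))\<^sup>2)" by (rule fejer_le_inverse)
  also have "\<dots> \<le> 4 / (real K * \<bar>y\<bar>\<^sup>2)"
    using n ypos K by (intro divide_left_mono mult_left_mono power_mono mult_pos_pos) auto
  also have "\<dots> = 4 * (ln 64)\<^sup>2 / (real K * \<bar>s\<bar>\<^sup>2)" by (simp add: y_def power_divide)
  also have "\<dots> \<le> 4 * 18 / (real K * (\<bar>v - m\<bar> / B)\<^sup>2)"
    using ln_64(4) sge dpos K by (intro frac_le mult_left_mono power_mono mult_pos_pos) auto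
  also have "\<dots> = 72 * B\<^sup>2 / (real K * (v - m)\<^sup>2)" by (simp add: power_divide)
  finally show ?thesis by (simp add: s_def)
qed

lemma fejer_log_le:
  fixes v m B :: real
  assumes v: "0 < v" "v \<le> B" and m: "0 < m" "m \<le> B" and r: "v \<le> 32 * m" "m \<le> 32 * v" and K: "0 < K"
  shows "fejer K (tau * (ln v - ln m)) \<le> 162 * B\<^sup>2 / real K * (1 / ((v - m)\<^sup>2 + (9 * B / real K)\<^sup>2))"
proof -
  \<comment> \<open>With this h the majorant at distance h equals the maximum K, and 162/2 = 81
    exceeds the constant 72 of the tail, so a single formula covers both regimes.\<close>
  define h where "h = 9 * B / real K"
  have B: "0 < B" using v by simp
  have h: "0 < h\<^sup>2" using B K by (simp add: h_def)
  have hh: "162 * B\<^sup>2 / real K * (1 / (2 * h\<^sup>2)) = real K"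
    using B K by (simp add: h_def power_divide field_simps power2_eq_square)
  show ?thesis
  proof (cases "(v - m)\<^sup>2 \<le> h\<^sup>2")
    case True
    have "fejer K (tau * (ln v - ln m)) \<le> 162 * B\<^sup>2 / real K * (1 / (2 * h\<^sup>2))" unfolding hh by (rule fejer_le_K)
    also have "\<dots> \<le> 162 * B\<^sup>2 / real K * (1 / ((v - m)\<^sup>2 + h\<^sup>2))"
      using True h by (intro mult_left_mono divide_left_mono mult_pos_pos) (auto intro: add_nonneg_pos)
    finally show ?thesis by (simp add: h_def)
  next
    case False
    then have ne: "v \<noteq> m" using h by auto
    have d: "0 < (v - m)\<^sup>2" using ne by simp
    have "fejer K (tau * (ln v - ln m)) \<le> 72 * B\<^sup>2 / (real K * (v - m)\<^sup>2)"
      by (rule fejer_log_tail[OF v m r K ne])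
    also have "\<dots> = 72 * B\<^sup>2 / real K * (1 / (v - m)\<^sup>2)" by simp
    also have "\<dots> \<le> 81 * B\<^sup>2 / real K * (1 / (v - m)\<^sup>2)"
      by (intro mult_right_mono divide_right_mono) auto
    also have "\<dots> = 162 * B\<^sup>2 / real K * (1 / (2 * (v - m)\<^sup>2))" by simp
    also have "\<dots> \<le> 162 * B\<^sup>2 / real K * (1 / ((v - m)\<^sup>2 + h\<^sup>2))"
      using False h d by (intro mult_left_mono divide_left_mono mult_pos_pos) (auto intro: add_nonneg_pos)
    finally show ?thesis by (simp add: h_def)
  qed
qed

text \<open>The two terms reflect the peak K of the kernel and its mean 1 times the number of
  l-spaced points up to B.\<close>

lemma fejer_sum_le:
  fixes V :: "real set" and B m l :: real
  assumes fin: "finite V" and l: "0 < l" and K: "0 < K" and m: "0 < m" "m \<le> B"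
    and V: "\<And>v. v \<in> V \<Longrightarrow> 0 < v \<and> v \<le> B \<and> v \<le> 32 * m \<and> m \<le> 32 * v"
    and sp: "\<And>x y. x \<in> V \<Longrightarrow> y \<in> V \<Longrightarrow> x \<noteq> y \<Longrightarrow> l \<le> \<bar>x - y\<bar>"
  shows "(\<Sum>v\<in>V. fejer K (tau * (ln v - ln m))) \<le> 4 * real K + 72 * B / l"
proof -
  define h where "h = 9 * B / real K"
  have B: "0 < B" using m by simp
  have h: "0 < h" using B K by (simp add: h_def)
  have "(\<Sum>v\<in>V. fejer K (tau * (ln v - ln m))) \<le> (\<Sum>v\<in>V. 162 * B\<^sup>2 / real K * (1 / ((v - m)\<^sup>2 + h\<^sup>2)))"
    unfolding h_def using V m K by (intro sum_mono fejer_log_le) auto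
  also have "\<dots> = 162 * B\<^sup>2 / real K * (\<Sum>v\<in>V. 1 / ((v - m)\<^sup>2 + h\<^sup>2))" by (simp only: sum_distrib_left)
  also have "(\<Sum>v\<in>V. 1 / ((v - m)\<^sup>2 + h\<^sup>2)) = (\<Sum>w\<in>(\<lambda>v. v - m) ` V. 1 / (w\<^sup>2 + h\<^sup>2))"
    by (subst sum.reindex) (auto simp: inj_on_def)
  also have "162 * B\<^sup>2 / real K * \<dots> \<le> 162 * B\<^sup>2 / real K * (2 / h\<^sup>2 + 4 / (l * h))"
  proof (intro mult_left_mono spaced_sum_bound l h)
    fix x y assume "x \<in> (\<lambda>v. v - m) ` V" "y \<in> (\<lambda>v. v - m) ` V" "x \<noteq> y"
    then obtain x' y' where "x' \<in> V" "y' \<in> V" "x = x' - m" "y = y' - m" "x' \<noteq> y'" by auto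
    then show "l \<le> \<bar>x - y\<bar>" using sp[of x' y'] by simp
  qed (use fin in auto)
  also have "\<dots> = 4 * real K + 72 * B / l"
    using B K l by (simp add: h_def power_divide field_simps power2_eq_square)
  finally show ?thesis .
qed

text \<open>Only the quadratic decay of the kernel is used. Beyond H, adding H^2 to the denominator
  loses at most a factor 2 and makes \<open>spaced_sum_bound\<close> applicable.\<close>

lemma tail_sum_le:
  fixes V :: "real set" and B m l H :: real
  assumes fin: "finite V" and l: "0 < l" and H: "0 < H" and K: "0 < K" and m: "0 < m" "m \<le> B"
    and V: "\<And>v. v \<in> V \<Longrightarrow> 0 < v \<and> v \<le> B \<and> v \<le> 32 * m \<and> m \<le> 32 * v \<and> H < \<bar>v - m\<bar>"
    and sp: "\<And>x y. x \<in> V \<Longrightarrow> y \<in> V \<Longrightarrow> x \<noteq> y \<Longrightarrow> l \<le> \<bar>x - y\<bar>"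
  shows "(\<Sum>v\<in>V. fejer K (tau * (ln v - ln m))) \<le> 144 * B\<^sup>2 / real K * (2 / H\<^sup>2 + 4 / (l * H))"
proof -
  have "fejer K (tau * (ln v - ln m)) \<le> 144 * B\<^sup>2 / real K * (1 / ((v - m)\<^sup>2 + H\<^sup>2))" if v: "v \<in> V" for v
  proof -
    have Hv: "H < \<bar>v - m\<bar>" using V[OF v] by simp
    have ne: "v \<noteq> m" using Hv H by auto
    have "H\<^sup>2 \<le> \<bar>v - m\<bar>\<^sup>2" using Hv H by (intro power_mono) auto
    then have sq: "(v - m)\<^sup>2 + H\<^sup>2 \<le> 2 * (v - m)\<^sup>2" by simp
    have "fejer K (tau * (ln v - ln m)) \<le> 72 * B\<^sup>2 / (real K * (v - m)\<^sup>2)"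
      using V[OF v] m K ne by (intro fejer_log_tail) auto
    also have "\<dots> = 144 * B\<^sup>2 / real K * (1 / (2 * (v - m)\<^sup>2))" by simp
    also have "\<dots> \<le> 144 * B\<^sup>2 / real K * (1 / ((v - m)\<^sup>2 + H\<^sup>2))"
      using sq ne H by (intro mult_left_mono divide_left_mono mult_pos_pos) (auto intro: add_nonneg_pos)
    finally show ?thesis .
  qed
  then have "(\<Sum>v\<in>V. fejer K (tau * (ln v - ln m))) \<le> (\<Sum>v\<in>V. 144 * B\<^sup>2 / real K * (1 / ((v - m)\<^sup>2 + H\<^sup>2)))"
    by (intro sum_mono)
  also have "\<dots> = 144 * B\<^sup>2 / real K * (\<Sum>v\<in>V. 1 / ((v - m)\<^sup>2 + H\<^sup>2))" by (simp only: sum_distrib_left)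
  also have "(\<Sum>v\<in>V. 1 / ((v - m)\<^sup>2 + H\<^sup>2)) = (\<Sum>w\<in>(\<lambda>v. v - m) ` V. 1 / (w\<^sup>2 + H\<^sup>2))"
    by (subst sum.reindex) (auto simp: inj_on_def)
  also have "144 * B\<^sup>2 / real K * \<dots> \<le> 144 * B\<^sup>2 / real K * (2 / H\<^sup>2 + 4 / (l * H))"
  proof (intro mult_left_mono spaced_sum_bound l H)
    fix x y assume "x \<in> (\<lambda>v. v - m) ` V" "y \<in> (\<lambda>v. v - m) ` V" "x \<noteq> y"
    then obtain x' y' where "x' \<in> V" "y' \<in> V" "x = x' - m" "y = y' - m" "x' \<noteq> y'" by auto
    then show "l \<le> \<bar>x - y\<bar>" using sp[of x' y'] by simp
  qed (use fin in auto)
  finally show ?thesis .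
qed

section \<open>The inequality for the set of exceptional degrees\<close>

lemma sum_inverse_le: "1 \<le> N \<Longrightarrow> (\<Sum>k\<in>{1..N}. 1 / real k) \<le> 1 + ln (real N)"
proof (induction N rule: dec_induct)
  case (step N)
  have "ln (real N / real (Suc N)) \<le> real N / real (Suc N) - 1" using step by (intro ln_le_minus_one) auto
  then have "1 / real (Suc N) \<le> ln (real (Suc N)) - ln (real N)" using step by (simp add: ln_div field_simps)
  then show ?case using step by simp
qed simp

lemma sum_inverse_square_le: "1 \<le> z \<Longrightarrow> (\<Sum>k\<in>{z<..N}. 1 / (real k)\<^sup>2) \<le> 1 / real z"
proof -
  assume z: "1 \<le> z"
  have "(\<Sum>k\<in>{z<..N}. 1 / (real k)\<^sup>2) \<le> 1 / real z - 1 / real N" if "z \<le> N" for N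
    using that
  proof (induction N rule: dec_induct)
    case (step N)
    have N: "0 < real N" using step z by simp
    have "1 / (real (Suc N))\<^sup>2 \<le> 1 / (real N * real (Suc N))"
      using N by (intro divide_left_mono) (auto simp: power2_eq_square)
    also have "\<dots> = 1 / real N - 1 / real (Suc N)" using N by (simp add: field_simps)
    finally have "1 / (real (Suc N))\<^sup>2 \<le> 1 / real N - 1 / real (Suc N)" .
    moreover have "{z<..Suc N} = insert (Suc N) {z<..N}" using step by auto
    ultimately show ?case using step by simp
  qed simp
  note le = this
  show ?thesis
  proof (cases "z \<le> N")
    case True
    moreover have "0 \<le> 1 / real N" by simp
    ultimately show ?thesis using le[of N] by linarith
  next
    case False
    then have "{z<..N} = {}" by auto
    then show ?thesis using z by (simp only: sum.empty) simp
  qed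
qed

lemma card_spaced_le:
  fixes S :: "nat set"
  assumes l: "0 < l" and S: "S \<subseteq> {c..<c + N}" and sp: "\<And>x y. x \<in> S \<Longrightarrow> y \<in> S \<Longrightarrow> x < y \<Longrightarrow> x + l \<le> y"
  shows "real (card S) \<le> real N / real l + 1"
proof -
  have inj: "inj_on (\<lambda>x. (x - c) div l) S"
  proof (rule inj_onI, rule ccontr)
    fix x y assume xy: "x \<in> S" "y \<in> S" "(x - c) div l = (y - c) div l" "x \<noteq> y"
    have ge: "c \<le> x" "c \<le> y" using xy S by auto
    have aux: False if "u < v" "u + l \<le> v" "c \<le> u" "(u - c) div l = (v - c) div l" for u v
    proof -
      have "(u - c) + l \<le> v - c" using that by linarith
      then have "((u - c) + l) div l \<le> (v - c) div l" by (rule div_le_mono)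
      then have "(u - c) div l + 1 \<le> (v - c) div l" using l by (simp only: div_add_self2)
      then show False using that by simp
    qed
    show False using aux[of x y] aux[of y x] sp[OF xy(1,2)] sp[OF xy(2,1)] xy ge by (metis linorder_neqE_nat)
  qed
  have "(\<lambda>x. (x - c) div l) ` S \<subseteq> {..N div l}"
  proof
    fix i assume "i \<in> (\<lambda>x. (x - c) div l) ` S"
    then obtain x where "x \<in> S" "i = (x - c) div l" by auto
    moreover have "x - c \<le> N" using \<open>x \<in> S\<close> S by fastforce
    ultimately show "i \<in> {..N div l}" by (auto intro!: div_le_mono)
  qed
  then have "card S \<le> card {..N div l}" using card_inj_on_le[OF inj] by blast
  then have "real (card S) \<le> real (N div l) + 1" by simp
  also have "real (N div l) \<le> real N / real l" using of_nat_div_le_of_nat[of N l, where 'a = real] by simp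
  finally show ?thesis by simp
qed

text \<open>The bilinear form over E is bounded below by its main term. From above, coprime pairs
  contribute only the tail of the kernel, because for exceptional n no product a p comes close to n
  - 2 J^3; pairs with a common prime l > z are counted trivially. Constants: 148 = 4 + 72 * 2, 36864
  = 144 * 16^2, 1184 = 4 * 8 + 72 * 16, and 63 J is the number of j.\<close>

lemma exceptional_inequality:
  fixes X P J W z :: nat and E :: "nat set" and \<eta> :: real
  assumes z: "1 \<le> z" "W = fact z" and J: "1 \<le> J" and P: "1 \<le> P"
    and X: "8 * W * J * P \<le> X" "X < 16 * W * J * P" "4 * J ^ 3 \<le> X"
    and \<eta>: "0 \<le> \<eta>"
    and small: "\<And>d. 0 < d \<Longrightarrow> d < P \<Longrightarrow> norm (\<Sum>j\<in>{J..<64 * J}. of_real (1 / real (1 + W * j)) * cis (real d * (tau * ln (real (1 + W * j))))) \<le> \<eta>"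
    and E: "E \<subseteq> {X<..2 * X}"
    and tail: "\<And>n j p. n \<in> E \<Longrightarrow> j \<in> {J..<64 * J} \<Longrightarrow> p \<in> prime_window P \<Longrightarrow> coprime (1 + W * j) n
      \<Longrightarrow> real (J ^ 3) < \<bar>real ((1 + W * j) * p) - (real n - 2 * real (J ^ 3))\<bar>"
  defines "U \<equiv> (\<Sum>j\<in>{J..<64 * J}. 1 / real (1 + W * j))"
  shows "real (card E) * real (card (prime_window P)) * U
      - \<eta> * sqrt (148 * real X * real (card E)) * sqrt (148 * real P * real (card (prime_window P)))
    \<le> real (card E) * U * (36864 * (real X)\<^sup>2 / real P * (2 / (real (J ^ 3))\<^sup>2 + 4 / (real J * real (J ^ 3))))
      + real (card (prime_window P)) * (1184 * real X) * (63 / (real W * real z) + (1 + ln (real (64 * W * J))) / (real W * real J))"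
proof -
  define A where "A = {J..<64 * J}"
  define S where "S = prime_window P"
  define a where "a j = 1 + W * j" for j
  \<comment> \<open>Centering at n - 2 J^3 with radius J^3 makes n - a p lie between J^3 and 3 J^3,
    so b is positive and of known size.\<close>
  define y where "y n = real n - 2 * real (J ^ 3)" for n :: nat
  define I where "I = {X<..2 * X}"
  define f where "f n j p = fejer P (tau * (ln (y n) - ln (real (a j * p))))" for n j p
  have finS: "finite S" unfolding S_def by (rule finite_prime_window)
  have finE: "finite E" using E finite_subset by blast
  have W1: "1 \<le> W" using z by simp
  have WJ: "1 \<le> W * J" using mult_le_mono[of 1 W 1 J] W1 J by simp
  have f0: "0 \<le> f n j p" for n j p by (simp add: f_def fejer_nonneg)
  have aJ: "W * J \<le> a j" "J \<le> a j" "a j \<le> 64 * W * J" if "j \<in> A" for j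
  proof -
    have j: "J \<le> j" "Suc j \<le> 64 * J" using that by (auto simp: A_def)
    have 1: "W * J \<le> W * j" using j by simp
    then show "W * J \<le> a j" unfolding a_def by linarith
    have "1 * J \<le> W * J" using W1 by (intro mult_le_mono) auto
    then show "J \<le> a j" using 1 unfolding a_def by linarith
    have "a j \<le> W * Suc j" using W1 by (simp add: a_def)
    also have "\<dots> \<le> W * (64 * J)" using j by (intro mult_le_mono) auto
    finally show "a j \<le> 64 * W * J" by (simp add: mult_ac)
  qed
  have apos: "0 < a j" for j by (simp add: a_def)
  have pS: "P < p" "p \<le> 2 * P" if "p \<in> S" for p using that by (auto simp: S_def prime_window_def)
  have H4: "4 * real (J ^ 3) \<le> real X" using X(3) by (metis of_nat_le_iff of_nat_mult of_nat_numeral)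
  have "1 * 1 \<le> (W * J) * P" using WJ P by (intro mult_le_mono) auto
  then have "1 \<le> X" using X(1) by linarith
  then have Xpos: "0 < real X" by simp
  have yI: "real X / 2 \<le> y n" "y n \<le> 2 * real X" "0 < y n" if "n \<in> I" for n
  proof -
    have "X < n" "n \<le> 2 * X" using that by (auto simp: I_def)
    then have "real X < real n" "real n \<le> 2 * real X" by linarith+
    moreover have "0 \<le> real (J ^ 3)" by simp
    ultimately show "real X / 2 \<le> y n" "y n \<le> 2 * real X" "0 < y n"
      using H4 Xpos unfolding y_def by linarith+
  qed
  have m: "real X / 16 \<le> real (a j * p)" "real (a j * p) \<le> 16 * real X" if "j \<in> A" "p \<in> S" for j p
  proof -
    have "W * J * P \<le> a j * p" using aJ(1)[OF that(1)] pS[OF that(2)] by (intro mult_le_mono) auto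
    then have "X \<le> 16 * (a j * p)" using X(2) by linarith
    then have "real X \<le> 16 * real (a j * p)" by (metis of_nat_le_iff of_nat_mult of_nat_numeral)
    then show "real X / 16 \<le> real (a j * p)" by simp
    have "a j * p \<le> (64 * W * J) * (2 * P)" using aJ(3)[OF that(1)] pS[OF that(2)] by (intro mult_le_mono) auto
    then have "a j * p \<le> 16 * X" using X(1) by simp
    then show "real (a j * p) \<le> 16 * real X" by (metis of_nat_le_iff of_nat_mult of_nat_numeral)
  qed
  have ratio: "y n \<le> 32 * real (a j * p)" "real (a j * p) \<le> 32 * y n" "0 < real (a j * p)"
    if "n \<in> I" "j \<in> A" "p \<in> S" for n j p
    using yI[OF that(1)] m[OF that(2,3)] Xpos by auto
  have EI: "n \<in> I" if "n \<in> E" for n using that E by (auto simp: I_def)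
  have ln_ap: "ln (real (a j * p)) = ln (real (a j)) + ln (real p)" if "p \<in> S" for j p
    using apos[of j] pS[OF that] by (simp add: ln_mult)
  have spaced1: "(1::real) \<le> \<bar>real x - real y\<bar>" if "x \<noteq> y" for x y :: nat using that by linarith

  have EE: "(\<Sum>e\<in>E. \<Sum>g\<in>E. fejer P (tau * ln (y e) - tau * ln (y g))) \<le> 148 * real X * real (card E)"
  proof -
    have "(\<Sum>g\<in>E. fejer P (tau * ln (y e) - tau * ln (y g))) \<le> 148 * real X" if e: "e \<in> E" for e
    proof -
      have "(\<Sum>g\<in>E. fejer P (tau * ln (y e) - tau * ln (y g))) = (\<Sum>g\<in>E. fejer P (tau * (ln (y g) - ln (y e))))"
      proof (rule sum.cong[OF refl])
        fix g
        have "tau * ln (y e) - tau * ln (y g) = - (tau * (ln (y g) - ln (y e)))" by (simp add: algebra_simps)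
        then show "fejer P (tau * ln (y e) - tau * ln (y g)) = fejer P (tau * (ln (y g) - ln (y e)))"
          by (simp only: fejer_minus)
      qed
      also have "\<dots> = (\<Sum>v\<in>y ` E. fejer P (tau * (ln v - ln (y e))))"
        by (subst sum.reindex) (auto simp: inj_on_def y_def)
      also have "\<dots> \<le> 4 * real P + 72 * (2 * real X) / 1"
      proof (rule fejer_sum_le)
        show "finite (y ` E)" using finE by simp
        show "0 < P" using P by simp
        show "0 < y e" "y e \<le> 2 * real X" using yI[OF EI[OF e]] by auto
        show "0 < v \<and> v \<le> 2 * real X \<and> v \<le> 32 * y e \<and> y e \<le> 32 * v" if "v \<in> y ` E" for v
        proof -
          from that obtain g where g: "g \<in> E" "v = y g" by auto
          show ?thesis using yI[OF EI[OF g(1)]] yI[OF EI[OF e]] g(2) by auto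
        qed
        show "1 \<le> \<bar>u - v\<bar>" if "u \<in> y ` E" "v \<in> y ` E" "u \<noteq> v" for u v
          using that spaced1 by (auto simp: y_def)
      qed simp
      also have "\<dots> \<le> 148 * real X"
      proof -
        have "1 * P \<le> W * J * P" using WJ by (intro mult_le_mono) auto
        then have "P \<le> X" using X(1) by linarith
        then show ?thesis by simp
      qed
      finally show ?thesis .
    qed
    then have "(\<Sum>e\<in>E. \<Sum>g\<in>E. fejer P (tau * ln (y e) - tau * ln (y g))) \<le> (\<Sum>e\<in>E. 148 * real X)" by (intro sum_mono)
    then show ?thesis by (simp add: mult.commute)
  qed
  have PP: "(\<Sum>p\<in>S. \<Sum>q\<in>S. fejer P (tau * ln (real p) - tau * ln (real q))) \<le> 148 * real P * real (card S)"
  proof -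
    have "(\<Sum>q\<in>S. fejer P (tau * ln (real p) - tau * ln (real q))) \<le> 148 * real P" if p: "p \<in> S" for p
    proof -
      have "(\<Sum>q\<in>S. fejer P (tau * ln (real p) - tau * ln (real q))) = (\<Sum>q\<in>S. fejer P (tau * (ln (real q) - ln (real p))))"
      proof (rule sum.cong[OF refl])
        fix q
        have "tau * ln (real p) - tau * ln (real q) = - (tau * (ln (real q) - ln (real p)))" by (simp add: algebra_simps)
        then show "fejer P (tau * ln (real p) - tau * ln (real q)) = fejer P (tau * (ln (real q) - ln (real p)))"
          by (simp only: fejer_minus)
      qed
      also have "\<dots> = (\<Sum>v\<in>real ` S. fejer P (tau * (ln v - ln (real p))))"
        by (subst sum.reindex) (auto simp: inj_on_def)
      also have "\<dots> \<le> 4 * real P + 72 * (2 * real P) / 1"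
      proof (rule fejer_sum_le)
        show "finite (real ` S)" using finS by simp
        show "0 < P" using P by simp
        show "0 < real p" "real p \<le> 2 * real P" using pS[OF p] P by auto
        show "0 < v \<and> v \<le> 2 * real P \<and> v \<le> 32 * real p \<and> real p \<le> 32 * v" if "v \<in> real ` S" for v
        proof -
          from that obtain q where q: "q \<in> S" "v = real q" by auto
          show ?thesis using pS[OF q(1)] pS[OF p] q(2) P by auto
        qed
        show "1 \<le> \<bar>u - v\<bar>" if "u \<in> real ` S" "v \<in> real ` S" "u \<noteq> v" for u v
          using that spaced1 by auto
      qed simp
      finally show ?thesis by simp
    qed
    then have "(\<Sum>p\<in>S. \<Sum>q\<in>S. fejer P (tau * ln (real p) - tau * ln (real q))) \<le> (\<Sum>p\<in>S. 148 * real P)" by (intro sum_mono)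
    then show ?thesis by (simp add: mult.commute)
  qed

  define u where "u j = 1 / real (a j)" for j
  have u0: "0 \<le> u j" for j by (simp add: u_def)
  have U: "U = (\<Sum>j\<in>A. u j)" by (simp add: U_def u_def A_def a_def)
  define TT where "TT = (\<Sum>n\<in>E. \<Sum>j\<in>A. \<Sum>p\<in>S. u j * f n j p)"
  have lower: "real (card E) * real (card S) * U - \<eta> * sqrt (148 * real X * real (card E)) * sqrt (148 * real P * real (card S)) \<le> TT"
  proof -
    have "real (card E) * real (card S) * (\<Sum>j\<in>A. u j)
      - \<eta> * sqrt (\<Sum>e\<in>E. \<Sum>g\<in>E. fejer P (tau * ln (y e) - tau * ln (y g))) * sqrt (\<Sum>p\<in>S. \<Sum>q\<in>S. fejer P (tau * ln (real p) - tau * ln (real q)))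
      \<le> (\<Sum>n\<in>E. \<Sum>j\<in>A. \<Sum>p\<in>S. u j * fejer P (tau * ln (y n) - tau * ln (real (a j)) - tau * ln (real p)))"
    proof (rule fejer_bilinear[OF _ \<eta> _ finE finS])
      show "0 < P" using P by simp
      show "finite A" by (simp add: A_def)
      show "norm (\<Sum>j\<in>A. of_real (u j) * cis (real d * (tau * ln (real (a j))))) \<le> \<eta>" if "0 < d" "d < P" for d
        using small[OF that] by (simp only: A_def u_def a_def)
    qed
    moreover have "(\<Sum>n\<in>E. \<Sum>j\<in>A. \<Sum>p\<in>S. u j * fejer P (tau * ln (y n) - tau * ln (real (a j)) - tau * ln (real p))) = TT"
      unfolding TT_def f_def
    proof (intro sum.cong refl)
      fix n j p assume "p \<in> S"
      then have "tau * ln (y n) - tau * ln (real (a j)) - tau * ln (real p) = tau * (ln (y n) - ln (real (a j * p)))"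
        using ln_ap[of p j] by (simp only: right_diff_distrib distrib_left diff_diff_eq)
      then show "u j * fejer P (tau * ln (y n) - tau * ln (real (a j)) - tau * ln (real p))
          = u j * fejer P (tau * (ln (y n) - ln (real (a j * p))))" by (simp only:)
    qed
    moreover have "\<eta> * sqrt (\<Sum>e\<in>E. \<Sum>g\<in>E. fejer P (tau * ln (y e) - tau * ln (y g))) * sqrt (\<Sum>p\<in>S. \<Sum>q\<in>S. fejer P (tau * ln (real p) - tau * ln (real q)))
      \<le> \<eta> * sqrt (148 * real X * real (card E)) * sqrt (148 * real P * real (card S))"
      using EE PP \<eta> by (intro mult_mono mult_left_mono real_sqrt_le_mono mult_nonneg_nonneg)
        (auto intro!: sum_nonneg simp: fejer_nonneg)
    ultimately show ?thesis unfolding U by linarith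
  qed

  define H where "H = real (J ^ 3)"
  have H0: "0 < H" using J by (simp add: H_def)
  define Tb where "Tb = 36864 * (real X)\<^sup>2 / real P * (2 / H\<^sup>2 + 4 / (real J * H))"
  have Tb0: "0 \<le> Tb" using H0 by (simp add: Tb_def)
  \<comment> \<open>For fixed a the products a p are at least J apart, which gains the factor J in
    the second term of the tail.\<close>
  have tail_le: "(\<Sum>p\<in>S. f n j p) \<le> Tb" if n: "n \<in> E" and j: "j \<in> A" and cop: "coprime (a j) n" for n j
  proof -
    have nI: "n \<in> I" by (rule EI[OF n])
    have "(\<Sum>p\<in>S. f n j p) = (\<Sum>p\<in>S. fejer P (tau * (ln (real (a j * p)) - ln (y n))))"
    proof (rule sum.cong[OF refl])
      fix p
      have "tau * (ln (y n) - ln (real (a j * p))) = - (tau * (ln (real (a j * p)) - ln (y n)))" by (simp add: algebra_simps)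
      then show "f n j p = fejer P (tau * (ln (real (a j * p)) - ln (y n)))" unfolding f_def by (simp only: fejer_minus)
    qed
    also have "\<dots> = (\<Sum>v\<in>(\<lambda>p. real (a j * p)) ` S. fejer P (tau * (ln v - ln (y n))))"
      using apos[of j] by (subst sum.reindex) (auto simp: inj_on_def)
    also have "\<dots> \<le> 144 * (16 * real X)\<^sup>2 / real P * (2 / H\<^sup>2 + 4 / (real J * H))"
    proof (rule tail_sum_le)
      show "finite ((\<lambda>p. real (a j * p)) ` S)" using finS by simp
      show "0 < real J" using J by simp
      show "0 < P" using P by simp
      show "0 < y n" "y n \<le> 16 * real X" using yI[OF nI] Xpos by auto
      show "0 < v \<and> v \<le> 16 * real X \<and> v \<le> 32 * y n \<and> y n \<le> 32 * v \<and> H < \<bar>v - y n\<bar>"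
        if "v \<in> (\<lambda>p. real (a j * p)) ` S" for v
      proof -
        from that obtain p where p: "p \<in> S" "v = real (a j * p)" by auto
        have "H < \<bar>v - y n\<bar>" unfolding H_def p(2) y_def a_def
          using n j p cop by (intro tail) (auto simp: A_def S_def a_def)
        then show ?thesis using ratio[OF nI j p(1)] m[OF j p(1)] p(2) by simp
      qed
      show "real J \<le> \<bar>v - w\<bar>" if "v \<in> (\<lambda>p. real (a j * p)) ` S" "w \<in> (\<lambda>p. real (a j * p)) ` S" "v \<noteq> w" for v w
      proof -
        from that obtain p q where pq: "v = real (a j * p)" "w = real (a j * q)" "p \<noteq> q" by auto
        have "real (a j) * 1 \<le> real (a j) * \<bar>real p - real q\<bar>" using spaced1[OF pq(3)] by (intro mult_left_mono) auto
        also have "\<dots> = \<bar>v - w\<bar>" unfolding pq by (simp add: abs_mult right_diff_distrib[symmetric])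
        finally have "real (a j) \<le> \<bar>v - w\<bar>" by simp
        moreover have "real J \<le> real (a j)" using aJ(2)[OF j] by simp
        ultimately show ?thesis by linarith
      qed
    qed (use H0 in auto)
    also have "\<dots> = Tb" by (simp add: Tb_def power_mult_distrib)
    finally show ?thesis .
  qed

  define s where "s n j = (\<Sum>p\<in>S. u j * f n j p)" for n j
  have s0: "0 \<le> s n j" for n j unfolding s_def using u0 f0 by (intro sum_nonneg mult_nonneg_nonneg) auto
  define L where "L = {l. prime l \<and> z < l \<and> l \<le> 64 * W * J}"
  have finL: "finite L" by (rule finite_subset[of _ "{..64 * W * J}"]) (auto simp: L_def)
  define c where "c n j l = (if l dvd a j \<and> l dvd n then s n j else 0)" for n j l
  have c0: "0 \<le> c n j l" for n j l using s0 by (simp add: c_def)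
  \<comment> \<open>Either a and n are coprime and the tail bound applies, or the whole term is
    charged to a common prime divisor.\<close>
  have cover: "s n j \<le> u j * Tb + (\<Sum>l\<in>L. c n j l)" if n: "n \<in> E" and j: "j \<in> A" for n j
  proof (cases "coprime (a j) n")
    case True
    have "s n j = u j * (\<Sum>p\<in>S. f n j p)" by (simp add: s_def sum_distrib_left)
    also have "\<dots> \<le> u j * Tb" using tail_le[OF n j True] u0 by (intro mult_left_mono)
    finally show ?thesis using sum_nonneg[of L "c n j"] c0 by (smt (verit))
  next
    case False
    then have "gcd (a j) n \<noteq> 1" by (simp add: coprime_iff_gcd_eq_1)
    then obtain l where l: "prime l" "l dvd gcd (a j) n" using prime_factor_nat by blast
    then have la: "l dvd a j" "l dvd n" by auto
    have "l \<le> a j" using la apos by (intro dvd_imp_le) auto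
    then have "l \<le> 64 * W * J" using aJ(3)[OF j] by linarith
    \<comment> \<open>a is 1 modulo W = z!, so no prime up to z divides it.\<close>
    moreover have "z < l"
    proof (rule ccontr)
      assume "\<not> z < l"
      then have "l dvd W" using l(1) z(2) by (simp add: prime_dvd_fact_iff)
      then have "l dvd W * j" by simp
      moreover have "l dvd 1 + W * j" using la(1) by (simp only: a_def)
      ultimately have "l dvd 1" using dvd_add_left_iff[of l "W * j" 1] by blast
      then show False using l(1) by auto
    qed
    ultimately have "l \<in> L" using l by (simp add: L_def)
    then have "c n j l \<le> (\<Sum>l\<in>L. c n j l)" using finL c0 by (intro member_le_sum) auto
    moreover have "c n j l = s n j" using la by (simp add: c_def)
    moreover have "0 \<le> u j * Tb" using u0 Tb0 by simp
    ultimately show ?thesis by linarith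
  qed
  \<comment> \<open>The multiples of l in the window are l apart, so restricting n to them gains a
    factor l in the kernel sum.\<close>
  have cn: "(\<Sum>n\<in>I. c n j l) \<le> (if l dvd a j then u j * (real (card S) * (1184 * real X / real l)) else 0)"
    if j: "j \<in> A" and l: "l \<in> L" for j l
  proof (cases "l dvd a j")
    case True
    have lpos: "0 < l" using l prime_gt_0_nat by (simp add: L_def)
    have each: "(\<Sum>n\<in>{n \<in> I. l dvd n}. f n j p) \<le> 1184 * real X / real l" if p: "p \<in> S" for p
    proof -
      have "(\<Sum>n\<in>{n \<in> I. l dvd n}. f n j p) = (\<Sum>v\<in>y ` {n \<in> I. l dvd n}. fejer P (tau * (ln v - ln (real (a j * p)))))"
        unfolding f_def by (subst sum.reindex) (auto simp: inj_on_def y_def)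
      also have "\<dots> \<le> 4 * real P + 72 * (16 * real X) / real l"
      proof (rule fejer_sum_le)
        show "finite (y ` {n \<in> I. l dvd n})" by (simp add: I_def)
        show "0 < real l" using lpos by simp
        show "0 < P" using P by simp
        have "X + 1 \<in> I" using Xpos by (simp add: I_def)
        then show "0 < real (a j * p)" using ratio[OF _ j p] by blast
        show "real (a j * p) \<le> 16 * real X" using m[OF j p] by simp
        show "0 < v \<and> v \<le> 16 * real X \<and> v \<le> 32 * real (a j * p) \<and> real (a j * p) \<le> 32 * v"
          if "v \<in> y ` {n \<in> I. l dvd n}" for v
        proof -
          from that obtain n where n: "n \<in> I" "v = y n" by auto
          show ?thesis using yI[OF n(1)] ratio[OF n(1) j p] n(2) Xpos by auto
        qed
        show "real l \<le> \<bar>v - w\<bar>" if "v \<in> y ` {n \<in> I. l dvd n}" "w \<in> y ` {n \<in> I. l dvd n}" "v \<noteq> w" for v w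
        proof -
          from that obtain n n' where nn: "l dvd n" "l dvd n'" "v = y n" "w = y n'" "n \<noteq> n'" by auto
          then have d: "int l dvd int n - int n'" by (simp add: int_dvd_int_iff)
          have "int l \<le> \<bar>int n - int n'\<bar>" using dvd_imp_le_int[OF _ d] nn(5) by simp
          then have "real l \<le> \<bar>real n - real n'\<bar>" by linarith
          then show ?thesis by (simp add: nn y_def)
        qed
      qed
      also have "\<dots> \<le> 1184 * real X / real l"
      proof -
        have "l * P \<le> (64 * W * J) * P" using l by (intro mult_le_mono) (auto simp: L_def)
        then have "l * P \<le> 8 * X" using X(1) by linarith
        then have "real l * real P \<le> 8 * real X" by (metis of_nat_le_iff of_nat_mult of_nat_numeral)
        then have "real P \<le> 8 * real X / real l" using lpos by (simp add: field_simps)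
        then have "4 * real P + 72 * (16 * real X) / real l \<le> 4 * (8 * real X / real l) + 72 * (16 * real X) / real l" by simp
        also have "\<dots> = 1184 * real X / real l" by (simp add: add_divide_distrib[symmetric])
        finally show ?thesis .
      qed
      finally show ?thesis .
    qed
    have "(\<Sum>n\<in>I. c n j l) = (\<Sum>n\<in>{n \<in> I. l dvd n}. s n j)"
      unfolding c_def using True by (simp add: sum.If_cases I_def Int_def conj_commute)
    also have "\<dots> = (\<Sum>p\<in>S. \<Sum>n\<in>{n \<in> I. l dvd n}. u j * f n j p)" unfolding s_def by (rule sum.swap)
    also have "\<dots> = u j * (\<Sum>p\<in>S. \<Sum>n\<in>{n \<in> I. l dvd n}. f n j p)" by (simp add: sum_distrib_left)
    also have "\<dots> \<le> u j * (\<Sum>p\<in>S. 1184 * real X / real l)" using each u0 by (intro mult_left_mono sum_mono)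
    finally show ?thesis using True by simp
  next
    case False
    then show ?thesis by (simp add: c_def)
  qed
  \<comment> \<open>The j with l dividing 1 + W j lie in one residue class modulo l, which gains a
    second factor l up to the rounding term; the first part then converges over l > z.\<close>
  have jl: "(\<Sum>j\<in>A. if l dvd a j then u j * (real (card S) * (1184 * real X / real l)) else 0)
      \<le> real (card S) * (1184 * real X) * (63 / (real W * (real l)\<^sup>2) + 1 / (real W * real J * real l))" if l: "l \<in> L" for l
  proof -
    have lpos: "0 < l" and lp: "prime l" "z < l" using l prime_gt_0_nat by (auto simp: L_def)
    have copW: "coprime l W"
    proof -
      have "\<not> l dvd W" using lp z(2) by (simp add: prime_dvd_fact_iff)
      then show ?thesis using lp(1) prime_imp_coprime by blast
    qed
    define Al where "Al = {j \<in> A. l dvd a j}"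
    have cAl: "real (card Al) \<le> real (63 * J) / real l + 1"
    proof (rule card_spaced_le[OF lpos])
      show "Al \<subseteq> {J..<J + 63 * J}" by (auto simp: Al_def A_def)
      fix x x' assume xx: "x \<in> Al" "x' \<in> Al" "x < x'"
      have "l dvd a x' - a x" using xx by (intro dvd_diff_nat) (auto simp: Al_def)
      also have "a x' - a x = W * (x' - x)" by (simp add: a_def diff_mult_distrib2)
      finally have "l dvd x' - x" using copW by (simp add: coprime_dvd_mult_right_iff)
      then have "l \<le> x' - x" using xx by (intro dvd_imp_le) auto
      then show "x + l \<le> x'" using xx by linarith
    qed
    define Q where "Q = real (card S) * (1184 * real X / real l)"
    have Q0: "0 \<le> Q" by (simp add: Q_def)
    have "(\<Sum>j\<in>A. if l dvd a j then u j * Q else 0) = (\<Sum>j\<in>Al. u j * Q)"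
      by (simp add: sum.If_cases A_def Al_def Int_def)
    also have "\<dots> \<le> (\<Sum>j\<in>Al. 1 / (real W * real J) * Q)"
    proof (intro sum_mono mult_right_mono Q0)
      fix j assume "j \<in> Al"
      then have "W * J \<le> a j" using aJ(1) by (simp add: Al_def)
      then have "real W * real J \<le> real (a j)" by (metis of_nat_le_iff of_nat_mult)
      then show "u j \<le> 1 / (real W * real J)" unfolding u_def using apos[of j] W1 J by (intro divide_left_mono mult_pos_pos) auto
    qed
    also have "\<dots> = real (card Al) * (1 / (real W * real J) * Q)" by simp
    also have "\<dots> \<le> (real (63 * J) / real l + 1) * (1 / (real W * real J) * Q)"
      using cAl Q0 by (intro mult_right_mono) auto
    also have "\<dots> = real (card S) * (1184 * real X) * (63 / (real W * (real l)\<^sup>2) + 1 / (real W * real J * real l))"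
      using lpos J W1 by (simp add: Q_def field_simps power2_eq_square)
    finally show ?thesis unfolding Q_def .
  qed
  have Lsum: "(\<Sum>l\<in>L. 63 / (real W * (real l)\<^sup>2) + 1 / (real W * real J * real l))
      \<le> 63 / (real W * real z) + (1 + ln (real (64 * W * J))) / (real W * real J)"
  proof -
    have "(\<Sum>l\<in>L. 1 / (real l)\<^sup>2) \<le> (\<Sum>l\<in>{z<..64 * W * J}. 1 / (real l)\<^sup>2)" by (intro sum_mono2) (auto simp: L_def)
    also have "\<dots> \<le> 1 / real z" by (rule sum_inverse_square_le[OF z(1)])
    finally have 1: "63 / real W * (\<Sum>l\<in>L. 1 / (real l)\<^sup>2) \<le> 63 / real W * (1 / real z)" by (intro mult_left_mono) auto
    have "(\<Sum>l\<in>L. 1 / real l) \<le> (\<Sum>l\<in>{1..64 * W * J}. 1 / real l)" using z by (intro sum_mono2) (auto simp: L_def)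
    also have "\<dots> \<le> 1 + ln (real (64 * W * J))" using WJ by (intro sum_inverse_le) linarith
    finally have 2: "1 / (real W * real J) * (\<Sum>l\<in>L. 1 / real l) \<le> 1 / (real W * real J) * (1 + ln (real (64 * W * J)))"
      by (intro mult_left_mono) auto
    have "(\<Sum>l\<in>L. 63 / (real W * (real l)\<^sup>2) + 1 / (real W * real J * real l))
        = 63 / real W * (\<Sum>l\<in>L. 1 / (real l)\<^sup>2) + 1 / (real W * real J) * (\<Sum>l\<in>L. 1 / real l)"
      by (simp add: sum.distrib sum_distrib_left)
    then show ?thesis using 1 2 by simp
  qed
  have upper: "TT \<le> real (card E) * U * Tb + real (card S) * (1184 * real X) * (63 / (real W * real z) + (1 + ln (real (64 * W * J))) / (real W * real J))"
  proof -
    have "TT = (\<Sum>n\<in>E. \<Sum>j\<in>A. s n j)" by (simp add: TT_def s_def)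
    also have "\<dots> \<le> (\<Sum>n\<in>E. \<Sum>j\<in>A. u j * Tb + (\<Sum>l\<in>L. c n j l))" using cover by (intro sum_mono) auto
    also have "\<dots> = real (card E) * U * Tb + (\<Sum>n\<in>E. \<Sum>j\<in>A. \<Sum>l\<in>L. c n j l)"
      by (simp add: sum.distrib U sum_distrib_right mult.assoc)
    also have "(\<Sum>n\<in>E. \<Sum>j\<in>A. \<Sum>l\<in>L. c n j l) \<le> (\<Sum>n\<in>I. \<Sum>j\<in>A. \<Sum>l\<in>L. c n j l)"
      using E c0 by (intro sum_mono2 sum_nonneg) (auto simp: I_def)
    also have "\<dots> = (\<Sum>j\<in>A. \<Sum>n\<in>I. \<Sum>l\<in>L. c n j l)" by (rule sum.swap)
    also have "\<dots> = (\<Sum>j\<in>A. \<Sum>l\<in>L. \<Sum>n\<in>I. c n j l)" by (intro sum.cong refl sum.swap)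
    also have "\<dots> \<le> (\<Sum>j\<in>A. \<Sum>l\<in>L. if l dvd a j then u j * (real (card S) * (1184 * real X / real l)) else 0)"
      using cn by (intro sum_mono) auto
    also have "\<dots> = (\<Sum>l\<in>L. \<Sum>j\<in>A. if l dvd a j then u j * (real (card S) * (1184 * real X / real l)) else 0)" by (rule sum.swap)
    also have "\<dots> \<le> (\<Sum>l\<in>L. real (card S) * (1184 * real X) * (63 / (real W * (real l)\<^sup>2) + 1 / (real W * real J * real l)))"
      using jl by (intro sum_mono) auto
    also have "\<dots> = real (card S) * (1184 * real X) * (\<Sum>l\<in>L. 63 / (real W * (real l)\<^sup>2) + 1 / (real W * real J * real l))"
      by (simp only: sum_distrib_left)
    also have "\<dots> \<le> real (card S) * (1184 * real X) * (63 / (real W * real z) + (1 + ln (real (64 * W * J))) / (real W * real J))"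
      using Lsum by (intro mult_left_mono) auto
    finally show ?thesis by simp
  qed
  show ?thesis using lower upper by (simp only: S_def Tb_def H_def)
qed

section \<open>The density of the good degrees\<close>

lemma tau_bounds: "0 < tau" "tau < 2"
proof -
  have l: "4 \<le> ln (64::real)" unfolding ln_64(1) using ln2_ge_two_thirds by simp
  then show "0 < tau" by (simp add: tau_def)
  have "2 * pi < 2 * ln 64" using l pi_less_4 by linarith
  then show "tau < 2" using l by (simp add: tau_def field_simps)
qed

lemma nat_floor_powr:
  fixes x c :: real
  assumes x: "1 \<le> x" and c: "0 \<le> c"
  defines "k \<equiv> nat \<lfloor>c * log 2 x\<rfloor>"
  shows "2 ^ k \<le> x powr c" "x powr c < 2 * 2 ^ k" "real k \<le> c * log 2 x" "c * log 2 x < real k + 1"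
proof -
  have nn: "0 \<le> c * log 2 x" using x c by simp
  then show k: "real k \<le> c * log 2 x" "c * log 2 x < real k + 1" unfolding k_def by linarith+
  have eq: "2 powr (c * log 2 x) = x powr c"
  proof -
    have "(2 powr log 2 x) powr c = 2 powr (log 2 x * c)" by (rule powr_powr)
    moreover have "2 powr log 2 x = x" using x by (intro powr_log_cancel) auto
    ultimately show ?thesis by (simp only: mult.commute)
  qed
  have "2 powr real k \<le> 2 powr (c * log 2 x)" using k by (intro powr_mono) auto
  then show "2 ^ k \<le> x powr c" unfolding eq by (simp add: powr_realpow)
  have "2 powr (c * log 2 x) < 2 powr (real k + 1)" using k by (intro powr_less_mono) auto
  then show "x powr c < 2 * 2 ^ k" unfolding eq by (simp add: powr_add powr_realpow)
qed

lemma log2_le: "1 \<le> x \<Longrightarrow> log 2 x \<le> 2 * ln (x::real)"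
proof -
  assume x: "1 \<le> x"
  have "ln x * (2 / 3) \<le> ln x * ln 2" using ln2_ge_two_thirds x by (intro mult_left_mono) auto
  then have "ln x \<le> 2 * ln x * ln 2" using x ln_ge_zero[OF x] by linarith
  then show ?thesis by (simp add: log_def divide_le_eq)
qed

lemma smooth_count:
  fixes X :: nat and \<delta> :: real
  assumes X: "1 < X" and \<delta>: "0 \<le> \<delta>"
  shows "real (card {n \<in> {X<..2 * X}. \<forall>p. prime p \<longrightarrow> p dvd n \<longrightarrow> p \<le> 2 ^ nat \<lfloor>\<delta> * log 2 (real X)\<rfloor>}) \<le> 8 * \<delta> * real X"
proof -
  define k where "k = nat \<lfloor>\<delta> * log 2 (real X)\<rfloor>"
  have lnX: "0 < ln (real X)" using X by simp
  have "real k \<le> \<delta> * log 2 (real X)" unfolding k_def using X \<delta> by (intro nat_floor_powr) auto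
  then have "real k * ln 2 \<le> \<delta> * log 2 (real X) * ln 2" by (intro mult_right_mono) auto
  then have k: "real k * ln 2 \<le> \<delta> * ln (real X)" by (simp add: log_def)
  let ?C = "real (card {n \<in> {X<..2 * X}. \<forall>p. prime p \<longrightarrow> p dvd n \<longrightarrow> p \<le> 2 ^ k})"
  have "?C * ln (real X) \<le> 4 * real (2 * X) * real k * ln 2" by (rule card_smooth_le[OF X])
  also have "\<dots> = 8 * real X * (real k * ln 2)" by simp
  also have "\<dots> \<le> 8 * real X * (\<delta> * ln (real X))" using k by (intro mult_left_mono) auto
  also have "\<dots> = (8 * \<delta> * real X) * ln (real X)" by simp
  finally show ?thesis using lnX unfolding k_def by (simp only: mult_le_cancel_right_pos)
qed

text \<open>If the exceptions that are not smooth exceeded half of \<epsilon> X,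
  \<open>exceptional_inequality\<close> would fail; the smooth numbers take the other half.
  Frequencies run up to about 2 X while J is about X^d up to logarithms, so the exponent 4/d for
  \<open>dirichlet_sum_bound\<close> covers them.\<close>

theorem window_exceptions:
  fixes \<epsilon> :: real
  assumes \<epsilon>: "0 < \<epsilon>" "\<epsilon> \<le> 1"
  shows "\<exists>X0. \<forall>X\<ge>X0. real (card ({X<..2 * X} - invariably_prime_generated)) \<le> \<epsilon> * real X"
proof -
  \<comment> \<open>Smoothness at level X^(10 d) costs 8 * 10 d X, which is half of \<epsilon>
    X.\<close>
  define d where "d = \<epsilon> / 160"
  have d: "0 < d" "d \<le> 1 / 160" using \<epsilon> by (auto simp: d_def)
  \<comment> \<open>1193472 = 16 * 1184 * 63, so that the contribution of common prime factors is at
    most \<epsilon>/16.\<close>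
  define z where "z = nat \<lceil>1193472 / \<epsilon>\<rceil> + 1"
  have z1: "1 \<le> z" by (simp add: z_def)
  have "1193472 / \<epsilon> \<le> real z" unfolding z_def by linarith
  then have z2: "74592 / real z \<le> \<epsilon> / 16" using \<epsilon> z1 by (simp add: field_simps)
  define W :: nat where "W = fact z"
  have W1: "1 \<le> W" by (simp add: W_def)
  have Wr: "1 \<le> real W" using W1 by simp
  have E: "1 \<le> 4 / d" using d by (simp add: field_simps)
  have "0 < W" using W1 by simp
  from dirichlet_sum_bound[OF this E] obtain \<eta> J0 where \<eta>: "0 < \<eta>"
    and DS': "\<forall>J\<ge>J0. \<forall>t (u::nat). 0 < t \<and> t \<le> real J powr (4 / d) \<and> t * ln 64 = 2 * pi * real u
      \<longrightarrow> norm (dirichlet_sum W J t) \<le> 1024 * real J powr (- \<eta>)"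
    by (elim exE conjE)
  have DS: "norm (dirichlet_sum W J t) \<le> 1024 * real J powr (- \<eta>)"
    if "J0 \<le> J" "0 < t" "t \<le> real J powr (4 / d)" "t * ln 64 = 2 * pi * real u" for J t and u :: nat
    using DS'[rule_format, OF that(1)] that(2-) by blast
  define w where "w = real W"
  have w1: "1 \<le> w" using Wr by (simp add: w_def)
  \<comment> \<open>One growth condition per later estimate. The constants are 4225 = 65^2 for the
    lower bound on b, 192 = 3 * 64 for a b < r, 905969664 = 16 * 6 * 256 * 36864 for the kernel
    tail, and 151552 = 1024 * 148 for the nonzero frequencies.\<close>
  have ev: "eventually (\<lambda>x::real. real J0 + 2 \<le> x powr d / (16 * w)) at_top"
     "eventually (\<lambda>x::real. 9 \<le> (1 - d) * log 2 x) at_top"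
     "eventually (\<lambda>x::real. 4 * (x powr d * (ln x)^2)^3 \<le> x) at_top"
     "eventually (\<lambda>x::real. 4225 * w^2 * (2 * ln x + 4) \<le> x powr d / (16 * w)) at_top"
     "eventually (\<lambda>x::real. 192 * w * (x powr d * (ln x)^2)^4 \<le> x powr (10 * d) / 2) at_top"
     "eventually (\<lambda>x::real. 9 * (x powr d * (ln x)^2)^6 \<le> x powr (1 - d) / (8 * (ln x)^2)) at_top"
     "eventually (\<lambda>x::real. 905969664 * w^2 * (4 * (ln x)^2) \<le> (x powr d / (16 * w))^2) at_top"
     "eventually (\<lambda>x::real. 151552 * w * (2 * ln x) * (x powr d / (16 * w)) powr (-\<eta>) \<le> \<epsilon> / 16) at_top"
     "eventually (\<lambda>x::real. 1184 * (1 + 2 * ln x) / (x powr d / (16 * w)) \<le> \<epsilon> / 32) at_top"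
     "eventually (\<lambda>x::real. 2 * x \<le> (x powr d / (16 * w)) powr (4 / d)) at_top"
     "eventually (\<lambda>x::real. 8 \<le> x) at_top"
    using d w1 \<eta> \<epsilon>(1) by (real_asymp, real_asymp, real_asymp, real_asymp, real_asymp, real_asymp, real_asymp, real_asymp, real_asymp, real_asymp, real_asymp)
  have "eventually (\<lambda>x::real. (real J0 + 2 \<le> x powr d / (16 * w) \<and> 9 \<le> (1 - d) * log 2 x \<and>
     4 * (x powr d * (ln x)^2)^3 \<le> x \<and> 4225 * w^2 * (2 * ln x + 4) \<le> x powr d / (16 * w) \<and>
     192 * w * (x powr d * (ln x)^2)^4 \<le> x powr (10 * d) / 2 \<and>
     9 * (x powr d * (ln x)^2)^6 \<le> x powr (1 - d) / (8 * (ln x)^2)) \<and>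
     905969664 * w^2 * (4 * (ln x)^2) \<le> (x powr d / (16 * w))^2 \<and>
     151552 * w * (2 * ln x) * (x powr d / (16 * w)) powr (-\<eta>) \<le> \<epsilon> / 16 \<and>
     1184 * (1 + 2 * ln x) / (x powr d / (16 * w)) \<le> \<epsilon> / 32 \<and>
     2 * x \<le> (x powr d / (16 * w)) powr (4 / d) \<and> 8 \<le> x) at_top"
    by (intro eventually_conj ev)
  then obtain X0 :: real where X0: "\<And>x. X0 \<le> x \<Longrightarrow> (real J0 + 2 \<le> x powr d / (16 * w) \<and> 9 \<le> (1 - d) * log 2 x \<and>
     4 * (x powr d * (ln x)^2)^3 \<le> x \<and> 4225 * w^2 * (2 * ln x + 4) \<le> x powr d / (16 * w) \<and>
     192 * w * (x powr d * (ln x)^2)^4 \<le> x powr (10 * d) / 2 \<and>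
     9 * (x powr d * (ln x)^2)^6 \<le> x powr (1 - d) / (8 * (ln x)^2)) \<and>
     905969664 * w^2 * (4 * (ln x)^2) \<le> (x powr d / (16 * w))^2 \<and>
     151552 * w * (2 * ln x) * (x powr d / (16 * w)) powr (-\<eta>) \<le> \<epsilon> / 16 \<and>
     1184 * (1 + 2 * ln x) / (x powr d / (16 * w)) \<le> \<epsilon> / 32 \<and>
     2 * x \<le> (x powr d / (16 * w)) powr (4 / d) \<and> 8 \<le> x"
    unfolding eventually_at_top_linorder by blast
  show ?thesis
  proof (intro exI[of _ "nat \<lceil>X0\<rceil>"] allI impI)
    fix X :: nat assume "nat \<lceil>X0\<rceil> \<le> X"
    then have XX: "X0 \<le> real X" by linarith
    define x where "x = real X"
    define lx where "lx = ln x"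
    \<comment> \<open>jl and jh will enclose J; they differ by a power of the logarithm because P is
      only known up to such a factor.\<close>
    define jl where "jl = x powr d / (16 * w)"
    define jh where "jh = x powr d * lx\<^sup>2"
    have c: "real J0 + 2 \<le> jl" "9 \<le> (1 - d) * log 2 x" "4 * jh ^ 3 \<le> x" "4225 * w\<^sup>2 * (2 * lx + 4) \<le> jl"
      "192 * w * jh ^ 4 \<le> x powr (10 * d) / 2" "9 * jh ^ 6 \<le> x powr (1 - d) / (8 * lx\<^sup>2)"
      "905969664 * w\<^sup>2 * (4 * lx\<^sup>2) \<le> jl\<^sup>2" "151552 * w * (2 * lx) * jl powr (- \<eta>) \<le> \<epsilon> / 16"
      "1184 * (1 + 2 * lx) / jl \<le> \<epsilon> / 32" "2 * x \<le> jl powr (4 / d)" "8 \<le> x"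
      using X0[OF XX] by (auto simp: jl_def jh_def lx_def x_def)
    have lx0: "0 < lx" using c(11) by (simp add: lx_def)
    have jl0: "2 \<le> jl" using c(1) by linarith
    have w0: "0 < w" using w1 by simp
    define \<kappa> where "\<kappa> = nat \<lfloor>(1 - d) * log 2 x\<rfloor>"
    have x1: "1 \<le> x" "1 < x" using c(11) by auto
    have \<kappa>: "2 ^ \<kappa> \<le> x powr (1 - d)" "x powr (1 - d) < 2 * 2 ^ \<kappa>" "real \<kappa> \<le> (1 - d) * log 2 x" "(1 - d) * log 2 x < real \<kappa> + 1"
      unfolding \<kappa>_def using x1 d by (intro nat_floor_powr; simp)+
    have \<kappa>8: "8 \<le> \<kappa>" using \<kappa>(4) c(2) by linarith
    have \<kappa>l: "real \<kappa> \<le> 2 * lx"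
    proof -
      have "(1 - d) * log 2 x \<le> 1 * log 2 x" using d x1 by (intro mult_right_mono) auto
      then show ?thesis using \<kappa>(3) log2_le[OF x1(1)] by (simp add: lx_def)
    qed
    obtain i where i: "i < \<kappa>" "2 ^ \<kappa> \<le> 2 ^ i * real \<kappa> ^ 2" "2 ^ i \<le> real (card (prime_window (2 ^ i))) * real \<kappa> ^ 2"
      using prime_window_exists[OF \<kappa>8] by blast
    define P :: nat where "P = 2 ^ i"
    define S where "S = prime_window P"
    define Q where "Q = real (card S)"
    have P1: "1 \<le> P" by (simp add: P_def)
    have rP: "real P = 2 ^ i" by (simp add: P_def)
    have PQ: "real P \<le> Q * real \<kappa> ^ 2" using i(3) by (simp add: Q_def S_def P_def)
    have Q0: "0 < Q"
    proof -
      have "0 < Q * real \<kappa> ^ 2" using PQ P1 by linarith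
      then show ?thesis by (simp add: zero_less_mult_iff Q_def)
    qed
    have Pup: "real P \<le> x powr (1 - d)"
    proof -
      have "real P \<le> 2 ^ \<kappa>" unfolding rP using i(1) by (intro power_increasing) auto
      then show ?thesis using \<kappa>(1) by linarith
    qed
    have \<kappa>sq: "real \<kappa> ^ 2 \<le> 4 * lx\<^sup>2"
    proof -
      have "real \<kappa> ^ 2 \<le> (2 * lx)\<^sup>2" using \<kappa>l by (intro power_mono) auto
      then show ?thesis by (simp add: power_mult_distrib)
    qed
    have Plow: "x powr (1 - d) \<le> real P * (8 * lx\<^sup>2)"
    proof -
      have "x powr (1 - d) \<le> 2 * (real P * real \<kappa> ^ 2)" using \<kappa>(2) i(2) unfolding rP by linarith
      also have "\<dots> \<le> 2 * (real P * (4 * lx\<^sup>2))" using \<kappa>sq by (intro mult_left_mono) auto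
      finally show ?thesis by simp
    qed
    \<comment> \<open>Chosen to give 8 W J P \<le> X < 16 W J P, so that the products a p stay
      between X/16 and 16 X.\<close>
    define J where "J = X div (8 * W * P)"
    have den: "0 < 8 * W * P" using W1 P1 by simp
    have split: "x powr d * x powr (1 - d) = x" using x1 by (simp add: powr_add[symmetric])
    have Jup': "real J * (8 * w * real P) \<le> x"
    proof -
      have "J * (8 * W * P) \<le> X" unfolding J_def by (rule div_times_less_eq_dividend)
      then have "real (J * (8 * W * P)) \<le> real X" by (simp only: of_nat_le_iff)
      then show ?thesis by (simp add: w_def x_def)
    qed
    have Jlow': "x < (real J + 1) * (8 * w * real P)"
    proof -
      have "X < (J + 1) * (8 * W * P)" unfolding J_def using den by (metis Suc_eq_plus1 dividend_less_div_times add.commute mult_Suc)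
      then have "real X < real ((J + 1) * (8 * W * P))" by (simp only: of_nat_less_iff)
      also have "\<dots> = (real J + 1) * (8 * w * real P)" by (simp only: of_nat_mult of_nat_add of_nat_1 of_nat_numeral w_def)
      finally show ?thesis by (simp only: x_def)
    qed
    have Jlow: "jl \<le> real J"
    proof -
      have "(real J + 1) * (8 * w * real P) \<le> (real J + 1) * (8 * w * x powr (1 - d))"
        using Pup w0 by (intro mult_left_mono) auto
      then have "x < (real J + 1) * (8 * w * x powr (1 - d))" using Jlow' by linarith
      then have "x powr d * x powr (1 - d) < ((real J + 1) * (8 * w)) * x powr (1 - d)" unfolding split by (simp only: mult.assoc)
      then have "x powr d < (real J + 1) * (8 * w)" using x1 by (simp only: mult_less_cancel_right_pos powr_gt_zero)
      then have "2 * jl < real J + 1" using w0 by (simp add: jl_def field_simps)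
      then show ?thesis using jl0 by linarith
    qed
    have Jup: "real J \<le> jh"
    proof -
      have "real J * (8 * w * real P) \<le> x powr d * (real P * (8 * lx\<^sup>2))"
      proof -
        have "x powr d * x powr (1 - d) \<le> x powr d * (real P * (8 * lx\<^sup>2))" using Plow by (intro mult_left_mono) auto
        then show ?thesis using Jup' split by linarith
      qed
      then have "(real J * w) * (8 * real P) \<le> jh * (8 * real P)" by (simp add: jh_def mult_ac)
      then have "real J * w \<le> jh" using P1 by simp
      moreover have "real J * 1 \<le> real J * w" using w1 by (intro mult_left_mono) auto
      ultimately show ?thesis by linarith
    qed
    have J1: "1 \<le> J" "J0 \<le> J" using Jlow jl0 c(1) by linarith+
    have Jpos: "0 < real J" using J1 by simp
    have cond1: "8 * W * J * P \<le> X"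
      using div_times_less_eq_dividend[of X "8 * W * P"] by (simp add: J_def mult_ac)
    have cond2: "X < 16 * W * J * P"
    proof -
      have "(real J + 1) * (8 * w * real P) \<le> (2 * real J) * (8 * w * real P)" using J1 w0 by (intro mult_right_mono) auto
      then have "real X < real (16 * W * J * P)" using Jlow' by (simp add: x_def w_def mult_ac)
      then show ?thesis by (simp only: of_nat_less_iff)
    qed
    have cond3: "4 * J ^ 3 \<le> X"
    proof -
      have "4 * real J ^ 3 \<le> 4 * jh ^ 3" using Jup by (intro mult_left_mono power_mono) auto
      then have "real (4 * J ^ 3) \<le> real X" using c(3) by (simp add: x_def)
      then show ?thesis by (simp only: of_nat_le_iff)
    qed
    define \<eta>' where "\<eta>' = 1024 * real J powr (- \<eta>)"
    have small: "norm (\<Sum>j\<in>{J..<64 * J}. of_real (1 / real (1 + W * j)) * cis (real u * (tau * ln (real (1 + W * j))))) \<le> \<eta>'"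
      if u: "0 < u" "u < P" for u
    proof -
      have "(\<Sum>j\<in>{J..<64 * J}. of_real (1 / real (1 + W * j)) * cis (real u * (tau * ln (real (1 + W * j))))) = dirichlet_sum W J (real u * tau)"
        unfolding dirichlet_sum_def by (intro sum.cong refl) (simp add: mult.assoc)
      moreover have "norm (dirichlet_sum W J (real u * tau)) \<le> \<eta>'" unfolding \<eta>'_def
      proof (rule DS[OF J1(2), of _ u])
        show "0 < real u * tau" using u tau_bounds by simp
        show "real u * tau * ln 64 = 2 * pi * real u" by (simp add: tau_def)
        have "real u * tau \<le> real P * 2" using u tau_bounds by (intro mult_mono) auto
        also have "\<dots> \<le> 2 * x"
        proof -
          have "x powr (1 - d) \<le> x powr 1" using x1 d by (intro powr_mono) auto
          then show ?thesis using Pup x1 by simp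
        qed
        also have "\<dots> \<le> jl powr (4 / d)" by (rule c(10))
        also have "\<dots> \<le> real J powr (4 / d)" using Jlow jl0 d by (intro powr_mono2) auto
        finally show "real u * tau \<le> real J powr (4 / d)" .
      qed
      ultimately show ?thesis by simp
    qed
    \<comment> \<open>A prime r above 2^js exceeds X^(10 d)/2, well above a b, which is about X^(4
      d) up to logarithms and constants.\<close>
    define js where "js = nat \<lfloor>(10 * d) * log 2 x\<rfloor>"
    have js: "x powr (10 * d) < 2 * 2 ^ js" unfolding js_def using x1 d by (intro nat_floor_powr(2)) auto
    define smooth where "smooth = {n \<in> {X<..2 * X}. \<forall>p. prime p \<longrightarrow> p dvd n \<longrightarrow> p \<le> 2 ^ js}"
    define E where "E = {n \<in> {X<..2 * X}. n \<notin> invariably_prime_generated} - smooth"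
    have ES: "E \<subseteq> {X<..2 * X}" by (auto simp: E_def)
    \<comment> \<open>Contrapositive: a coprime pair with a p near n - 2 J^3 yields an admissible b
      = n - a p, and then \<open>invariably_prime_generatedI\<close> shows that n is not
      exceptional.\<close>
    have tail: "real (J ^ 3) < \<bar>real ((1 + W * j) * p) - (real n - 2 * real (J ^ 3))\<bar>"
      if n: "n \<in> E" and j: "j \<in> {J..<64 * J}" and p: "p \<in> prime_window P" and cop: "coprime (1 + W * j) n" for n j p
    proof (rule ccontr)
      assume neg: "\<not> ?thesis"
      define a where "a = 1 + W * j"
      define b where "b = n - a * p"
      have nX: "X < n" "n \<le> 2 * X" "n \<notin> invariably_prime_generated" using n by (auto simp: E_def)
      obtain r where r: "prime r" "r dvd n" "2 ^ js < r" using n by (auto simp: E_def smooth_def not_le)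
      have pp: "prime p" "P < p" using p by (auto simp: prime_window_def)
      have close: "\<bar>real (a * p) - (real n - 2 * real (J ^ 3))\<bar> \<le> real (J ^ 3)" using neg unfolding a_def by linarith
      have J3: "0 < real (J ^ 3)" using J1 by simp
      have "real (a * p) \<le> real n" using close J3 by linarith
      then have apn: "a * p \<le> n" by (simp only: of_nat_le_iff)
      have rb: "real b = real n - real (a * p)" unfolding b_def using apn by (simp only: of_nat_diff)
      have b_lo: "real (J ^ 3) \<le> real b" and b_hi: "real b \<le> 3 * real (J ^ 3)" using close unfolding rb by linarith+
      have nab: "n = a * p + b" using apn by (simp add: b_def)
      have a_hi: "a \<le> 64 * W * J"
      proof -
        have "a \<le> W * Suc j" using W1 by (simp add: a_def)
        also have "\<dots> \<le> W * (64 * J)" using j by (intro mult_le_mono) auto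
        finally show ?thesis by (simp add: mult_ac)
      qed
      \<comment> \<open>The bit length for n \<le> 2 x; it is logarithmic in x, so b, of size J^3,
        still dominates a^2 l.\<close>
      define l where "l = nat \<lfloor>1 * log 2 (2 * x)\<rfloor> + 1"
      have xx: "1 \<le> 2 * x" using x1 by simp
      have l1: "2 * x < 2 ^ l" using nat_floor_powr(2)[OF xx, of 1] x1 unfolding l_def by simp
      have l2: "real l \<le> 2 * lx + 2"
      proof -
        have "real l \<le> log 2 (2 * x) + 1" using nat_floor_powr(3)[OF xx, of 1] unfolding l_def by simp
        also have "log 2 (2 * x) = 1 + log 2 x" using x1 by (simp add: log_mult)
        also have "log 2 x \<le> 2 * lx" unfolding lx_def by (rule log2_le[OF x1(1)])
        finally show ?thesis by simp
      qed
      have nl: "n < 2 ^ l"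
      proof -
        have "real n \<le> 2 * x" using nX by (simp add: x_def)
        also have "\<dots> < real (2 ^ l)" using l1 by (simp only: of_nat_power of_nat_numeral)
        finally show ?thesis by (simp only: of_nat_less_iff)
      qed
      have big: "(a + 1) * (2 * (a + 1) + a * l) \<le> b"
      proof -
        have WJ1: "1 \<le> W * J" using mult_le_mono[of 1 W 1 J] W1 J1 by simp
        have a1: "a + 1 \<le> 65 * (W * J)" using a_hi WJ1 by linarith
        have "(a + 1) * (2 * (a + 1) + a * l) \<le> (65 * (W * J)) * (2 * (65 * (W * J)) + (65 * (W * J)) * l)"
          using a1 by (intro mult_le_mono add_le_mono) auto
        also have "\<dots> = 4225 * (W * J)\<^sup>2 * (l + 2)" by (simp add: power2_eq_square algebra_simps)
        finally have "real ((a + 1) * (2 * (a + 1) + a * l)) \<le> real (4225 * (W * J)\<^sup>2 * (l + 2))" by (simp only: of_nat_le_iff)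
        also have "\<dots> = (real J)\<^sup>2 * (4225 * w\<^sup>2 * (real l + 2))" by (simp add: w_def power_mult_distrib algebra_simps)
        also have "\<dots> \<le> (real J)\<^sup>2 * (4225 * w\<^sup>2 * (2 * lx + 4))" using l2 by (intro mult_left_mono) auto
        also have "\<dots> \<le> (real J)\<^sup>2 * real J" using c(4) Jlow by (intro mult_left_mono) auto
        also have "\<dots> = real (J ^ 3)" by (simp add: power2_eq_square power3_eq_cube)
        also have "\<dots> \<le> real b" by (rule b_lo)
        finally show ?thesis by (simp only: of_nat_le_iff)
      qed
      have bsq: "b\<^sup>2 < p"
      proof -
        have "(real b)\<^sup>2 \<le> (3 * real (J ^ 3))\<^sup>2" using b_hi by (intro power_mono) auto
        also have "\<dots> = 9 * real J ^ 6" by (simp add: power_mult_distrib power_mult[symmetric])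
        also have "\<dots> \<le> 9 * jh ^ 6" using Jup by (intro mult_left_mono power_mono) auto
        also have "\<dots> \<le> x powr (1 - d) / (8 * lx\<^sup>2)" by (rule c(6))
        also have "\<dots> \<le> real P" using Plow lx0 by (simp add: divide_le_eq)
        also have "\<dots> < real p" using pp by simp
        finally have "real (b\<^sup>2) < real p" by simp
        then show ?thesis by (simp only: of_nat_less_iff)
      qed
      have ab: "a * b < r"
      proof -
        have "real (a * b) \<le> (64 * w * real J) * (3 * real (J ^ 3))"
        proof -
          have "real a \<le> real (64 * W * J)" using a_hi by (simp only: of_nat_le_iff)
          then have "real a \<le> 64 * w * real J" by (simp add: w_def)
          then show ?thesis using b_hi w0 by (simp only: of_nat_mult) (intro mult_mono, auto)
        qed
        also have "\<dots> = 192 * w * real J ^ 4" by (simp add: power_numeral_reduce)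
        also have "\<dots> \<le> 192 * w * jh ^ 4" using Jup w0 by (intro mult_left_mono power_mono) auto
        also have "\<dots> \<le> x powr (10 * d) / 2" by (rule c(5))
        also have "\<dots> < 2 ^ js" using js by simp
        also have "\<dots> < real r" using r(3) by (metis of_nat_less_iff of_nat_numeral of_nat_power)
        finally show ?thesis by (simp only: of_nat_less_iff)
      qed
      have a0: "0 < a" by (simp add: a_def)
      have ab': "a + 1 \<le> b"
      proof -
        have "(a + 1) * 1 \<le> (a + 1) * (2 * (a + 1) + a * l)" by (intro mult_le_mono) auto
        then have "a + 1 \<le> (a + 1) * (2 * (a + 1) + a * l)" by (simp only: mult_1_right)
        then show ?thesis using big by (rule order_trans)
      qed
      have bp: "b < p" by (rule le_less_trans[OF le_square bsq[unfolded power2_eq_square]])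
      have cab: "coprime a b"
      proof -
        have "coprime a n" using cop by (simp add: a_def)
        moreover have "c dvd n" if "c dvd a" "c dvd b" for c using that unfolding nab by simp
        ultimately show ?thesis by (intro coprimeI) (rule coprime_common_divisor, blast+)
      qed
      have "(b - 1)\<^sup>2 \<le> b\<^sup>2" by (intro power_mono) auto
      then have bm: "(b - 1)\<^sup>2 < p" using bsq by linarith
      have "odd r"
      proof -
        have "2 * 1 \<le> a * b"
        proof -
          have "2 \<le> b" using ab' a0 by linarith
          then show ?thesis using a0 mult_le_mono[of 1 a 2 b] by simp
        qed
        then have "2 < r" using ab by linarith
        then show ?thesis using r(1) prime_odd_nat by blast
      qed
      then have "n \<in> invariably_prime_generated"
        using invariably_prime_generatedI[of p b a r n l] pp(1) bp ab' bm r ab nab nl a0 cab big by linarith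
      then show False using nX by simp
    qed
    define N where "N = real (card E)"
    define U where "U = (\<Sum>j\<in>{J..<64 * J}. 1 / real (1 + W * j))"
    define Tb where "Tb = 36864 * (real X)\<^sup>2 / real P * (2 / (real (J ^ 3))\<^sup>2 + 4 / (real J * real (J ^ 3)))"
    have main: "N * Q * U - \<eta>' * sqrt (148 * x * N) * sqrt (148 * real P * Q)
      \<le> N * U * Tb + Q * (1184 * x) * (63 / (w * real z) + (1 + ln (real (64 * W * J))) / (w * real J))"
      using exceptional_inequality[OF z1 W_def J1(1) P1 cond1 cond2 cond3 _ small ES tail]
      unfolding N_def Q_def S_def U_def Tb_def x_def w_def \<eta>'_def by simp
    have NX: "N \<le> x"
    proof -
      have "card E \<le> card {X<..2 * X}" by (intro card_mono ES) simp
      then show ?thesis by (simp add: N_def x_def)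
    qed
    have N0: "0 \<le> N" by (simp add: N_def)
    have Ulow: "1 / (2 * w) \<le> U"
    proof -
      have "(\<Sum>j\<in>{J..<64 * J}. 1 / (64 * w * real J)) \<le> U" unfolding U_def
      proof (rule sum_mono)
        fix j assume j: "j \<in> {J..<64 * J}"
        have "1 + W * j \<le> W * Suc j" using W1 by simp
        also have "\<dots> \<le> W * (64 * J)" using j by (intro mult_le_mono) auto
        finally have "real (1 + W * j) \<le> real (W * (64 * J))" by (simp only: of_nat_le_iff)
        then have "real (1 + W * j) \<le> 64 * w * real J" by (simp add: w_def mult_ac)
        then show "1 / (64 * w * real J) \<le> 1 / real (1 + W * j)"
          using w0 Jpos by (intro divide_left_mono mult_pos_pos) (auto simp: add_pos_nonneg)
      qed
      moreover have "(\<Sum>j\<in>{J..<64 * J}. 1 / (64 * w * real J)) = 63 / (64 * w)" using Jpos by simp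
      moreover have "1 / (2 * w) \<le> 63 / (64 * w)" using w0 by (simp add: field_simps)
      ultimately show ?thesis by linarith
    qed
    have Tb: "Tb \<le> Q / 16"
    proof -
      have J6: "2 / (real (J ^ 3))\<^sup>2 \<le> 2 / real J ^ 4"
      proof -
        have "real J ^ 4 \<le> real J ^ 6" using J1 by (intro power_increasing) auto
        moreover have "(real (J ^ 3))\<^sup>2 = real J ^ 6" by (simp add: power_mult[symmetric])
        ultimately show ?thesis using Jpos by (intro divide_left_mono) auto
      qed
      have J4: "4 / (real J * real (J ^ 3)) = 4 / real J ^ 4" by (simp add: power_numeral_reduce)
      have "Tb \<le> 36864 * (real X)\<^sup>2 / real P * (6 / real J ^ 4)"
        unfolding Tb_def J4 using J6 by (intro mult_left_mono) auto
      also have "(real X)\<^sup>2 \<le> (16 * w * real J * real P)\<^sup>2"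
      proof (rule power_mono)
        have "real X \<le> real (16 * W * J * P)" using cond2 by (simp only: of_nat_le_iff)
        then show "real X \<le> 16 * w * real J * real P" by (simp add: w_def)
      qed simp
      then have "36864 * (real X)\<^sup>2 / real P * (6 / real J ^ 4) \<le> 36864 * (16 * w * real J * real P)\<^sup>2 / real P * (6 / real J ^ 4)"
        by (intro mult_right_mono divide_right_mono mult_left_mono) auto
      also have "\<dots> = 56623104 * w\<^sup>2 * real P / (real J)\<^sup>2"
        using P1 Jpos by (simp add: power_mult_distrib field_simps power_numeral_reduce)
      also have "\<dots> \<le> 56623104 * w\<^sup>2 * (Q * (4 * lx\<^sup>2)) / (real J)\<^sup>2"
      proof (intro divide_right_mono mult_left_mono)
        have "Q * real \<kappa> ^ 2 \<le> Q * (4 * lx\<^sup>2)" using \<kappa>sq Q0 by (intro mult_left_mono) auto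
        then show "real P \<le> Q * (4 * lx\<^sup>2)" using PQ by linarith
      qed auto
      also have "\<dots> = Q / 16 * (905969664 * w\<^sup>2 * (4 * lx\<^sup>2) / (real J)\<^sup>2)" by simp
      also have "\<dots> \<le> Q / 16 * 1"
      proof (intro mult_left_mono)
        have "jl\<^sup>2 \<le> (real J)\<^sup>2" using Jlow jl0 by (intro power_mono) auto
        then show "905969664 * w\<^sup>2 * (4 * lx\<^sup>2) / (real J)\<^sup>2 \<le> 1" using c(7) Jpos by (simp add: divide_le_eq)
      qed (use Q0 in auto)
      finally show ?thesis by simp
    qed
    \<comment> \<open>Uses N \<le> x trivially and P \<le> Q \<kappa>^2; the sparsity of the primes
      in the window costs only the factor \<kappa>.\<close>
    have sq: "sqrt (148 * x * N) * sqrt (148 * real P * Q) \<le> 148 * x * (real \<kappa> * Q)"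
    proof -
      have "sqrt (148 * x * N) * sqrt (148 * real P * Q) \<le> sqrt (148 * x * x) * sqrt (148 * (Q * real \<kappa> ^ 2) * Q)"
        using NX N0 PQ x1 Q0 by (intro mult_mono real_sqrt_le_mono mult_left_mono mult_right_mono) auto
      also have "\<dots> = sqrt ((148 * x * (real \<kappa> * Q))\<^sup>2)"
        by (simp only: real_sqrt_mult[symmetric]) (simp add: power2_eq_square mult_ac)
      also have "\<dots> = 148 * x * (real \<kappa> * Q)" using x1 Q0 by (simp add: real_sqrt_abs)
      finally show ?thesis .
    qed
    have NE: "N \<le> \<epsilon> / 2 * x"
    proof (rule ccontr)
      assume "\<not> ?thesis"
      then have Nbig: "\<epsilon> / 2 * x < N" by simp
      have U0: "0 < U" using Ulow w0 by (meson less_le_trans zero_less_divide_1_iff mult_pos_pos zero_less_numeral)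
      have "N * U * Tb \<le> N * U * (Q / 16)" using Tb N0 U0 by (intro mult_left_mono) auto
      moreover have "\<eta>' * sqrt (148 * x * N) * sqrt (148 * real P * Q) \<le> \<eta>' * (148 * x * (real \<kappa> * Q))"
      proof -
        have "\<eta>' * (sqrt (148 * x * N) * sqrt (148 * real P * Q)) \<le> \<eta>' * (148 * x * (real \<kappa> * Q))"
          using sq by (intro mult_left_mono) (auto simp: \<eta>'_def)
        then show ?thesis by (simp only: mult.assoc)
      qed
      ultimately have step: "N * Q * U - \<eta>' * (148 * x * (real \<kappa> * Q)) \<le> N * U * (Q / 16)
          + Q * (1184 * x) * (63 / (w * real z) + (1 + ln (real (64 * W * J))) / (w * real J))" using main by linarith
      have alg: "15 / 16 * (N * U) \<le> e * 148 * x * k + 1184 * x * V"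
        if "N * Q * U - e * (148 * x * (k * Q)) \<le> N * U * (Q / 16) + Q * (1184 * x) * V" for e k V :: real
      proof -
        have "Q * (15 / 16 * (N * U)) \<le> Q * (e * 148 * x * k + 1184 * x * V)"
          using that by (simp add: algebra_simps)
        then show ?thesis using Q0 by (simp only: mult_le_cancel_left_pos)
      qed
      have "15 / 16 * (N * U) \<le> \<eta>' * 148 * x * real \<kappa> + 1184 * x * (63 / (w * real z) + (1 + ln (real (64 * W * J))) / (w * real J))"
        by (rule alg) (rule step)
      moreover have "15 / 16 * (\<epsilon> / 2 * x * (1 / (2 * w))) \<le> 15 / 16 * (N * U)"
        using Nbig Ulow w0 x1 \<epsilon> N0 by (intro mult_left_mono mult_mono) auto
      ultimately have "15 / 16 * (\<epsilon> / 2 * x * (1 / (2 * w))) \<le> \<eta>' * 148 * x * real \<kappa> + 1184 * x * (63 / (w * real z) + (1 + ln (real (64 * W * J))) / (w * real J))"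
        by linarith
      then have "(w / x) * (15 / 16 * (\<epsilon> / 2 * x * (1 / (2 * w)))) \<le> (w / x) * (\<eta>' * 148 * x * real \<kappa> + 1184 * x * (63 / (w * real z) + (1 + ln (real (64 * W * J))) / (w * real J)))"
        using w0 x1 by (intro mult_left_mono) auto
      moreover have "(w / x) * (15 / 16 * (\<epsilon> / 2 * x * (1 / (2 * w)))) = 15 * \<epsilon> / 64" using w0 x1 by (simp add: field_simps)
      moreover have "(w / x) * (\<eta>' * 148 * x * real \<kappa> + 1184 * x * (63 / (w * real z) + (1 + ln (real (64 * W * J))) / (w * real J)))
         = w * \<eta>' * 148 * real \<kappa> + 74592 / real z + 1184 * (1 + ln (real (64 * W * J))) / real J"
        using w0 x1 Jpos z1 by (simp add: field_simps)
      ultimately have fin: "15 * \<epsilon> / 64 \<le> w * \<eta>' * 148 * real \<kappa> + 74592 / real z + 1184 * (1 + ln (real (64 * W * J))) / real J" by linarith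
      have t1: "w * \<eta>' * 148 * real \<kappa> \<le> \<epsilon> / 16"
      proof -
        have "real J powr (- \<eta>) \<le> jl powr (- \<eta>)" using Jlow jl0 \<eta> by (intro powr_mono2') auto
        then have "151552 * w * real \<kappa> * real J powr (- \<eta>) \<le> 151552 * w * (2 * lx) * jl powr (- \<eta>)"
          using \<kappa>l w0 by (intro mult_mono mult_left_mono) auto
        then show ?thesis using c(8) by (simp add: \<eta>'_def mult_ac)
      qed
      have t3: "1184 * (1 + ln (real (64 * W * J))) / real J \<le> \<epsilon> / 32"
      proof -
        have "64 * W * J * P \<le> 8 * X" using cond1 by linarith
        moreover have "64 * W * J * 1 \<le> 64 * W * J * P" using P1 by (intro mult_le_mono) auto
        ultimately have "64 * W * J \<le> 8 * X" by linarith
        then have "real (64 * W * J) \<le> real (8 * X)" by (simp only: of_nat_le_iff)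
        then have "real (64 * W * J) \<le> 8 * x" by (simp add: x_def)
        also have "\<dots> \<le> x * x" using c(11) by (intro mult_right_mono) auto
        finally have "ln (real (64 * W * J)) \<le> ln (x * x)" using W1 J1 by (intro ln_mono) auto
        also have "\<dots> = 2 * lx" using x1 by (simp add: ln_mult lx_def)
        finally have "1184 * (1 + ln (real (64 * W * J))) / real J \<le> 1184 * (1 + 2 * lx) / jl"
          using Jlow jl0 lx0 by (intro frac_le) auto
        then show ?thesis using c(9) by linarith
      qed
      \<comment> \<open>The errors total at most \<epsilon>/16 + \<epsilon>/16 + \<epsilon>/32 = 10
        \<epsilon>/64, less than 15 \<epsilon>/64.\<close>
      show False using fin t1 t3 z2 \<epsilon> by linarith
    qed
    have "card ({X<..2 * X} - invariably_prime_generated) \<le> card E + card smooth"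
    proof -
      have "{X<..2 * X} - invariably_prime_generated \<subseteq> E \<union> smooth" by (auto simp: E_def)
      then have "card ({X<..2 * X} - invariably_prime_generated) \<le> card (E \<union> smooth)"
        by (intro card_mono) (auto simp: E_def smooth_def)
      also have "\<dots> \<le> card E + card smooth" by (rule card_Un_le)
      finally show ?thesis .
    qed
    then have "real (card ({X<..2 * X} - invariably_prime_generated)) \<le> N + real (card smooth)" by (simp add: N_def)
    also have "real (card smooth) \<le> 8 * (10 * d) * real X"
      unfolding smooth_def js_def x_def using c(11) d by (intro smooth_count) (auto simp: x_def)
    also have "8 * (10 * d) * real X = \<epsilon> / 2 * x" by (simp add: d_def x_def)
    finally show "real (card ({X<..2 * X} - invariably_prime_generated)) \<le> \<epsilon> * real X"
      using NE by (simp add: x_def)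
  qed
qed

text \<open>Halving M: the induction gives 3 \<epsilon> X + \<epsilon> X + 1 with X at most M/2,
  hence at most 2 \<epsilon> M + 1, and K is large enough that 1 \<le> \<epsilon> M.\<close>

lemma card_exceptions_le:
  fixes S :: "nat set" and \<epsilon> :: real
  assumes \<epsilon>: "0 < \<epsilon>"
    and X0: "\<And>X. X0 \<le> X \<Longrightarrow> real (card ({X<..2 * X} - S)) \<le> \<epsilon> * real X"
  shows "\<exists>C. \<forall>M. real (card ({1..M} - S)) \<le> C + 3 * \<epsilon> * real M"
proof -
  define K where "K = 2 * X0 + 2 + nat \<lceil>1 / \<epsilon>\<rceil>"
  have "real (card ({1..M} - S)) \<le> real K + 3 * \<epsilon> * real M" for M
  proof (induction M rule: less_induct)
    case (less M)
    show ?case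
    proof (cases "M < K")
      case True
      have "card ({1..M} - S) \<le> card {1..M}" by (intro card_mono) auto
      then have "real (card ({1..M} - S)) \<le> real K" using True by simp
      moreover have "0 \<le> 3 * \<epsilon> * real M" using \<epsilon> by simp
      ultimately show ?thesis by linarith
    next
      case False
      define X where "X = M div 2"
      have X: "X < M" "X0 \<le> X" "M \<le> 2 * X + 1" "2 * X \<le> M" using False unfolding X_def K_def by linarith+
      have "{1..M} - S \<subseteq> ({1..X} - S) \<union> ({X<..2 * X} - S) \<union> {M}" using X by auto
      then have "card ({1..M} - S) \<le> card (({1..X} - S) \<union> ({X<..2 * X} - S) \<union> {M})" by (intro card_mono) auto
      also have "\<dots> \<le> card ({1..X} - S) + card ({X<..2 * X} - S) + 1"
        by (intro order_trans[OF card_Un_le] add_mono card_Un_le) simp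
      finally have "real (card ({1..M} - S)) \<le> real (card ({1..X} - S)) + real (card ({X<..2 * X} - S)) + 1" by linarith
      also have "\<dots> \<le> real K + 3 * \<epsilon> * real X + \<epsilon> * real X + 1" using less.IH[OF X(1)] X0[OF X(2)] by linarith
      finally have *: "real (card ({1..M} - S)) \<le> real K + 4 * (\<epsilon> * real X) + 1" by simp
      have "\<epsilon> * (2 * real X) \<le> \<epsilon> * real M" using X(4) \<epsilon> by (intro mult_left_mono) auto
      moreover have "1 \<le> \<epsilon> * real M"
      proof -
        have "1 / \<epsilon> \<le> real M" using False unfolding K_def by linarith
        then show ?thesis using \<epsilon> by (simp add: field_simps)
      qed
      ultimately show ?thesis using * by linarith
    qed
  qed
  then show ?thesis by blast
qed

lemma asymptotic_density_eq_1I: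
  assumes win: "\<And>\<epsilon>. 0 < \<epsilon> \<Longrightarrow> \<epsilon> \<le> 1 \<Longrightarrow>
    \<exists>X0. \<forall>X\<ge>X0. real (card ({X<..2 * X} - S)) \<le> \<epsilon> * real X"
  shows "asymptotic_density S = 1"
proof (rule antisym)
  have ratio: "real (card (S \<inter> {1..M})) = real M - real (card ({1..M} - S))" for M
  proof -
    have "{1..M} - (S \<inter> {1..M}) = {1..M} - S" by auto
    then have "card ({1..M} - S) = card {1..M} - card (S \<inter> {1..M})" by (metis card_Diff_subset finite_Int finite_atLeastAtMost inf_le2)
    moreover have "card (S \<inter> {1..M}) \<le> card {1..M}" by (intro card_mono) auto
    ultimately show ?thesis by simp
  qed
  have "ereal (real (card (S \<inter> {1..M})) / real M) \<le> 1" for M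
    \<comment> \<open>At M = 0 the quotient is 0 because division by zero yields 0.\<close>
    unfolding ratio by (cases "M = 0") (simp_all add: divide_le_eq)
  then have "asymptotic_density S \<le> liminf (\<lambda>M. 1)"
    unfolding asymptotic_density_def by (intro Liminf_mono always_eventually) auto
  then show "asymptotic_density S \<le> 1" by (simp add: Liminf_const)
  show "1 \<le> asymptotic_density S"
  proof (rule ereal_le_epsilon2)
    fix e :: real assume e: "0 < e"
    define \<epsilon> where "\<epsilon> = min 1 (e / 4)"
    have \<epsilon>: "0 < \<epsilon>" "\<epsilon> \<le> 1" "4 * \<epsilon> \<le> e" using e by (auto simp: \<epsilon>_def)
    from win[OF \<epsilon>(1,2)] obtain X0 where "\<forall>X\<ge>X0. real (card ({X<..2 * X} - S)) \<le> \<epsilon> * real X" by blast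
    then have "\<exists>C. \<forall>M. real (card ({1..M} - S)) \<le> C + 3 * \<epsilon> * real M"
      by (intro card_exceptions_le[OF \<epsilon>(1)]) blast
    then obtain C where C: "\<And>M. real (card ({1..M} - S)) \<le> C + 3 * \<epsilon> * real M" by blast
    have "eventually (\<lambda>M. ereal (1 - e) \<le> ereal (real (card (S \<inter> {1..M})) / real M)) sequentially"
      unfolding eventually_sequentially
    proof (intro exI[of _ "nat \<lceil>C / \<epsilon>\<rceil> + 1"] allI impI)
      fix M :: nat assume M: "nat \<lceil>C / \<epsilon>\<rceil> + 1 \<le> M"
      then have "C / \<epsilon> \<le> real M" by linarith
      then have "C \<le> \<epsilon> * real M" using \<epsilon>(1) by (simp add: field_simps)
      moreover have "4 * \<epsilon> * real M \<le> e * real M" using \<epsilon>(3) by (intro mult_right_mono) auto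
      ultimately have "(1 - e) * real M \<le> real (card (S \<inter> {1..M}))"
        unfolding ratio using C[of M] by (simp add: algebra_simps)
      then show "ereal (1 - e) \<le> ereal (real (card (S \<inter> {1..M})) / real M)" using M by (simp add: le_divide_eq)
    qed
    then have "ereal (1 - e) \<le> asymptotic_density S" unfolding asymptotic_density_def by (rule Liminf_bounded)
    then have "ereal (1 - e) + ereal e \<le> asymptotic_density S + ereal e" by (rule add_right_mono)
    then show "1 \<le> asymptotic_density S + ereal e" by (simp add: one_ereal_def)
  qed
qed

theorem theorem1p5:
  fixes \<alpha> :: ereal
  defines "\<alpha> \<equiv> asymptotic_density invariably_prime_generated"
  shows "(ereal (1 - dickman_rho 20) \<le> \<alpha> \<and> 1 - dickman_rho 20 > 1 - 1 / 10 ^ 28) \<and>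
         (riemann_hypothesis \<longrightarrow> \<alpha> = 1) \<and> (cramer_conjecture \<longrightarrow> \<alpha> = 1)"
proof -
  \<comment> \<open>With density 1, part (A) comes down to 0 < rho(20) < 10^-28.\<close>
  have "\<alpha> = 1" unfolding \<alpha>_def by (intro asymptotic_density_eq_1I window_exceptions)
  then show ?thesis using dickman_rho_20 by (simp add: one_ereal_def)
qed

end
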